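(* Let $d=2$, let $\Lambda(k,\ell)=\ell+\tfrac12\ell^2+\mu(k,\ell)$, where $\mu(k,\ell)$ is the leading eigenvalue of $K_{12}^2-k^2A_{12}^2$ on $V_\ell$, and let $\Upsilon(k,s)=\max_{\ell\in\mathbb{R}}[\ell s-\Lambda(k,\ell)]$ be the Legendre transform of $\ell\mapsto\Lambda(k,\ell)$. Then for each fixed real $\ell$, as $k\to0$, $$ \begin{aligned} \Lambda(k,\ell)={}&\frac{\ell(\ell+2)}{2}-\frac{\ell(\ell+2)}{2}k^2+\frac{(\ell-2)\ell(\ell+2)(\ell+4)}{128}k^4+\frac{(\ell-2)\ell(\ell+2)(\ell+4)}{256}k^6\\ &-\frac{(\ell-2)\ell(\ell+2)(\ell+4)(7\ell^4+28\ell^3+36\ell^2+16\ell-5248)}{2097152}k^8\\ &-\frac{(\ell-2)\ell(\ell+2)(\ell+4)(21\ell^4+84\ell^3+108\ell^2+48\ell-7552)}{4194304}k^{10}+O(k^{12}), \end{aligned} $$ and for each fixed real $s$, as $k\to0$, $$ \begin{aligned} \Upsilon(k,s)={}&\frac{(s-1)^2}{2}+\frac{(s-1)(s+1)}{2}k^2-\frac{s^4-74s^2+9}{128}k^4-\frac{(3s^2-14s+3)(3s^2+14s+3)}{256}k^6\\ &+\frac{7s^8+948s^6-211974s^4+1781972s^2-47241}{2097152}k^8\\ &+\frac{133s^8+15244s^6-990274s^4+4389324s^2-67995}{4194304}k^{10}+O(k^{12}). \end{aligned} $$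
   Context: For real $\ell$, $V_\ell$ is the space of smooth functions $v$ on $\mathbb{R}^2\setminus\{0\}$ with $v(rx)=|r|^\ell v(x)$ for all real $r\ne0$. On $V_\ell$, $K_{12}=x_1\partial_{x_2}-x_2\partial_{x_1}$ and $A_{12}=x_1\partial_{x_1}-x_2\partial_{x_2}$. For $k\geq 0$, an eigenvalue of $K_{12}^2-k^2A_{12}^2$ is a number $\mu$ for which there is a non-zero $v\in V_\ell$ with $\mu v=(K_{12}^2-k^2A_{12}^2)v$, and $\mu(k,\ell)$ denotes the largest one (the eigenvalue maximising $\ell+\ell^2/2+\mu$); for small $k$ it is the branch that tends to $0$ as $k\to0$. Restricting functions to the unit circle, parametrised by $x_1=\sin\theta$, $x_2=\cos\theta$, one has $K_{12}=-\frac{d}{d\theta}$ and $A_{12}=-\ell\cos(2\theta)+\sin(2\theta)\frac{d}{d\theta}$, so that the eigenvalue equation reads $$ \mu v=[1-k^2\sin^2(2\theta)]v''+(\ell-1)k^2\sin(4\theta)v'-k^2\ell[2\sin^2(2\theta)+\ell\cos^2(2\theta)]v , $$ and $\mu(k,\ell)$ is the largest $\mu$ for which this equation has a non-zero even $(\pi/2)$-periodic solution. *)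

theory Defs
  imports "HOL-Analysis.Analysis" "HOL-Library.Landau_Symbols"
begin

text \<open>For open \<open>S\<close>, \<open>Ck_on n S f\<close> says that \<open>f\<close> is \<open>n\<close> times continuously differentiable on
  \<open>S\<close>, in terms of iterated directional derivatives.\<close>

primrec Ck_on :: "nat \<Rightarrow> 'a set \<Rightarrow> ('a::real_normed_vector \<Rightarrow> 'b::real_normed_vector) \<Rightarrow> bool" where
  "Ck_on 0 S f \<longleftrightarrow> continuous_on S f"
| "Ck_on (Suc n) S f \<longleftrightarrow>
     (\<forall>x\<in>S. f differentiable (at x)) \<and> (\<forall>u. Ck_on n S (\<lambda>x. frechet_derivative f (at x) u))"

definition smooth_on :: "'a set \<Rightarrow> ('a::real_normed_vector \<Rightarrow> 'b::real_normed_vector) \<Rightarrow> bool" where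
  "smooth_on S f \<longleftrightarrow> (\<forall>n. Ck_on n S f)"

definition pderivative :: "2 \<Rightarrow> (real^2 \<Rightarrow> real) \<Rightarrow> real^2 \<Rightarrow> real" where
  "pderivative i v x = frechet_derivative v (at x) (axis i 1)"

definition K12 :: "(real^2 \<Rightarrow> real) \<Rightarrow> real^2 \<Rightarrow> real" where
  "K12 v x = x$1 * pderivative 2 v x - x$2 * pderivative 1 v x"

definition A12 :: "(real^2 \<Rightarrow> real) \<Rightarrow> real^2 \<Rightarrow> real" where
  "A12 v x = x$1 * pderivative 1 v x - x$2 * pderivative 2 v x"

text \<open>Functions on the punctured plane are total functions here; their value at the origin is
  arbitrary and never used.\<close>

definition V :: "real \<Rightarrow> (real^2 \<Rightarrow> real) set" where
  "V l = {v. smooth_on (- {0}) v \<and> (\<forall>r x. r \<noteq> 0 \<longrightarrow> x \<noteq> 0 \<longrightarrow> v (r *\<^sub>R x) = \<bar>r\<bar> powr l * v x)}"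

definition eigenvalues :: "real \<Rightarrow> real \<Rightarrow> real set" where
  "eigenvalues k l =
     {\<mu>. \<exists>v\<in>V l. (\<exists>x. x \<noteq> 0 \<and> v x \<noteq> 0) \<and>
            (\<forall>x. x \<noteq> 0 \<longrightarrow> \<mu> * v x = K12 (K12 v) x - k\<^sup>2 * A12 (A12 v) x)}"

definition leading_eigenvalue :: "real \<Rightarrow> real \<Rightarrow> real" where
  "leading_eigenvalue k l = (GREATEST \<mu>. \<mu> \<in> eigenvalues k l)"

definition Lam :: "real \<Rightarrow> real \<Rightarrow> real" where
  "Lam k l = l + l\<^sup>2 / 2 + leading_eigenvalue k l"

definition Ups :: "real \<Rightarrow> real \<Rightarrow> real" where
  "Ups k s = (GREATEST y. y \<in> range (\<lambda>l. l * s - Lam k l))"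

end

theory Submission
  imports Defs
begin

text \<open>Restricted to the circle, the eigenvalue equation is a Sturm-Liouville equation. Shooting in the
  spectral parameter yields a positive \<open>(\<pi>/2)\<close>-periodic eigenfunction. By the maximum principle its
  eigenvalue \<open>\<mu>\<close> dominates all others, and \<open>min (L f / f) \<le> \<mu> \<le> max (L f / f)\<close> for every positive trial
  function \<open>f\<close>. Taking for \<open>f\<close> the formal perturbation series truncated after \<open>k\<^sup>1\<^sup>0\<close> gives the
  expansion of \<open>\<Lambda>\<close> with an error \<open>O(k\<^sup>1\<^sup>2)\<close> that is locally uniform in \<open>l\<close>. Coercivity of \<open>\<Lambda>\<close> in \<open>l\<close>
  confines the maximiser of \<open>l s - \<Lambda>(k, l)\<close> to a bounded interval, where the truncated
  expansion is uniformly convex; its value at a point with derivative \<open>O(k\<^sup>6)\<close> is therefore the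
  maximum up to \<open>O(k\<^sup>1\<^sup>2)\<close>.\<close>

section \<open>Linear second-order equations\<close>

text \<open>Because of its first-order term the operator is in general not symmetric with respect to
  dt, so pointwise quotients stand in for Rayleigh quotients. They also suit a leading eigenvalue
  defined as a maximum over all of \<open>V l\<close>: restrictions of such functions to the circle
  are compared as 2 pi-periodic functions, while the positive eigenfunction has the shorter period
  pi/2 of the coefficients, and one comparison covers them all. Conversely, a solution on the circle
  counts as an eigenfunction only after a smooth homogeneous extension to the punctured plane, which
  has no global angle; this is why two branches of the angle appear. Neither analyticity in k nor
  convergence of the perturbation series enters: the truncated series only has to be positive and to
  solve the equation up to k^12 times a bounded residual. Uniformity in l is forced by the Legendre
  transform, whose maximiser may move with k. Outside a bounded set of l the expansion says nothing,
  and there the crude bound from the constant trial function takes over.\<close>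

lemma continuous_imp_antiderivative:
  fixes f :: "real \<Rightarrow> real"
  assumes "continuous_on UNIV f"
  shows "\<exists>F. F 0 = 0 \<and> (\<forall>t. (F has_real_derivative f t) (at t))"
proof -
  \<comment> \<open>An oriented integral: for nonzero \<open>t\<close> one of the two intervals is
    empty, and at 0 both are a point.\<close>
  define F where "F t = integral {0..t} f - integral {t..0} f" for t
  have int: "f integrable_on {a..b}" for a b
    by (intro integrable_continuous_real continuous_on_subset[OF assms]) auto
  have "(F has_real_derivative f t) (at t)" for t
  proof -
    define N where "N = \<bar>t\<bar> + 1"
    have eq: "F u = integral {-N..u} f - integral {-N..0} f" if "u \<in> {-N<..<N}" for u
    proof (cases "u \<ge> 0")
      case True
      then have "integral {-N..0} f + integral {0..u} f = integral {-N..u} f"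
        using that by (intro Henstock_Kurzweil_Integration.integral_combine int) auto
      moreover have "integral {u..0} f = 0"
        using True by (cases "u = 0") auto
      ultimately show ?thesis by (simp add: F_def)
    next
      case False
      then have "integral {-N..u} f + integral {u..0} f = integral {-N..0} f"
        using that by (intro Henstock_Kurzweil_Integration.integral_combine int) auto
      moreover have "integral {0..u} f = 0"
        using False by auto
      ultimately show ?thesis by (simp add: F_def)
    qed
    have "t \<in> {-N<..<N}" by (auto simp: N_def)
    have "((\<lambda>u. integral {-N..u} f) has_real_derivative f t) (at t within {-N..N})"
      using \<open>t \<in> _\<close>
      by (intro integral_has_real_derivative continuous_on_subset[OF assms]) auto
    then have "((\<lambda>u. integral {-N..u} f) has_real_derivative f t) (at t)"
      using \<open>t \<in> _\<close> by (simp add: at_within_Icc_at)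
    then have "((\<lambda>u. integral {-N..u} f - integral {-N..0} f) has_real_derivative f t) (at t)"
      by (auto intro!: derivative_eq_intros)
    then show ?thesis
      by (rule has_field_derivative_transform_within_open[where S = "{-N<..<N}"])
        (use \<open>t \<in> _\<close> eq in auto)
  qed
  moreover have "F 0 = 0" by (simp add: F_def)
  ultimately show ?thesis by blast
qed

lemma DERIV_compose_affine:
  fixes f :: "real \<Rightarrow> real"
  assumes "\<And>u. (f has_real_derivative f' u) (at u)"
  shows "((\<lambda>u. f (a + c * u)) has_real_derivative c * f' (a + c * u)) (at u)"
proof -
  have "((\<lambda>u. a + c * u) has_real_derivative c) (at u)"
    by (auto intro!: derivative_eq_intros)
  from DERIV_chain2[OF assms this] show ?thesis by (simp add: mult.commute)
qed

text \<open>Each integration gains a factor \<open>t / (n + 1)\<close>, the source of the factorials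
  in the Picard estimate. Both functions \<open>c * s ^ Suc n / Suc n - F s\<close> and
  \<open>c * s ^ Suc n / Suc n + F s\<close> are nondecreasing.\<close>

lemma derivative_power_bound_nonneg:
  fixes F :: "real \<Rightarrow> real"
  assumes "F 0 = 0" and F: "\<And>s. (F has_real_derivative f s) (at s)"
    and b: "\<And>s. 0 \<le> s \<Longrightarrow> s \<le> T \<Longrightarrow> \<bar>f s\<bar> \<le> c * s ^ n" and "0 \<le> t" "t \<le> T"
  shows "\<bar>F t\<bar> \<le> c * t ^ Suc n / Suc n"
proof -
  have D: "((\<lambda>s. c * s ^ Suc n / Suc n) has_real_derivative c * s ^ n) (at s)" for s
    by (rule derivative_eq_intros refl | simp add: field_simps del: of_nat_Suc)+
  have "(\<lambda>s. c * s ^ Suc n / Suc n - F s) 0 \<le> (\<lambda>s. c * s ^ Suc n / Suc n - F s) t"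
  proof (rule DERIV_nonneg_imp_nondecreasing[OF \<open>0 \<le> t\<close>])
    fix x assume "0 \<le> x" "x \<le> t"
    then have "0 \<le> c * x ^ n - f x" using b[of x] \<open>t \<le> T\<close> by (simp add: abs_le_iff)
    then show "\<exists>y. ((\<lambda>s. c * s ^ Suc n / Suc n - F s) has_real_derivative y) (at x) \<and> 0 \<le> y"
      using DERIV_diff[OF D F] by blast
  qed
  moreover have "(\<lambda>s. c * s ^ Suc n / Suc n + F s) 0 \<le> (\<lambda>s. c * s ^ Suc n / Suc n + F s) t"
  proof (rule DERIV_nonneg_imp_nondecreasing[OF \<open>0 \<le> t\<close>])
    fix x assume "0 \<le> x" "x \<le> t"
    then have "0 \<le> c * x ^ n + f x" using b[of x] \<open>t \<le> T\<close> by (simp add: abs_le_iff)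
    then show "\<exists>y. ((\<lambda>s. c * s ^ Suc n / Suc n + F s) has_real_derivative y) (at x) \<and> 0 \<le> y"
      using DERIV_add[OF D F] by blast
  qed
  ultimately show ?thesis using \<open>F 0 = 0\<close> by (simp add: abs_le_iff)
qed

lemma derivative_power_bound:
  fixes F :: "real \<Rightarrow> real"
  assumes "F 0 = 0" and F: "\<And>s. (F has_real_derivative f s) (at s)"
    and b: "\<And>s. \<bar>s\<bar> \<le> T \<Longrightarrow> \<bar>f s\<bar> \<le> c * \<bar>s\<bar> ^ n" and "\<bar>t\<bar> \<le> T"
  shows "\<bar>F t\<bar> \<le> c * \<bar>t\<bar> ^ Suc n / Suc n"
proof (cases "t \<ge> 0")
  case True
  have "\<bar>F t\<bar> \<le> c * t ^ Suc n / Suc n"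
  proof (rule derivative_power_bound_nonneg[OF assms(1) F _ True])
    show "\<bar>f s\<bar> \<le> c * s ^ n" if "0 \<le> s" "s \<le> T" for s
      using b[of s] that by simp
  qed (use True \<open>\<bar>t\<bar> \<le> T\<close> in auto)
  with True show ?thesis by simp
next
  case False
  have "\<bar>F (- (-t))\<bar> \<le> c * (-t) ^ Suc n / Suc n"
  proof (rule derivative_power_bound_nonneg[where F = "\<lambda>s. F (-s)" and f = "\<lambda>s. - f (-s)"])
    fix s
    show "((\<lambda>s. F (- s)) has_real_derivative - f (- s)) (at s)"
      using DERIV_compose_affine[OF F, of 0 "-1"] by simp
    show "\<bar>- f (- s)\<bar> \<le> c * s ^ n" if "0 \<le> s" "s \<le> T"
      using b[of "-s"] that by simp
  qed (use False assms in auto)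
  with False show ?thesis by simp
qed

definition solves_ode ::
  "(real \<Rightarrow> real) \<Rightarrow> (real \<Rightarrow> real) \<Rightarrow> (real \<Rightarrow> real) \<Rightarrow> (real \<Rightarrow> real) \<Rightarrow> bool" where
  "solves_ode p q y z \<longleftrightarrow>
     (\<forall>t. (y has_real_derivative z t) (at t) \<and>
          (z has_real_derivative p t * z t + q t * y t) (at t))"

text \<open>Picard iteration, organised by increments: each pair \<open>(y n, z n)\<close> is
  integrated to give the next one, and the solution is the sum of all pairs. Linearity gives bounds
  \<open>(K * \<bar>t\<bar>) ^ n / fact n\<close> on every bounded interval, hence a solution on the
  whole line.\<close>

theorem linear_ode_exists:
  fixes p q :: "real \<Rightarrow> real"
  assumes p: "continuous_on UNIV p" and q: "continuous_on UNIV q"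
  shows "\<exists>y z. solves_ode p q y z \<and> y 0 = 1 \<and> z 0 = 0"
proof -
  define good where "good f \<longleftrightarrow> continuous_on UNIV (fst f) \<and> continuous_on UNIV (snd f)"
    for f :: "(real \<Rightarrow> real) \<times> (real \<Rightarrow> real)"
  define nxt where "nxt f g \<longleftrightarrow> fst g 0 = 0 \<and> snd g 0 = 0 \<and>
      (\<forall>t. (fst g has_real_derivative snd f t) (at t) \<and>
        (snd g has_real_derivative p t * snd f t + q t * fst f t) (at t))" for f g
  have ex: "\<exists>g. good g \<and> nxt f g" if f: "good f" for f
  proof -
    obtain a where a: "a 0 = 0" "\<And>t. (a has_real_derivative snd f t) (at t)"
      using continuous_imp_antiderivative[of "snd f"] f unfolding good_def by metis
    have "continuous_on UNIV (\<lambda>t. p t * snd f t + q t * fst f t)"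
      using that p q unfolding good_def by (intro continuous_intros) auto
    then obtain b where b: "b 0 = 0"
      "\<And>t. (b has_real_derivative p t * snd f t + q t * fst f t) (at t)"
      using continuous_imp_antiderivative[of "\<lambda>t. p t * snd f t + q t * fst f t"] by metis
    have "continuous_on UNIV a" "continuous_on UNIV b"
      using DERIV_continuous_on[of UNIV a "snd f"] DERIV_continuous_on[of UNIV b "\<lambda>t. p t * snd f t + q t * fst f t"] a b
      by auto
    then show ?thesis using a b by (intro exI[of _ "(a, b)"]) (simp add: good_def nxt_def)
  qed
  have "\<exists>F. good (F 0) \<and> F 0 = (\<lambda>_. 1, \<lambda>_. 0) \<and> (\<forall>n. good (F n) \<and> nxt (F n) (F (Suc n)))"
  proof -
    have "\<exists>F. \<forall>n. (good (F n) \<and> (n = 0 \<longrightarrow> F n = (\<lambda>_. 1, \<lambda>_. 0))) \<and> nxt (F n) (F (Suc n))"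
    proof (rule dependent_nat_choice)
      show "\<exists>x. good x \<and> ((0::nat) = 0 \<longrightarrow> x = (\<lambda>_. 1, \<lambda>_. 0))"
        by (auto simp: good_def)
      show "\<exists>y. (good y \<and> (Suc n = 0 \<longrightarrow> y = (\<lambda>_. 1, \<lambda>_. 0))) \<and> nxt x y"
        if "good x \<and> (n = 0 \<longrightarrow> x = (\<lambda>_. 1, \<lambda>_. 0))" for x n
        using ex[of x] that by auto
    qed
    then obtain F where "\<forall>n. (good (F n) \<and> (n = 0 \<longrightarrow> F n = (\<lambda>_. 1, \<lambda>_. 0))) \<and> nxt (F n) (F (Suc n))" ..
    then show ?thesis by (intro exI[of _ F]) blast
  qed
  then obtain F where F0: "F 0 = (\<lambda>_. 1, \<lambda>_. 0)" and nxt: "\<And>n. nxt (F n) (F (Suc n))"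
    by blast
  define y where "y n = fst (F n)" for n
  define z where "z n = snd (F n)" for n
  have y0: "y 0 = (\<lambda>_. 1)" and z0: "z 0 = (\<lambda>_. 0)" using F0 by (auto simp: y_def z_def)
  have ys: "y (Suc n) 0 = 0" and zs: "z (Suc n) 0 = 0"
    and yd: "(y (Suc n) has_real_derivative z n t) (at t)"
    and zd: "(z (Suc n) has_real_derivative p t * z n t + q t * y n t) (at t)" for n t
    using nxt[of n] by (auto simp: nxt_def y_def z_def)
  have loc: "\<exists>K. \<forall>n t. \<bar>t\<bar> \<le> T \<longrightarrow> \<bar>y n t\<bar> \<le> (K * \<bar>t\<bar>) ^ n / fact n \<and> \<bar>z n t\<bar> \<le> (K * \<bar>t\<bar>) ^ n / fact n"
    for T
  proof -
    have "compact ((\<lambda>t. \<bar>p t\<bar> + \<bar>q t\<bar>) ` {-T..T})"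
      by (intro compact_continuous_image continuous_intros continuous_on_subset[OF p]
          continuous_on_subset[OF q]) auto
    then obtain K0 where K0: "\<And>t. t \<in> {-T..T} \<Longrightarrow> \<bar>p t\<bar> + \<bar>q t\<bar> \<le> K0"
      using bounded_real[of "(\<lambda>t. \<bar>p t\<bar> + \<bar>q t\<bar>) ` {-T..T}"] compact_imp_bounded by fastforce
    \<comment> \<open>With \<open>K \<ge> 1\<close> a single constant serves both components: the
      increment of \<open>y\<close> has no coefficient of its own, that of \<open>z\<close> has
      \<open>p\<close> and \<open>q\<close>.\<close>
    define K where "K = max 1 K0"
    have K: "\<bar>p t\<bar> + \<bar>q t\<bar> \<le> K" if "\<bar>t\<bar> \<le> T" for t
      using K0[of t] that by (auto simp: K_def abs_le_iff)
    have "K \<ge> 1" by (simp add: K_def)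
    have "\<forall>t. \<bar>t\<bar> \<le> T \<longrightarrow> \<bar>y n t\<bar> \<le> (K * \<bar>t\<bar>) ^ n / fact n \<and> \<bar>z n t\<bar> \<le> (K * \<bar>t\<bar>) ^ n / fact n" for n
    proof (induction n)
      case 0
      then show ?case by (simp add: y0 z0)
    next
      case (Suc n)
      have eq: "(K * \<bar>t\<bar>) ^ Suc n / fact (Suc n) = K ^ Suc n / fact n * \<bar>t\<bar> ^ Suc n / Suc n" for t
        by (simp add: power_mult_distrib mult_ac)
      have b: "(K * \<bar>s\<bar>) ^ n / fact n * K \<le> K ^ Suc n / fact n * \<bar>s\<bar> ^ n" for s
        by (simp add: power_mult_distrib mult_ac)
      have "\<bar>z n s\<bar> \<le> K ^ Suc n / fact n * \<bar>s\<bar> ^ n" if "\<bar>s\<bar> \<le> T" for s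
      proof -
        have "\<bar>z n s\<bar> \<le> (K * \<bar>s\<bar>) ^ n / fact n * 1" using Suc that by simp
        also have "\<dots> \<le> (K * \<bar>s\<bar>) ^ n / fact n * K"
          using \<open>K \<ge> 1\<close> by (intro mult_left_mono) auto
        finally show ?thesis using b[of s] by linarith
      qed
      moreover have "\<bar>p s * z n s + q s * y n s\<bar> \<le> K ^ Suc n / fact n * \<bar>s\<bar> ^ n" if "\<bar>s\<bar> \<le> T" for s
      proof -
        have "\<bar>p s * z n s + q s * y n s\<bar> \<le> \<bar>p s\<bar> * \<bar>z n s\<bar> + \<bar>q s\<bar> * \<bar>y n s\<bar>"
          using abs_triangle_ineq[of "p s * z n s" "q s * y n s"] by (simp add: abs_mult)
        also have "\<dots> \<le> \<bar>p s\<bar> * ((K * \<bar>s\<bar>) ^ n / fact n) + \<bar>q s\<bar> * ((K * \<bar>s\<bar>) ^ n / fact n)"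
          using Suc that by (intro add_mono mult_left_mono) auto
        also have "\<dots> = (K * \<bar>s\<bar>) ^ n / fact n * (\<bar>p s\<bar> + \<bar>q s\<bar>)"
          by (simp only: distrib_left mult.commute[of "_ / _"])
        also have "\<dots> \<le> (K * \<bar>s\<bar>) ^ n / fact n * K"
          using K[OF that] \<open>K \<ge> 1\<close> by (intro mult_left_mono) auto
        finally show ?thesis using b[of s] by linarith
      qed
      ultimately show ?case
        unfolding eq using derivative_power_bound[OF ys yd] derivative_power_bound[OF zs zd] by metis
    qed
    then show ?thesis by blast
  qed
  have unif: "uniform_limit {-T..T} (\<lambda>n t. \<Sum>i<n. y i t) (\<lambda>t. \<Sum>i. y i t) sequentially"
      "uniform_limit {-T..T} (\<lambda>n t. \<Sum>i<n. z i t) (\<lambda>t. \<Sum>i. z i t) sequentially" for T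
  proof -
    from loc obtain K where K: "\<And>n t. \<bar>t\<bar> \<le> T \<Longrightarrow> \<bar>y n t\<bar> \<le> (K * \<bar>t\<bar>) ^ n / fact n"
      "\<And>n t. \<bar>t\<bar> \<le> T \<Longrightarrow> \<bar>z n t\<bar> \<le> (K * \<bar>t\<bar>) ^ n / fact n" by blast
    have M: "(K * \<bar>t\<bar>) ^ n / fact n \<le> (\<bar>K\<bar> * \<bar>T\<bar>) ^ n / fact n" if "\<bar>t\<bar> \<le> T" for n t
    proof (rule divide_right_mono)
      have "(K * \<bar>t\<bar>) ^ n \<le> \<bar>K * \<bar>t\<bar>\<bar> ^ n" by (metis abs_ge_self power_abs)
      also have "\<dots> \<le> (\<bar>K\<bar> * \<bar>T\<bar>) ^ n"
        using that by (intro power_mono) (auto simp: abs_mult intro!: mult_mono)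
      finally show "(K * \<bar>t\<bar>) ^ n \<le> (\<bar>K\<bar> * \<bar>T\<bar>) ^ n" .
    qed auto
    have sm: "summable (\<lambda>n. (\<bar>K\<bar> * \<bar>T\<bar>) ^ n / fact n)"
      using summable_exp[of "\<bar>K\<bar> * \<bar>T\<bar>"] by (simp add: field_simps)
    have "norm (y n t) \<le> (\<bar>K\<bar> * \<bar>T\<bar>) ^ n / fact n" "norm (z n t) \<le> (\<bar>K\<bar> * \<bar>T\<bar>) ^ n / fact n"
      if "t \<in> {-T..T}" for n t
    proof -
      have "\<bar>t\<bar> \<le> T" using that by auto
      from K(1)[OF this, of n] K(2)[OF this, of n] M[OF this, of n]
      show "norm (y n t) \<le> (\<bar>K\<bar> * \<bar>T\<bar>) ^ n / fact n" "norm (z n t) \<le> (\<bar>K\<bar> * \<bar>T\<bar>) ^ n / fact n"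
        unfolding real_norm_def by linarith+
    qed
    then show "uniform_limit {-T..T} (\<lambda>n t. \<Sum>i<n. y i t) (\<lambda>t. \<Sum>i. y i t) sequentially"
      "uniform_limit {-T..T} (\<lambda>n t. \<Sum>i<n. z i t) (\<lambda>t. \<Sum>i. z i t) sequentially"
      by (intro Weierstrass_m_test[OF _ sm]; blast)+
  qed
  \<comment> \<open>Derivatives of the increments. The index shift turns a partial sum of
    derivatives into a partial sum with one term fewer of the original series, so its uniform
    convergence is already known.\<close>
  define y' where "y' i t = (case i of 0 \<Rightarrow> 0 | Suc n \<Rightarrow> z n t)" for i t
  define z' where "z' i t = (case i of 0 \<Rightarrow> 0 | Suc n \<Rightarrow> p t * z n t + q t * y n t)" for i t
  define Y where "Y t = (\<Sum>i. y i t)" for t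
  define Z where "Z t = (\<Sum>i. z i t)" for t
  have sums_shift: "(\<Sum>i<n. y' i t) = (\<Sum>i<n-1. z i t)"
     "(\<Sum>i<n. z' i t) = p t * (\<Sum>i<n-1. z i t) + q t * (\<Sum>i<n-1. y i t)" for n t
    by (cases n; simp add: y'_def z'_def sum.lessThan_Suc_shift sum_distrib_left sum.distrib
        del: sum.lessThan_Suc)+
  have lim_pred: "filterlim (\<lambda>n::nat. n - 1) sequentially sequentially"
    by (rule filterlim_minus_const_nat_at_top)
  have D: "(Y has_real_derivative Z t) (at t) \<and> (Z has_real_derivative p t * Z t + q t * Y t) (at t)" for t
  proof -
    define T where "T = \<bar>t\<bar> + 1"
    have t: "t \<in> interior {-T..T}" by (auto simp: T_def)
    have u1: "uniform_limit {-T..T} (\<lambda>n t. \<Sum>i<n. y' i t) Z sequentially"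
      unfolding sums_shift Z_def
      using filterlim_compose[OF unif(2)[of T, unfolded] lim_pred] by simp
    have bp: "bounded (p ` {-T..T})" and bq: "bounded (q ` {-T..T})"
      by (intro compact_imp_bounded compact_continuous_image continuous_on_subset[OF p]
         continuous_on_subset[OF q]; simp)+
    have y'd: "(y n has_real_derivative y' n x) (at x)" for n x
      by (cases n) (use yd in \<open>simp_all add: y0 y'_def\<close>)
    have z'd: "(z n has_real_derivative z' n x) (at x)" for n x
      by (cases n) (use zd in \<open>simp_all add: z0 z'_def\<close>)
    have cy: "continuous_on UNIV (y n)" and cz: "continuous_on UNIV (z n)" for n
      using DERIV_continuous_on[of UNIV "y n", OF has_field_derivative_at_within[OF y'd]]
        DERIV_continuous_on[of UNIV "z n", OF has_field_derivative_at_within[OF z'd]] by auto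
    have "continuous_on {-T..T} Y" "continuous_on {-T..T} Z"
      unfolding Y_def Z_def
      by (rule uniform_limit_theorem[OF _ unif(1)[of T]] uniform_limit_theorem[OF _ unif(2)[of T]];
          auto intro!: always_eventually continuous_on_sum continuous_on_subset[OF cy] continuous_on_subset[OF cz])+
    then have bY: "bounded (Y ` {-T..T})" and bZ: "bounded (Z ` {-T..T})"
      by (auto intro!: compact_imp_bounded compact_continuous_image)
    have u2: "uniform_limit {-T..T} (\<lambda>n t. \<Sum>i<n. z' i t) (\<lambda>t. p t * Z t + q t * Y t) sequentially"
      unfolding sums_shift
      by (intro uniform_limit_add bounded_bilinear.bounded_uniform_limit[OF bounded_bilinear_mult]
          uniform_limit_const bp bq bY bZ)
        (use filterlim_compose[OF unif(1)[of T] lim_pred] filterlim_compose[OF unif(2)[of T] lim_pred]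
          in \<open>auto simp: Y_def Z_def\<close>)
    have "0 \<in> {-T..T}" by (simp add: T_def)
    have "y n 0 = 0" "z n 0 = 0" if "n \<notin> {0}" for n
      using that ys zs by (cases n; simp)+
    then have s0: "summable (\<lambda>n. y n 0)" "summable (\<lambda>n. z n 0)"
      by (blast intro: summable_finite[of "{0}"])+
    obtain g1 where g1: "\<And>x. x \<in> {-T..T} \<Longrightarrow>
        (\<lambda>n. y n x) sums g1 x \<and> (g1 has_field_derivative Z x) (at x within {-T..T})"
      using has_field_derivative_series[of "{-T..T}" y y' Z 0]
        has_field_derivative_at_within[OF y'd] u1 s0(1) \<open>0 \<in> {-T..T}\<close> convex_real_interval(5)
      by metis
    obtain g2 where g2: "\<And>x. x \<in> {-T..T} \<Longrightarrow> (\<lambda>n. z n x) sums g2 x \<and>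
        (g2 has_field_derivative p x * Z x + q x * Y x) (at x within {-T..T})"
      using has_field_derivative_series[of "{-T..T}" z z' "\<lambda>t. p t * Z t + q t * Y t" 0]
        has_field_derivative_at_within[OF z'd] u2 s0(2) \<open>0 \<in> {-T..T}\<close> convex_real_interval(5)
      by metis
    have e: "g1 x = Y x" "g2 x = Z x" if "x \<in> {-T<..<T}" for x
      using g1[of x] g2[of x] that by (auto simp: Y_def Z_def sums_iff)
    have "(g1 has_field_derivative Z t) (at t)" "(g2 has_field_derivative p t * Z t + q t * Y t) (at t)"
      using g1[of t] g2[of t] t by (auto simp: at_within_interior[OF t])
    then show ?thesis
      using e t by (auto intro: has_field_derivative_transform_within_open[where S="{-T<..<T}"])
  qed
  have "Y 0 = 1" "Z 0 = 0"
  proof -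
    have "(\<lambda>n. y n 0) sums (\<Sum>n\<in>{0}. y n 0)" "(\<lambda>n. z n 0) sums (\<Sum>n\<in>{0}. z n 0)"
      using ys zs by (intro sums_finite; metis not0_implies_Suc finite.intros singletonI)+
    then show "Y 0 = 1" "Z 0 = 0" by (auto simp: Y_def Z_def y0 z0 sums_iff)
  qed
  with D show ?thesis unfolding solves_ode_def by blast
qed

text \<open>Gronwall's inequality for \<open>E = y\<^sup>2 + z\<^sup>2\<close>. The rate
  \<open>2 + 3 * K\<close> collects one unit each from \<open>2 y z\<close> and from the source
  \<open>2 z r\<close>, then \<open>2 K\<close> from \<open>p\<close> and \<open>K\<close> from
  \<open>q\<close>. The source \<open>r\<close> is what makes the estimate usable for differences of
  solutions with different parameters.\<close>

lemma energy_growth: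
  fixes y z r p q :: "real \<Rightarrow> real"
  assumes D: "\<And>t. 0 \<le> t \<Longrightarrow> t \<le> h \<Longrightarrow> (y has_real_derivative z t) (at t)"
      "\<And>t. 0 \<le> t \<Longrightarrow> t \<le> h \<Longrightarrow> (z has_real_derivative p t * z t + q t * y t + r t) (at t)"
    and b: "\<And>t. 0 \<le> t \<Longrightarrow> t \<le> h \<Longrightarrow> \<bar>p t\<bar> \<le> K \<and> \<bar>q t\<bar> \<le> K \<and> \<bar>r t\<bar> \<le> \<delta>"
    and t: "0 \<le> t" "t \<le> h"
  shows "(y t)\<^sup>2 + (z t)\<^sup>2 \<le> ((y 0)\<^sup>2 + (z 0)\<^sup>2 + \<delta>\<^sup>2 * t) * exp ((2 + 3 * K) * t)"
proof -
  define L where "L = 2 + 3 * K"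
  define E where "E s = (y s)\<^sup>2 + (z s)\<^sup>2" for s
  define E' where "E' s = 2 * y s * z s + 2 * z s * (p s * z s + q s * y s + r s)" for s
  have "K \<ge> 0" using b[of 0] t by auto
  have *: "\<delta>\<^sup>2 * 0 - E 0 * exp (- (L * 0)) \<le> \<delta>\<^sup>2 * t - E t * exp (- (L * t))"
  proof (rule DERIV_nonneg_imp_nondecreasing[OF t(1)])
    fix s assume s: "0 \<le> s" "s \<le> t"
    then have s': "0 \<le> s" "s \<le> h" using t by auto
    have "((\<lambda>s. \<delta>\<^sup>2 * s - E s * exp (- (L * s))) has_real_derivative
           \<delta>\<^sup>2 - (E' s - L * E s) * exp (- (L * s))) (at s)"
      unfolding E_def E'_def
      by (rule derivative_eq_intros D[OF s'] refl | simp add: algebra_simps power2_eq_square)+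
    moreover have "E' s - L * E s \<le> \<delta>\<^sup>2"
    proof -
      have ab: "2 * (a * b) \<le> a\<^sup>2 + b\<^sup>2" for a b :: real
        using sum_squares_bound[of a b] by simp
      have 1: "2 * y s * z s \<le> E s" using ab[of "y s" "z s"] by (simp add: E_def)
      have "p s * (z s)\<^sup>2 \<le> K * E s"
        unfolding E_def using b[OF s'] \<open>K \<ge> 0\<close> by (intro mult_mono) auto
      then have 2: "2 * z s * (p s * z s) \<le> 2 * K * E s" by (simp add: power2_eq_square algebra_simps)
      have "q s * (2 * (z s * y s)) \<le> \<bar>q s\<bar> * \<bar>2 * (z s * y s)\<bar>"
        by (metis abs_ge_self abs_mult)
      also have "\<dots> \<le> K * E s"
      proof (intro mult_mono)
        show "\<bar>2 * (z s * y s)\<bar> \<le> E s"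
          unfolding E_def abs_le_iff using ab[of "z s" "y s"] ab[of "- z s" "y s"] by auto
      qed (use b[OF s'] \<open>K \<ge> 0\<close> in auto)
      finally have 3: "2 * z s * (q s * y s) \<le> K * E s" by (simp add: algebra_simps)
      have "(r s)\<^sup>2 \<le> \<delta>\<^sup>2" using b[OF s'] by (metis abs_ge_zero power2_abs power_mono)
      then have 4: "2 * z s * r s \<le> \<delta>\<^sup>2 + E s" using ab[of "z s" "r s"] zero_le_power2[of "y s"]
        unfolding E_def mult.assoc by linarith
      have "E' s = 2 * y s * z s + 2 * z s * (p s * z s) + 2 * z s * (q s * y s) + 2 * z s * r s"
        by (simp add: E'_def algebra_simps)
      also have "\<dots> \<le> E s + 2 * K * E s + K * E s + (\<delta>\<^sup>2 + E s)" using 1 2 3 4 by linarith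
      also have "\<dots> = L * E s + \<delta>\<^sup>2" by (simp add: L_def algebra_simps)
      finally show ?thesis by simp
    qed
    then have "(E' s - L * E s) * exp (- (L * s)) \<le> \<delta>\<^sup>2 * 1"
      using s \<open>K \<ge> 0\<close> by (intro mult_mono) (auto simp: L_def)
    ultimately show "\<exists>y. ((\<lambda>s. \<delta>\<^sup>2 * s - E s * exp (- (L * s))) has_real_derivative y) (at s) \<and> 0 \<le> y"
      by (intro exI conjI) auto
  qed
  then have "E t * exp (- (L * t)) \<le> E 0 + \<delta>\<^sup>2 * t" by simp
  then have "E t * exp (- (L * t)) * exp (L * t) \<le> (E 0 + \<delta>\<^sup>2 * t) * exp (L * t)"
    by (intro mult_right_mono) auto
  then have "E t \<le> (E 0 + \<delta>\<^sup>2 * t) * exp (L * t)"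
    by (simp add: mult.assoc flip: exp_add)
  then show ?thesis by (simp add: E_def L_def)
qed

section \<open>Uniqueness, reflection and dependence on a parameter\<close>

lemma continuous_bounded_Icc:
  fixes f :: "real \<Rightarrow> real"
  assumes "continuous_on UNIV f"
  shows "\<exists>K. \<forall>t\<in>{a..b}. \<bar>f t\<bar> \<le> K"
proof -
  have "bounded (f ` {a..b})"
    by (intro compact_imp_bounded compact_continuous_image continuous_on_subset[OF assms]) auto
  then show ?thesis by (auto simp: bounded_real)
qed

text \<open>The energy estimate runs forward from 0 only; the substitution
  \<open>u \<mapsto> a + \<sigma> * u\<close> with \<open>\<sigma>\<close> = 1 or -1 moves the
  starting point to \<open>a\<close> and reverses time when \<open>t < a\<close>.\<close>

lemma linear_ode_zero:
  assumes p: "continuous_on UNIV p" and q: "continuous_on UNIV q"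
    and s: "solves_ode p q y z" and "y a = 0" "z a = 0"
  shows "y t = 0 \<and> z t = 0"
proof -
  define \<sigma> where "\<sigma> = (if t \<ge> a then 1 else -1 :: real)"
  define h where "h = \<bar>t - a\<bar>"
  obtain Kp where Kp: "\<bar>p u\<bar> \<le> Kp" if "u \<in> {a - h..a + h}" for u
    using continuous_bounded_Icc[OF p] by blast
  obtain Kq where Kq: "\<bar>q u\<bar> \<le> Kq" if "u \<in> {a - h..a + h}" for u
    using continuous_bounded_Icc[OF q] by blast
  have ss: "\<sigma> * \<sigma> = 1" and s1: "\<bar>\<sigma>\<bar> = 1" by (auto simp: \<sigma>_def)
  have yd: "(y has_real_derivative z u) (at u)"
    and zd: "(z has_real_derivative p u * z u + q u * y u) (at u)" for u
    using s by (auto simp: solves_ode_def)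
  have "(y (a + \<sigma> * h))\<^sup>2 + (\<sigma> * z (a + \<sigma> * h))\<^sup>2
     \<le> ((y (a + \<sigma> * 0))\<^sup>2 + (\<sigma> * z (a + \<sigma> * 0))\<^sup>2 + 0\<^sup>2 * h) * exp ((2 + 3 * (max Kp Kq)) * h)"
  proof (rule energy_growth[where h = h and r = "\<lambda>_. 0" and p = "\<lambda>s. \<sigma> * p (a + \<sigma> * s)" and q = "\<lambda>s. q (a + \<sigma> * s)"])
    fix u assume u: "0 \<le> u" "u \<le> h"
    show "((\<lambda>u. y (a + \<sigma> * u)) has_real_derivative \<sigma> * z (a + \<sigma> * u)) (at u)"
      by (rule DERIV_compose_affine[OF yd])
    have "((\<lambda>u. \<sigma> * z (a + \<sigma> * u)) has_real_derivative \<sigma> * (\<sigma> * (p (a + \<sigma> * u) * z (a + \<sigma> * u) + q (a + \<sigma> * u) * y (a + \<sigma> * u)))) (at u)"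
      by (intro DERIV_cmult DERIV_compose_affine[OF zd])
    then show "((\<lambda>u. \<sigma> * z (a + \<sigma> * u)) has_real_derivative
             \<sigma> * p (a + \<sigma> * u) * (\<sigma> * z (a + \<sigma> * u)) + q (a + \<sigma> * u) * y (a + \<sigma> * u) + 0) (at u)"
      by (rule DERIV_cong) (use ss in algebra)
    have "a + \<sigma> * u \<in> {a - h..a + h}" using u by (auto simp: \<sigma>_def)
    then show "\<bar>\<sigma> * p (a + \<sigma> * u)\<bar> \<le> max Kp Kq \<and> \<bar>q (a + \<sigma> * u)\<bar> \<le> max Kp Kq \<and> \<bar>0::real\<bar> \<le> 0"
      using Kp Kq s1 by (auto simp: abs_mult le_max_iff_disj)
  qed (auto simp: h_def)
  moreover have "a + \<sigma> * h = t" by (auto simp: \<sigma>_def h_def)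
  ultimately have "(y t)\<^sup>2 + (\<sigma> * z t)\<^sup>2 \<le> 0" using assms by simp
  then have "y t = 0 \<and> \<sigma> * z t = 0" by (simp add: sum_power2_le_zero_iff)
  with s1 show ?thesis by auto
qed

lemma solves_odeD:
  assumes "solves_ode p q y z"
  shows "(y has_real_derivative z t) (at t)"
    and "(z has_real_derivative p t * z t + q t * y t) (at t)"
    and "continuous_on S y" and "continuous_on S z"
proof -
  show y: "(y has_real_derivative z t) (at t)" and z: "(z has_real_derivative p t * z t + q t * y t) (at t)" for t
    using assms by (auto simp: solves_ode_def)
  show "continuous_on S y" "continuous_on S z"
    using DERIV_continuous_on[OF has_field_derivative_at_within[OF y]]
      DERIV_continuous_on[OF has_field_derivative_at_within[OF z]] by auto
qed

lemma linear_ode_unique: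
  assumes p: "continuous_on UNIV p" and q: "continuous_on UNIV q"
    and "solves_ode p q y z" "solves_ode p q u v" "y a = u a" "z a = v a"
  shows "y t = u t \<and> z t = v t"
proof -
  have "solves_ode p q (\<lambda>t. y t - u t) (\<lambda>t. z t - v t)"
    using assms unfolding solves_ode_def
    by (auto intro!: DERIV_diff elim!: DERIV_cong[OF DERIV_diff] simp: algebra_simps)
  from linear_ode_zero[OF p q this, of a t] show ?thesis using assms by simp
qed

text \<open>Reflection about \<open>c / 2\<close>. Taking \<open>c = 0\<close> and
  \<open>c = 2 * h\<close> turns Neumann conditions at 0 and \<open>h\<close> into symmetries of the
  solution.\<close>

lemma solves_ode_reflect:
  assumes s: "solves_ode p q y z"
    and p: "\<And>t. p (c - t) = - p t" and q: "\<And>t. q (c - t) = q t"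
  shows "solves_ode p q (\<lambda>t. y (c - t)) (\<lambda>t. - z (c - t))"
  unfolding solves_ode_def
proof (intro allI conjI)
  fix t
  show "((\<lambda>t. y (c - t)) has_real_derivative - z (c - t)) (at t)"
    using DERIV_compose_affine[OF solves_odeD(1)[OF s], of c "-1" t] by simp
  have "((\<lambda>t. - z (c - t)) has_real_derivative p (c - t) * z (c - t) + q (c - t) * y (c - t)) (at t)"
    using DERIV_minus[OF DERIV_compose_affine[OF solves_odeD(2)[OF s], of c "-1" t]]
    by (simp only: mult_minus1 minus_minus add_uminus_conv_diff)
  then show "((\<lambda>t. - z (c - t)) has_real_derivative p t * - z (c - t) + q t * y (c - t)) (at t)"
    by (simp add: p q)
qed

text \<open>The difference of the solutions for \<open>\<nu>\<close> and \<open>\<mu>\<close> has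
  zero initial data and solves the equation for \<open>\<nu>\<close> with source
  \<open>(\<nu> - \<mu>) * w * y \<mu>\<close>, so its energy is at most a constant times the square
  of \<open>\<nu> - \<mu>\<close>.\<close>

lemma linear_ode_parameter_continuity:
  fixes p q w :: "real \<Rightarrow> real"
  assumes p: "continuous_on UNIV p" and q: "continuous_on UNIV q" and w: "continuous_on UNIV w"
    and s: "\<And>\<mu>. solves_ode p (\<lambda>t. q t + \<mu> * w t) (y \<mu>) (z \<mu>)" "\<And>\<mu>. y \<mu> 0 = 1" "\<And>\<mu>. z \<mu> 0 = 0"
    and "0 \<le> h" "0 < e"
  shows "\<exists>d>0. \<forall>\<nu>. \<bar>\<nu> - \<mu>\<bar> < d \<longrightarrow> (\<forall>t\<in>{0..h}. \<bar>y \<nu> t - y \<mu> t\<bar> < e \<and> \<bar>z \<nu> t - z \<mu> t\<bar> < e)"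
proof -
  obtain Kp where Kp: "\<bar>p u\<bar> \<le> Kp" if "u \<in> {0..h}" for u
    using continuous_bounded_Icc[OF p] by blast
  obtain Kq where Kq: "\<bar>q u\<bar> \<le> Kq" if "u \<in> {0..h}" for u
    using continuous_bounded_Icc[OF q] by blast
  obtain Kw where Kw: "\<bar>w u\<bar> \<le> Kw" if "u \<in> {0..h}" for u
    using continuous_bounded_Icc[OF w] by blast
  have "continuous_on UNIV (y \<mu>)" using solves_odeD(3)[OF s(1)] .
  then obtain Ky where Ky: "\<bar>y \<mu> u\<bar> \<le> Ky" if "u \<in> {0..h}" for u
    using continuous_bounded_Icc by blast
  define K where "K = max Kp (Kq + (\<bar>\<mu>\<bar> + 1) * Kw)"
  define C where "C = (Kw * Ky)\<^sup>2 * h * exp ((2 + 3 * K) * h)"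
  have K0: "0 \<le> Kp" "0 \<le> Kq" "0 \<le> Kw" "0 \<le> Ky"
    using Kp[of 0] Kq[of 0] Kw[of 0] Ky[of 0] \<open>0 \<le> h\<close> by auto
  then have "K \<ge> 0" by (auto simp: K_def le_max_iff_disj)
  have "C \<ge> 0" using \<open>0 \<le> h\<close> by (simp add: C_def)
  \<comment> \<open>The 1 keeps \<open>\<nu>\<close> in the range where \<open>K\<close> bounds the
    coefficients; \<open>C + 1\<close> instead of \<open>C\<close> keeps the quotient meaningful
    when \<open>C\<close> vanishes.\<close>
  define d where "d = min 1 (e / sqrt (C + 1))"
  have "d > 0" using \<open>C \<ge> 0\<close> \<open>0 < e\<close> by (simp add: d_def)
  moreover have "\<bar>y \<nu> t - y \<mu> t\<bar> < e \<and> \<bar>z \<nu> t - z \<mu> t\<bar> < e"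
    if \<nu>: "\<bar>\<nu> - \<mu>\<bar> < d" and t: "t \<in> {0..h}" for \<nu> t
  proof -
    have d1: "\<bar>\<nu> - \<mu>\<bar> < 1" "\<bar>\<nu> - \<mu>\<bar> < e / sqrt (C + 1)" using \<nu> by (auto simp: d_def)
    have "(y \<nu> t - y \<mu> t)\<^sup>2 + (z \<nu> t - z \<mu> t)\<^sup>2 \<le>
        ((y \<nu> 0 - y \<mu> 0)\<^sup>2 + (z \<nu> 0 - z \<mu> 0)\<^sup>2 + (\<bar>\<nu> - \<mu>\<bar> * (Kw * Ky))\<^sup>2 * t) * exp ((2 + 3 * K) * t)"
    proof (rule energy_growth[where h = h and p = p and q = "\<lambda>t. q t + \<nu> * w t"
          and r = "\<lambda>t. (\<nu> - \<mu>) * (w t * y \<mu> t)"])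
      fix u assume u: "0 \<le> u" "u \<le> h"
      show "((\<lambda>t. y \<nu> t - y \<mu> t) has_real_derivative z \<nu> u - z \<mu> u) (at u)"
        by (intro DERIV_diff solves_odeD(1)[OF s(1)])
      have "((\<lambda>t. z \<nu> t - z \<mu> t) has_real_derivative
          (p u * z \<nu> u + (q u + \<nu> * w u) * y \<nu> u) - (p u * z \<mu> u + (q u + \<mu> * w u) * y \<mu> u)) (at u)"
        by (intro DERIV_diff solves_odeD(2)[OF s(1)])
      then show "((\<lambda>t. z \<nu> t - z \<mu> t) has_real_derivative
          p u * (z \<nu> u - z \<mu> u) + (q u + \<nu> * w u) * (y \<nu> u - y \<mu> u) + (\<nu> - \<mu>) * (w u * y \<mu> u)) (at u)"
        by (rule DERIV_cong) algebra
      have u': "u \<in> {0..h}" using u by auto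
      have "\<bar>q u + \<nu> * w u\<bar> \<le> \<bar>q u\<bar> + \<bar>\<nu>\<bar> * \<bar>w u\<bar>"
        by (metis abs_mult abs_triangle_ineq)
      also have "\<dots> \<le> Kq + (\<bar>\<mu>\<bar> + 1) * Kw"
        using Kq[OF u'] Kw[OF u'] d1(1) by (intro add_mono mult_mono) auto
      finally have "\<bar>q u + \<nu> * w u\<bar> \<le> K" by (simp add: K_def)
      moreover have "\<bar>p u\<bar> \<le> K" using Kp[OF u'] by (simp add: K_def)
      moreover have "\<bar>(\<nu> - \<mu>) * (w u * y \<mu> u)\<bar> \<le> \<bar>\<nu> - \<mu>\<bar> * (Kw * Ky)"
        unfolding abs_mult using Kw[OF u'] Ky[OF u'] by (intro mult_mono) auto
      ultimately show "\<bar>p u\<bar> \<le> K \<and> \<bar>q u + \<nu> * w u\<bar> \<le> K \<and> \<bar>(\<nu> - \<mu>) * (w u * y \<mu> u)\<bar> \<le> \<bar>\<nu> - \<mu>\<bar> * (Kw * Ky)"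
        by blast
    qed (use t in auto)
    also have "\<dots> = \<bar>\<nu> - \<mu>\<bar>\<^sup>2 * ((Kw * Ky)\<^sup>2 * t * exp ((2 + 3 * K) * t))"
      by (simp add: s power_mult_distrib)
    also have "\<dots> \<le> \<bar>\<nu> - \<mu>\<bar>\<^sup>2 * C"
      unfolding C_def using t \<open>K \<ge> 0\<close> by (intro mult_left_mono mult_mono) auto
    also have "\<dots> \<le> \<bar>\<nu> - \<mu>\<bar>\<^sup>2 * (C + 1)" by (intro mult_left_mono) auto
    also have "\<dots> < (e / sqrt (C + 1))\<^sup>2 * (C + 1)"
      using d1(2) \<open>C \<ge> 0\<close> by (intro mult_strict_right_mono power_strict_mono) auto
    also have "\<dots> = e\<^sup>2" using \<open>C \<ge> 0\<close> by (simp add: power_divide)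
    finally have *: "(y \<nu> t - y \<mu> t)\<^sup>2 + (z \<nu> t - z \<mu> t)\<^sup>2 < e\<^sup>2" .
    then have "\<bar>y \<nu> t - y \<mu> t\<bar>\<^sup>2 < e\<^sup>2" "\<bar>z \<nu> t - z \<mu> t\<bar>\<^sup>2 < e\<^sup>2"
      using zero_le_power2[of "y \<nu> t - y \<mu> t"] zero_le_power2[of "z \<nu> t - z \<mu> t"]
      unfolding power2_abs by linarith+
    then show ?thesis using \<open>0 < e\<close> by (meson less_eq_real_def power2_less_imp_less)
  qed
  ultimately show ?thesis by blast
qed

section \<open>Principal eigenpairs by shooting\<close>

lemma continuous_pos_lower_bound:
  fixes f :: "real \<Rightarrow> real"
  assumes "continuous_on {a..b} f" "a \<le> b" "\<And>t. t \<in> {a..b} \<Longrightarrow> f t > 0"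
  shows "\<exists>e>0. \<forall>t\<in>{a..b}. e \<le> f t"
proof -
  have "\<exists>x\<in>{a..b}. \<forall>y\<in>{a..b}. f x \<le> f y"
    using assms by (intro continuous_attains_inf) auto
  with assms(3) show ?thesis by blast
qed

text \<open>Shooting in the spectral parameter: \<open>bad\<close> is the set of parameters for which the solution
  with initial data \<open>(1, 0)\<close> fails to stay positive with positive slope at \<open>h\<close>; its supremum is
  the principal eigenvalue of the Neumann problem.\<close>

theorem neumann_principal_eigenpair:
  fixes p q w :: "real \<Rightarrow> real"
  assumes p: "continuous_on UNIV p" and q: "continuous_on UNIV q" and w: "continuous_on UNIV w"
    and "h > 0" and wpos: "\<And>t. w t > 0"
  shows "\<exists>\<mu> y z. solves_ode p (\<lambda>t. q t + \<mu> * w t) y z \<and> z 0 = 0 \<and> z h = 0 \<and> (\<forall>t\<in>{0..h}. y t > 0)"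
proof -
  have qw: "continuous_on UNIV (\<lambda>t. q t + \<mu> * w t)" for \<mu>
    by (intro continuous_intros q w)
  have "\<forall>\<mu>. \<exists>y z. solves_ode p (\<lambda>t. q t + \<mu> * w t) y z \<and> y 0 = 1 \<and> z 0 = 0"
    using linear_ode_exists[OF p qw] by blast
  then obtain y z where s: "\<And>\<mu>. solves_ode p (\<lambda>t. q t + \<mu> * w t) (y \<mu>) (z \<mu>)"
      "\<And>\<mu>. y \<mu> 0 = 1" "\<And>\<mu>. z \<mu> 0 = 0"
    by metis
  note cont = linear_ode_parameter_continuity[OF p q w s]
  note yd = solves_odeD(1)[OF s(1)]
  note zd = solves_odeD(2)[OF s(1)]
  have nz: "\<not> (y \<mu> t = 0 \<and> z \<mu> t = 0)" for \<mu> t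
    using linear_ode_zero[OF p qw s(1), of \<mu> t 0] s(2) by fastforce
  define bad where "bad = {\<mu>. z \<mu> h \<le> 0 \<or> (\<exists>t\<in>{0..h}. y \<mu> t \<le> 0)}"
  obtain e where e: "e > 0" "\<And>t. t \<in> {0..h} \<Longrightarrow> e \<le> w t"
    using continuous_pos_lower_bound[of 0 h w] continuous_on_subset[OF w] wpos \<open>h > 0\<close> by (metis less_imp_le subset_UNIV)
  have "continuous_on UNIV (\<lambda>t. \<bar>q t\<bar> + (p t)\<^sup>2 / 4)" by (intro continuous_intros p q) auto
  then obtain K where K: "\<And>t. t \<in> {0..h} \<Longrightarrow> \<bar>\<bar>q t\<bar> + (p t)\<^sup>2 / 4\<bar> \<le> K"
    using continuous_bounded_Icc by blast
  have Kw: "K < (K + 1) / e * w t" "K \<ge> 0" if "t \<in> {0..h}" for t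
  proof -
    show "K \<ge> 0" using K[OF that] by linarith
    then have "(K + 1) / e * e \<le> (K + 1) / e * w t"
      using e(1) e(2)[OF that] by (intro mult_left_mono) auto
    then show "K < (K + 1) / e * w t" using e(1) by simp
  qed
  \<comment> \<open>On the interval \<open>K\<close> bounds
    \<open>\<bar>q\<bar> + p\<^sup>2 / 4\<close> and \<open>e\<close> bounds \<open>w\<close> from
    below, so beyond this threshold \<open>q + \<mu> * w\<close> exceeds
    \<open>p\<^sup>2 / 4\<close>.\<close>
  have above: "\<mu> \<notin> bad" if \<mu>: "\<mu> \<ge> (K + 1) / e" for \<mu>
  proof -
    have Q: "q t + \<mu> * w t > (p t)\<^sup>2 / 4" if t: "t \<in> {0..h}" for t
      using K[OF t] Kw[OF t] mult_right_mono[OF \<mu>, of "w t"] wpos[of t] by linarith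
    have "z \<mu> h > 0 \<and> (\<forall>t\<in>{0..h}. y \<mu> t > 0)"
    proof -
      \<comment> \<open>Completing the square makes the derivative of \<open>y z\<close> positive.
        Hence \<open>y z > 0\<close> after 0, so \<open>y\<^sup>2\<close> grows from its initial
        value 1 and \<open>y\<close> cannot reach zero.\<close>
      define g where "g t = y \<mu> t * z \<mu> t" for t
      have gd: "(g has_real_derivative
          (z \<mu> t + p t * y \<mu> t / 2)\<^sup>2 + (q t + \<mu> * w t - (p t)\<^sup>2 / 4) * (y \<mu> t)\<^sup>2) (at t)" for t
        unfolding g_def
        by (rule DERIV_cong[OF DERIV_mult[OF yd zd]]) (simp add: power2_eq_square field_simps)
      have g'0: "(z \<mu> t + p t * y \<mu> t / 2)\<^sup>2 + (q t + \<mu> * w t - (p t)\<^sup>2 / 4) * (y \<mu> t)\<^sup>2 > 0"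
        if t: "t \<in> {0..h}" for t
      proof (cases "y \<mu> t = 0")
        case True
        then show ?thesis using nz[of \<mu> t] by simp
      next
        case False
        then have "(q t + \<mu> * w t - (p t)\<^sup>2 / 4) * (y \<mu> t)\<^sup>2 > 0" using Q[OF t] by simp
        then show ?thesis by (simp add: add_nonneg_pos)
      qed
      have g0: "g 0 = 0" by (simp add: g_def s)
      have gpos: "g t > 0" if "0 < t" "t \<le> h" for t
        using DERIV_pos_imp_increasing[OF that(1), of g] gd g'0 g0 that(2) by force
      have y2: "(y \<mu> t)\<^sup>2 \<ge> 1" if "0 \<le> t" "t \<le> h" for t
      proof -
        have "((\<lambda>t. (y \<mu> t)\<^sup>2) has_real_derivative 2 * g u) (at u)" for u
          unfolding g_def by (rule derivative_eq_intros yd refl | simp)+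
        moreover have "2 * g u \<ge> 0" if "0 \<le> u" "u \<le> t" for u
          using gpos[of u] g0 that \<open>t \<le> h\<close> by (cases "u = 0") auto
        ultimately have "(y \<mu> 0)\<^sup>2 \<le> (y \<mu> t)\<^sup>2"
          using DERIV_nonneg_imp_nondecreasing[OF \<open>0 \<le> t\<close>, of "\<lambda>t. (y \<mu> t)\<^sup>2"] by blast
        then show ?thesis by (simp add: s)
      qed
      have ypos: "y \<mu> t > 0" if t: "t \<in> {0..h}" for t
      proof (rule ccontr)
        assume "\<not> y \<mu> t > 0"
        then have "\<exists>x\<ge>0. x \<le> t \<and> y \<mu> x = 0"
          using t s(2) by (intro IVT2' continuous_on_subset[OF solves_odeD(3)[OF s(1)]]) auto
        then show False using y2 t by fastforce
      qed
      moreover have "z \<mu> h > 0"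
        using gpos[of h] ypos[of h] \<open>h > 0\<close> by (simp add: g_def zero_less_mult_iff)
      ultimately show ?thesis by blast
    qed
    then show ?thesis by (fastforce simp: bad_def)
  qed
  have below: "- ((K + 1) / e) \<in> bad"
  proof (rule ccontr)
    define m where "m = - ((K + 1) / e)"
    assume "- ((K + 1) / e) \<notin> bad"
    then have y: "\<And>t. t \<in> {0..h} \<Longrightarrow> y m t > 0" and z: "z m h > 0"
      by (auto simp: bad_def m_def not_le)
    \<comment> \<open>The Riccati substitution: for very negative parameters the slope ratio
      \<open>z / y\<close> cannot increase from 0, so a positive slope at \<open>h\<close> is
      impossible while \<open>y\<close> stays positive.\<close>
    define g where "g t = z m t / y m t" for t
    have gd: "(g has_real_derivative (q t + m * w t + (p t)\<^sup>2 / 4) - (g t - p t / 2)\<^sup>2) (at t)"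
      if t: "t \<in> {0..h}" for t
      unfolding g_def using y[OF t]
      by (intro DERIV_cong[OF DERIV_divide[OF zd yd]]) (auto simp: power2_eq_square field_simps)
    have "(q t + m * w t + (p t)\<^sup>2 / 4) - (g t - p t / 2)\<^sup>2 \<le> 0" if t: "t \<in> {0..h}" for t
    proof -
      have "q t + m * w t + (p t)\<^sup>2 / 4 \<le> 0"
        using K[OF t] Kw[OF t] unfolding m_def minus_mult_left[symmetric] by linarith
      then show ?thesis by (smt (verit) zero_le_power2)
    qed
    then have "g h \<le> g 0"
      using DERIV_nonpos_imp_nonincreasing[of 0 h g] gd \<open>h > 0\<close> by (meson atLeastAtMost_iff less_imp_le)
    then show False using z y[of h] \<open>h > 0\<close> by (simp add: g_def s divide_le_0_iff)
  qed
  \<comment> \<open>The good parameters form an open set: on a compact interval a positive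
    \<open>y\<close> has a positive minimum, which survives small changes of the parameter.\<close>
  have "closed bad"
    unfolding closed_def open_dist
  proof (intro ballI)
    fix \<mu> assume "\<mu> \<in> - bad"
    then have z: "z \<mu> h > 0" and y: "\<And>t. t \<in> {0..h} \<Longrightarrow> y \<mu> t > 0" by (auto simp: bad_def not_le)
    obtain e where e: "e > 0" "\<And>t. t \<in> {0..h} \<Longrightarrow> e \<le> y \<mu> t"
      using continuous_pos_lower_bound[OF solves_odeD(3)[OF s(1)] _ y] \<open>h > 0\<close> by (metis less_imp_le)
    obtain d where d: "d > 0" "\<And>\<nu> t. \<bar>\<nu> - \<mu>\<bar> < d \<Longrightarrow> t \<in> {0..h} \<Longrightarrow>
        \<bar>y \<nu> t - y \<mu> t\<bar> < min e (z \<mu> h) \<and> \<bar>z \<nu> t - z \<mu> t\<bar> < min e (z \<mu> h)"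
      using cont[of h "min e (z \<mu> h)" \<mu>] \<open>h > 0\<close> e(1) z by (auto simp: less_imp_le)
    have "\<nu> \<in> - bad" if "\<bar>\<nu> - \<mu>\<bar> < d" for \<nu>
    proof -
      have "y \<nu> t > 0" if "t \<in> {0..h}" for t
        using d(2)[OF \<open>\<bar>\<nu> - \<mu>\<bar> < d\<close> that] e(2)[OF that] by linarith
      moreover have "z \<nu> h > 0" using d(2)[OF that, of h] \<open>h > 0\<close> by auto
      ultimately show ?thesis by (fastforce simp: bad_def)
    qed
    then show "\<exists>e>0. \<forall>y. dist y \<mu> < e \<longrightarrow> y \<in> - bad"
      using d(1) by (auto simp: dist_real_def)
  qed
  have bdd: "bdd_above bad"
    using above by (intro bdd_aboveI[of _ "(K + 1) / e"]) (meson linear)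
  define \<mu> where "\<mu> = Sup bad"
  have "\<mu> \<in> bad"
    unfolding \<mu>_def using below bdd \<open>closed bad\<close> by (intro closed_contains_Sup) auto
  have good: "z \<nu> h > 0" "\<And>t. t \<in> {0..h} \<Longrightarrow> y \<nu> t > 0" if "\<nu> > \<mu>" for \<nu>
  proof -
    have "\<nu> \<notin> bad" using cSup_upper[OF _ bdd, of \<nu>] that by (auto simp: \<mu>_def)
    then show "z \<nu> h > 0" "\<And>t. t \<in> {0..h} \<Longrightarrow> y \<nu> t > 0" by (auto simp: bad_def not_le)
  qed
  \<comment> \<open>All parameters above the supremum are good; letting them decrease to
    \<open>\<mu>\<close> leaves the weak inequalities.\<close>
  have lim: "z \<mu> h \<ge> 0 \<and> y \<mu> t \<ge> 0" if t: "t \<in> {0..h}" for t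
  proof (rule ccontr)
    assume *: "\<not> (z \<mu> h \<ge> 0 \<and> y \<mu> t \<ge> 0)"
    define e where "e = (if z \<mu> h < 0 then - z \<mu> h else - y \<mu> t)"
    have "e > 0" using * by (auto simp: e_def)
    then obtain d where d: "d > 0" "\<And>\<nu> t. \<bar>\<nu> - \<mu>\<bar> < d \<Longrightarrow> t \<in> {0..h} \<Longrightarrow>
        \<bar>y \<nu> t - y \<mu> t\<bar> < e \<and> \<bar>z \<nu> t - z \<mu> t\<bar> < e"
      using cont[of h e \<mu>] \<open>h > 0\<close> by (auto simp: less_imp_le)
    have "\<bar>\<mu> + d / 2 - \<mu>\<bar> < d" "\<mu> + d / 2 > \<mu>" using d(1) by auto
    from d(2)[OF this(1) t] d(2)[OF this(1), of h] good(1)[OF this(2)] good(2)[OF this(2) t] \<open>h > 0\<close>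
    show False by (auto simp: e_def split: if_splits)
  qed
  \<comment> \<open>A zero of the nonnegative \<open>y\<close> would be a double zero, contradicting
    uniqueness. In the interior it is a minimum; at \<open>h\<close> a positive slope would make
    \<open>y\<close> negative just before; at 0 the value is 1.\<close>
  have pos: "y \<mu> t > 0" if t: "t \<in> {0..h}" for t
  proof (rule ccontr)
    assume "\<not> y \<mu> t > 0"
    then have y0: "y \<mu> t = 0" using lim[OF t] by linarith
    have "t \<noteq> 0" using y0 s(2)[of \<mu>] by auto
    have "z \<mu> t = 0"
    proof (cases "t = h")
      case True
      have "\<not> z \<mu> h > 0"
      proof
        assume "z \<mu> h > 0"
        then obtain d where d: "d > 0" "\<And>k. 0 < k \<Longrightarrow> k < d \<Longrightarrow> y \<mu> (h - k) < y \<mu> h"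
          using DERIV_pos_inc_left[OF yd] by blast
        have "0 < min (d / 2) h" "min (d / 2) h < d" using d(1) \<open>h > 0\<close> by auto
        from d(2)[OF this] lim[of "h - min (d / 2) h"] y0 True \<open>h > 0\<close> this(1) show False by auto
      qed
      then show ?thesis using lim[OF t] True by simp
    next
      case False
      define d where "d = min t (h - t)"
      have "d > 0" using False \<open>t \<noteq> 0\<close> t by (auto simp: d_def)
      show ?thesis
      proof (rule DERIV_local_min[OF yd \<open>d > 0\<close>], intro allI impI)
        fix u assume "\<bar>t - u\<bar> < d"
        then have "u \<in> {0..h}" by (auto simp: d_def)
        then show "y \<mu> t \<le> y \<mu> u" using lim y0 by simp
      qed
    qed
    with y0 nz show False by blast
  qed
  have "z \<mu> h = 0" using \<open>\<mu> \<in> bad\<close> pos lim[of 0] \<open>h > 0\<close> by (fastforce simp: bad_def)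
  with s pos show ?thesis by blast
qed

lemma periodic_int:
  fixes f :: "real \<Rightarrow> 'a"
  assumes "\<And>t. f (t + P) = f t"
  shows "f (t + P * real_of_int n) = f t"
proof (induction n arbitrary: t rule: int_induct[where k = 0])
  case (step1 i)
  then show ?case using assms[of "t + P * real_of_int i"] by (simp add: algebra_simps)
next
  case (step2 i)
  then show ?case using assms[of "t + P * real_of_int (i - 1)"] by (simp add: algebra_simps)
qed simp

lemma periodic_reduce:
  fixes f :: "real \<Rightarrow> 'a"
  assumes "\<And>t. f (t + P) = f t" "P > 0"
  shows "\<exists>s\<in>{0..P}. f s = f t"
proof
  define n where "n = \<lfloor>t / P\<rfloor>"
  have "real_of_int n \<le> t / P" "t / P < real_of_int n + 1"
    unfolding n_def by linarith+
  then have "P * real_of_int n \<le> t" "t < P * real_of_int n + P"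
    using \<open>P > 0\<close> by (simp_all add: field_simps)
  then show "t + P * real_of_int (- n) \<in> {0..P}" by simp
  show "f (t + P * real_of_int (- n)) = f t"
    by (rule periodic_int) (rule assms(1))
qed

text \<open>The coefficients are symmetric about 0 and about \<open>h\<close>, and the Neumann
  solution has zero slope at both points. By uniqueness it is even about both, and the composition
  of the two reflections is the translation by \<open>2 * h\<close>.\<close>

theorem periodic_principal_eigenpair:
  fixes p q w :: "real \<Rightarrow> real"
  assumes p: "continuous_on UNIV p" and q: "continuous_on UNIV q" and w: "continuous_on UNIV w"
    and "h > 0" and wpos: "\<And>t. w t > 0"
    and odd: "\<And>t. p (- t) = - p t" and even: "\<And>t. q (- t) = q t" "\<And>t. w (- t) = w t"
    and per: "\<And>t. p (t + 2 * h) = p t" "\<And>t. q (t + 2 * h) = q t" "\<And>t. w (t + 2 * h) = w t"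
  shows "\<exists>\<mu> y z. solves_ode p (\<lambda>t. q t + \<mu> * w t) y z \<and> (\<forall>t. y t > 0) \<and> (\<forall>t. y (t + 2 * h) = y t)"
proof -
  obtain \<mu> y z where s: "solves_ode p (\<lambda>t. q t + \<mu> * w t) y z" and z: "z 0 = 0" "z h = 0"
    and pos: "\<And>t. t \<in> {0..h} \<Longrightarrow> y t > 0"
    using neumann_principal_eigenpair[OF p q w \<open>h > 0\<close> wpos] by blast
  have qw: "continuous_on UNIV (\<lambda>t. q t + \<mu> * w t)"
    by (intro continuous_intros q w)
  have r0: "solves_ode p (\<lambda>t. q t + \<mu> * w t) (\<lambda>t. y (0 - t)) (\<lambda>t. - z (0 - t))"
    by (rule solves_ode_reflect[OF s]) (simp_all add: odd even)
  have r1: "solves_ode p (\<lambda>t. q t + \<mu> * w t) (\<lambda>t. y (2 * h - t)) (\<lambda>t. - z (2 * h - t))"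
    by (rule solves_ode_reflect[OF s])
      (use odd even per[of "- _"] in \<open>simp_all add: add.commute[of "- _"]\<close>)
  have ev: "y (- t) = y t" for t
    using linear_ode_unique[OF p qw r0 s, of 0 t] z by simp
  have sym: "y (2 * h - t) = y t" for t
    using linear_ode_unique[OF p qw r1 s, of h t] z by simp
  have period: "y (t + 2 * h) = y t" for t
    using sym[of "- t"] ev[of t] by (simp add: add.commute)
  have periodn: "y (t + 2 * h * real_of_int n) = y t" for t n
    by (rule periodic_int) (rule period)
  have "y t > 0" for t
  proof -
    \<comment> \<open>Translation by \<open>n\<close> periods brings \<open>t\<close> into
      \<open>[-h, h]\<close>, where evenness reduces to the half interval with known
      positivity.\<close>
    define n where "n = \<lfloor>(t + h) / (2 * h)\<rfloor>"
    have "real_of_int n \<le> (t + h) / (2 * h)" "(t + h) / (2 * h) < real_of_int n + 1"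
      unfolding n_def by linarith+
    then have "2 * h * real_of_int n \<le> t + h" "t + h < 2 * h * real_of_int n + 2 * h"
      using \<open>h > 0\<close> by (simp_all add: field_simps)
    then have "\<bar>t + 2 * h * real_of_int (- n)\<bar> \<in> {0..h}" by auto
    moreover have "y \<bar>u\<bar> = y u" for u using ev[of u] by (simp add: abs_if)
    ultimately show ?thesis using pos periodn[of t "- n"] by metis
  qed
  with s period show ?thesis by blast
qed

section \<open>The maximum principle\<close>

text \<open>If \<open>c\<close> were negative, \<open>f'\<close> would be negative just to the right
  of \<open>t\<close>, and the mean value theorem would take \<open>f\<close> below its
  minimum.\<close>

lemma second_derivative_nonneg_at_min:
  fixes f f' :: "real \<Rightarrow> real"
  assumes f: "\<And>x. (f has_real_derivative f' x) (at x)" and f': "(f' has_real_derivative c) (at t)"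
    and min: "\<And>x. f t \<le> f x"
  shows "f' t = 0" "c \<ge> 0"
proof -
  show "f' t = 0"
    by (rule DERIV_local_min[OF f zero_less_one]) (use min in blast)
  show "c \<ge> 0"
  proof (rule ccontr)
    assume "\<not> c \<ge> 0"
    then obtain d where d: "d > 0" "\<And>h. 0 < h \<Longrightarrow> h < d \<Longrightarrow> f' (t + h) < f' t"
      using DERIV_neg_dec_right[OF f'] by auto
    have "t < t + d / 2" using d(1) by simp
    then obtain z where z: "t < z" "z < t + d / 2" "f (t + d / 2) - f t = (t + d / 2 - t) * f' z"
      using MVT2[of t "t + d / 2" f f'] f by blast
    have "f' z < 0" using d(2)[of "z - t"] z \<open>f' t = 0\<close> d(1) by simp
    with d(1) have "(t + d / 2 - t) * f' z < 0" by (intro mult_pos_neg) auto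
    then show False using min[of "t + d / 2"] z(3) by linarith
  qed
qed

text \<open>Touch \<open>u\<close> from above by the smallest multiple \<open>m * f\<close>; at a contact point \<open>m * f - u\<close> has
  a minimum.\<close>

lemma eigenvalue_comparison:
  fixes u u' u'' f f' f'' a b c :: "real \<Rightarrow> real"
  assumes P: "P > 0" and a: "\<And>t. a t \<ge> 0"
    and u: "\<And>t. (u has_real_derivative u' t) (at t)" "\<And>t. (u' has_real_derivative u'' t) (at t)"
    and f: "\<And>t. (f has_real_derivative f' t) (at t)" "\<And>t. (f' has_real_derivative f'' t) (at t)"
    and per: "\<And>t. u (t + P) = u t" "\<And>t. f (t + P) = f t"
    and pos: "\<And>t. f t > 0" and u0: "u t0 > 0"
    and Lu: "\<And>t. a t * u'' t + b t * u' t + c t * u t \<ge> \<nu> * u t"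
    and Lf: "\<And>t. a t * f'' t + b t * f' t + c t * f t \<le> \<mu> * f t"
  shows "\<nu> \<le> \<mu>"
proof -
  have "continuous_on {0..P} (\<lambda>t. u t / f t)"
    using DERIV_continuous_on[OF has_field_derivative_at_within[OF u(1)]]
      DERIV_continuous_on[OF has_field_derivative_at_within[OF f(1)]] pos
    by (intro continuous_on_divide) (auto simp: less_imp_neq[symmetric])
  then obtain t where t: "\<And>s. s \<in> {0..P} \<Longrightarrow> u s / f s \<le> u t / f t"
    using continuous_attains_sup[of "{0..P}" "\<lambda>t. u t / f t"] P
    by (metis atLeastatMost_empty_iff2 compact_Icc less_imp_le not_le)
  define m where "m = u t / f t"
  have m: "u s / f s \<le> m" for s
    using periodic_reduce[of "\<lambda>t. u t / f t" P s] per P t by (metis m_def)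
  have "0 < u t0 / f t0" using u0 pos by simp
  then have "m > 0" using m[of t0] by linarith
  have d: "0 \<le> m * f s - u s" for s
    using m[of s] pos[of s] by (simp add: pos_divide_le_eq)
  have d0: "m * f t - u t = 0" using pos[of t] by (simp add: m_def)
  have D1: "((\<lambda>s. m * f s - u s) has_real_derivative m * f' s - u' s) (at s)" for s
    by (intro DERIV_diff DERIV_cmult f u)
  have D2: "((\<lambda>s. m * f' s - u' s) has_real_derivative m * f'' t - u'' t) (at t)"
    by (intro DERIV_diff DERIV_cmult f u)
  have min: "m * f' t - u' t = 0" "m * f'' t - u'' t \<ge> 0"
    using second_derivative_nonneg_at_min[OF D1 D2] d d0 by auto
  \<comment> \<open>At the contact point values and first derivatives agree, so the operators differ
    only in the second-order term, whose sign follows from \<open>a \<ge> 0\<close> and the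
    minimum.\<close>
  have eq: "u t = m * f t" "u' t = m * f' t" using d0 min by auto
  have "\<nu> * (m * f t) \<le> a t * u'' t + b t * u' t + c t * u t" using Lu[of t] eq by simp
  also have "\<dots> \<le> a t * (m * f'' t) + b t * u' t + c t * u t"
    using min(2) a[of t] by (simp add: mult_left_mono)
  also have "\<dots> = m * (a t * f'' t + b t * f' t + c t * f t)" by (simp add: eq algebra_simps)
  also have "\<dots> \<le> m * (\<mu> * f t)" using Lf[of t] \<open>m > 0\<close> by (intro mult_left_mono) auto
  finally have "\<nu> * (m * f t) \<le> \<mu> * (m * f t)" by (simp add: mult.left_commute)
  then show ?thesis using \<open>m > 0\<close> pos[of t] by simp
qed

section \<open>The eigenvalue equation on the circle\<close>

definition circle_op :: "real \<Rightarrow> real \<Rightarrow> (real \<Rightarrow> real) \<Rightarrow> (real \<Rightarrow> real) \<Rightarrow> (real \<Rightarrow> real) \<Rightarrow> real \<Rightarrow> real" where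
  "circle_op k l u u' u'' t =
     (1 - k\<^sup>2 * (sin (2 * t))\<^sup>2) * u'' t + ((l - 1) * k\<^sup>2 * sin (4 * t)) * u' t
     + (- (k\<^sup>2 * l * (2 * (sin (2 * t))\<^sup>2 + l * (cos (2 * t))\<^sup>2))) * u t"

text \<open>The derivatives are explicit arguments, so the equation is a pointwise identity between
  given functions. Positivity is what singles out the leading eigenvalue.\<close>

definition principal :: "real \<Rightarrow> real \<Rightarrow> real \<Rightarrow> (real \<Rightarrow> real) \<Rightarrow> (real \<Rightarrow> real) \<Rightarrow> (real \<Rightarrow> real) \<Rightarrow> bool" where
  "principal k l \<mu> u u' u'' \<longleftrightarrow>
     (\<forall>t. (u has_real_derivative u' t) (at t)) \<and> (\<forall>t. (u' has_real_derivative u'' t) (at t)) \<and>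
     (\<forall>t. u (t + pi / 2) = u t) \<and> (\<forall>t. u t > 0) \<and> (\<forall>t. circle_op k l u u' u'' t = \<mu> * u t)"

lemma principalD:
  assumes "principal k l \<mu> u u' u''"
  shows "(u has_real_derivative u' t) (at t)" "(u' has_real_derivative u'' t) (at t)"
    "u (t + pi / 2) = u t" "u t > 0" "circle_op k l u u' u'' t = \<mu> * u t"
  using assms by (auto simp: principal_def)

lemma sin_4_eq: "sin (4 * t) = 2 * sin (2 * t) * cos (2 * t)" for t :: real
  using sin_double[of "2 * t"] by simp

lemma symbol_pos:
  assumes "0 < k" "k < (1::real)"
  shows "1 - k\<^sup>2 * (sin t)\<^sup>2 > 0"
proof -
  have "k\<^sup>2 * (sin t)\<^sup>2 \<le> k\<^sup>2 * 1"
    by (intro mult_left_mono) (simp_all add: abs_square_le_1)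
  moreover have "k\<^sup>2 < 1" using assms by (simp add: power_less_one_iff)
  ultimately show ?thesis by linarith
qed

lemma principal_exists:
  assumes k: "0 < k" "k < 1"
  shows "\<exists>\<mu> u u' u''. principal k l \<mu> u u' u''"
proof -
  \<comment> \<open>Dividing by the leading coefficient \<open>a\<close> gives the normal form with
    weight \<open>w = 1 / a\<close>. The half period is pi/4, since all coefficients have period
    pi/2.\<close>
  define a where "a t = 1 - k\<^sup>2 * (sin (2 * t))\<^sup>2" for t
  define V0 where "V0 t = k\<^sup>2 * l * (2 * (sin (2 * t))\<^sup>2 + l * (cos (2 * t))\<^sup>2)" for t
  define p where "p t = - ((l - 1) * k\<^sup>2 * sin (4 * t)) / a t" for t
  define q where "q t = V0 t / a t" for t
  define w where "w t = 1 / a t" for t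
  have a: "a t > 0" for t using symbol_pos[OF k] by (simp add: a_def)
  then have a0: "a t \<noteq> 0" for t by (metis less_irrefl)
  have cont: "continuous_on UNIV p" "continuous_on UNIV q" "continuous_on UNIV w"
    using a0 unfolding p_def q_def w_def V0_def a_def by (auto intro!: continuous_intros)
  have refl: "a (- t) = a t" "p (- t) = - p t" "q (- t) = q t" "w (- t) = w t" for t
    by (simp_all add: a_def p_def q_def w_def V0_def)
  have s: "sin (2 * (t + 2 * (pi / 4))) = - sin (2 * t)" "cos (2 * (t + 2 * (pi / 4))) = - cos (2 * t)" for t
    using sin_periodic_pi[of "2 * t"] cos_periodic_pi[of "2 * t"] by (simp_all add: algebra_simps)
  have per: "p (t + 2 * (pi / 4)) = p t" "q (t + 2 * (pi / 4)) = q t" "w (t + 2 * (pi / 4)) = w t" for t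
    unfolding p_def q_def w_def V0_def a_def sin_4_eq s by simp_all
  obtain \<mu> y z where y: "solves_ode p (\<lambda>t. q t + \<mu> * w t) y z" "\<And>t. y t > 0" "\<And>t. y (t + 2 * (pi / 4)) = y t"
    using periodic_principal_eigenpair[OF cont, of "pi / 4"] refl per a by (auto simp: w_def)
  define y'' where "y'' t = p t * z t + (q t + \<mu> * w t) * y t" for t
  have "circle_op k l y z y'' t = \<mu> * y t" for t
  proof -
    have "a t * y'' t = - ((l - 1) * k\<^sup>2 * sin (4 * t)) * z t + (V0 t + \<mu>) * y t"
      using a0[of t] by (simp add: y''_def p_def q_def w_def field_simps)
    then show ?thesis by (simp add: circle_op_def a_def V0_def algebra_simps)
  qed
  moreover have "y (t + pi / 2) = y t" for t using y(3)[of t] by simp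
  ultimately have "principal k l \<mu> y z y''"
    using y solves_odeD(1,2)[OF y(1)] by (simp add: principal_def y''_def)
  then show ?thesis by blast
qed

text \<open>Subsolutions give lower bounds for the principal eigenvalue. The period
  \<open>2 * pi\<close> admits restrictions of arbitrary plane eigenfunctions, so the lemma yields
  both maximality of \<open>\<mu>\<close> and lower bounds from trial functions.\<close>

lemma principal_upper:
  assumes k: "0 < k" "k < 1" and pr: "principal k l \<mu> f f' f''"
    and u: "\<And>t. (u has_real_derivative u' t) (at t)" "\<And>t. (u' has_real_derivative u'' t) (at t)"
    and per: "\<And>t. u (t + 2 * pi) = u t" and "u t0 > 0"
    and L: "\<And>t. circle_op k l u u' u'' t \<ge> \<nu> * u t"
  shows "\<nu> \<le> \<mu>"
proof (rule eigenvalue_comparison[where P = "2 * pi" and u = u and f = f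
      and u' = u' and f' = f' and u'' = u'' and f'' = f''
      and a = "\<lambda>t. 1 - k\<^sup>2 * (sin (2 * t))\<^sup>2" and b = "\<lambda>t. (l - 1) * k\<^sup>2 * sin (4 * t)"
      and c = "\<lambda>t. - (k\<^sup>2 * l * (2 * (sin (2 * t))\<^sup>2 + l * (cos (2 * t))\<^sup>2))"])
  have "f (t + pi / 2 * real_of_int 4) = f t" for t
    by (rule periodic_int) (rule principalD(3)[OF pr])
  then show "f (t + 2 * pi) = f t" for t by simp
  show "\<And>t. 0 \<le> 1 - k\<^sup>2 * (sin (2 * t))\<^sup>2" using symbol_pos[OF k] by (simp add: less_imp_le)
qed (use assms L[unfolded circle_op_def] eq_refl[OF principalD(5)[OF pr, unfolded circle_op_def]]
    eq_refl[OF sym[OF principalD(5)[OF pr, unfolded circle_op_def]]] in \<open>auto simp: principalD(1-4)[OF pr]\<close>)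

text \<open>The same comparison with the roles exchanged: the principal eigenfunction is touched
  from above by multiples of a positive supersolution.\<close>

lemma principal_lower:
  assumes k: "0 < k" "k < 1" and pr: "principal k l \<mu> f f' f''"
    and u: "\<And>t. (u has_real_derivative u' t) (at t)" "\<And>t. (u' has_real_derivative u'' t) (at t)"
    and per: "\<And>t. u (t + pi / 2) = u t" and pos: "\<And>t. u t > 0"
    and L: "\<And>t. circle_op k l u u' u'' t \<le> \<nu> * u t"
  shows "\<mu> \<le> \<nu>"
proof (rule eigenvalue_comparison[where P = "pi / 2" and u = f and f = u
      and u' = f' and f' = u' and u'' = f'' and f'' = u''
      and a = "\<lambda>t. 1 - k\<^sup>2 * (sin (2 * t))\<^sup>2" and b = "\<lambda>t. (l - 1) * k\<^sup>2 * sin (4 * t)"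
      and c = "\<lambda>t. - (k\<^sup>2 * l * (2 * (sin (2 * t))\<^sup>2 + l * (cos (2 * t))\<^sup>2))"])
  show "\<And>t. 0 \<le> 1 - k\<^sup>2 * (sin (2 * t))\<^sup>2" using symbol_pos[OF k] by (simp add: less_imp_le)
qed (use assms L[unfolded circle_op_def] eq_refl[OF principalD(5)[OF pr, unfolded circle_op_def]]
    eq_refl[OF sym[OF principalD(5)[OF pr, unfolded circle_op_def]]] in \<open>auto simp: principalD(1-4)[OF pr]\<close>)

section \<open>Restriction to the circle\<close>

definition circ :: "real \<Rightarrow> real^2" where
  "circ t = vector [sin t, cos t]"

lemma circ_nth [simp]: "circ t $ 1 = sin t" "circ t $ 2 = cos t"
  by (simp_all add: circ_def)

lemma circ_nonzero [simp]: "circ t \<noteq> 0"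
proof
  assume "circ t = 0"
  then have "sin t = 0" "cos t = 0" by (metis circ_nth zero_index)+
  then show False using sin_cos_squared_add[of t] by simp
qed

lemma real2_eq_iff: "x = y \<longleftrightarrow> x $ 1 = y $ 1 \<and> x $ 2 = y $ 2" for x y :: "real^2"
  by (simp add: vec_eq_iff forall_2)

lemma polar_exists:
  fixes x :: "real^2"
  assumes "x \<noteq> 0"
  shows "\<exists>r t. r > 0 \<and> x = r *\<^sub>R circ t"
proof -
  define r where "r = sqrt ((x $ 1)\<^sup>2 + (x $ 2)\<^sup>2)"
  have "(x $ 1)\<^sup>2 + (x $ 2)\<^sup>2 > 0"
    using assms by (simp add: real2_eq_iff sum_power2_gt_zero_iff)
  then have r: "r > 0" "r\<^sup>2 = (x $ 1)\<^sup>2 + (x $ 2)\<^sup>2" by (simp_all add: r_def)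
  have "(x $ 2 / r)\<^sup>2 + (x $ 1 / r)\<^sup>2 = 1"
    using r(1) unfolding power_divide add_divide_distrib[symmetric] r(2)[symmetric] add.commute[of "(x $ 2)\<^sup>2"]
    by simp
  then obtain t where "x $ 2 / r = cos t" "x $ 1 / r = sin t"
    using sincos_total_2pi by metis
  then have "x = r *\<^sub>R circ t" using r(1) by (simp add: real2_eq_iff field_simps)
  with r(1) show ?thesis by blast
qed

lemma frechet_derivative_real2:
  fixes v :: "real^2 \<Rightarrow> real"
  assumes "v differentiable (at x)"
  shows "frechet_derivative v (at x) u = u $ 1 * pderivative 1 v x + u $ 2 * pderivative 2 v x"
proof -
  have lin: "linear (frechet_derivative v (at x))" by (rule linear_frechet_derivative[OF assms])
  have "u = (u $ 1) *\<^sub>R axis 1 1 + (u $ 2) *\<^sub>R axis 2 1"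
    by (simp add: real2_eq_iff axis_def)
  then have "frechet_derivative v (at x) u
      = frechet_derivative v (at x) ((u $ 1) *\<^sub>R axis 1 1 + (u $ 2) *\<^sub>R axis 2 1)" by simp
  also have "\<dots> = u $ 1 * pderivative 1 v x + u $ 2 * pderivative 2 v x"
    using lin by (simp add: linear_add linear_scale pderivative_def)
  finally show ?thesis .
qed

lemma has_derivative_real2:
  fixes v :: "real^2 \<Rightarrow> real"
  assumes "v differentiable (at x)"
  shows "(v has_derivative (\<lambda>u. u $ 1 * pderivative 1 v x + u $ 2 * pderivative 2 v x)) (at x)"
proof -
  have "frechet_derivative v (at x) = (\<lambda>u. u $ 1 * pderivative 1 v x + u $ 2 * pderivative 2 v x)"
    using frechet_derivative_real2[OF assms] by blast
  then show ?thesis using frechet_derivative_works assms by metis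
qed

lemma circ_has_derivative: "(circ has_derivative (\<lambda>h. h *\<^sub>R vector [cos t, - sin t])) (at t)"
proof -
  have "((\<lambda>s. sin s *\<^sub>R axis 1 1 + cos s *\<^sub>R axis 2 1 :: real^2) has_derivative
      (\<lambda>h. (cos t * h) *\<^sub>R axis 1 1 + (- sin t * h) *\<^sub>R axis 2 1)) (at t)"
    by (rule derivative_eq_intros refl | simp add: mult.commute)+
  moreover have "circ = (\<lambda>s. sin s *\<^sub>R axis 1 1 + cos s *\<^sub>R axis 2 1)"
    by (simp add: fun_eq_iff real2_eq_iff axis_def)
  moreover have "(\<lambda>h. (cos t * h) *\<^sub>R axis 1 1 + (- sin t * h) *\<^sub>R axis 2 1)
      = (\<lambda>h. h *\<^sub>R vector [cos t, - sin t] :: real^2)"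
    by (simp add: fun_eq_iff real2_eq_iff axis_def)
  ultimately show ?thesis by simp
qed

text \<open>\<open>circ\<close> runs clockwise from the second axis; its tangent is minus the
  rotation field of \<open>K12\<close>, hence the sign.\<close>

lemma K12_circ:
  assumes "v differentiable (at (circ t))"
  shows "((\<lambda>s. v (circ s)) has_real_derivative - K12 v (circ t)) (at t)"
proof -
  have "((\<lambda>s. v (circ s)) has_derivative
     (\<lambda>h. (h *\<^sub>R vector [cos t, - sin t] :: real^2) $ 1 * pderivative 1 v (circ t)
        + (h *\<^sub>R vector [cos t, - sin t] :: real^2) $ 2 * pderivative 2 v (circ t))) (at t)"
    by (rule has_derivative_compose[OF circ_has_derivative has_derivative_real2[OF assms]])
  moreover have "(\<lambda>h. (h *\<^sub>R vector [cos t, - sin t] :: real^2) $ 1 * pderivative 1 v (circ t)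
        + (h *\<^sub>R vector [cos t, - sin t] :: real^2) $ 2 * pderivative 2 v (circ t))
     = (*) (- K12 v (circ t))"
    by (simp add: fun_eq_iff K12_def algebra_simps)
  ultimately show ?thesis by (simp add: has_field_derivative_def)
qed

text \<open>A once-differentiable version of \<open>V l\<close>. It contains \<open>v\<close>,
  \<open>K12 v\<close> and \<open>A12 v\<close> for \<open>v\<close> in \<open>V l\<close>, so the
  circle formulas can be iterated without first showing that the operators preserve
  smoothness.\<close>

definition hom_diff :: "real \<Rightarrow> (real^2 \<Rightarrow> real) \<Rightarrow> bool" where
  "hom_diff l v \<longleftrightarrow> (\<forall>x. x \<noteq> 0 \<longrightarrow> v differentiable (at x)) \<and>
     (\<forall>r x. r \<noteq> 0 \<longrightarrow> x \<noteq> 0 \<longrightarrow> v (r *\<^sub>R x) = \<bar>r\<bar> powr l * v x)"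

text \<open>Euler's identity: the derivative of \<open>r \<mapsto> v (r x)\<close> at 1, computed by
  the chain rule and by homogeneity.\<close>

lemma hom_diff_euler:
  assumes v: "hom_diff l v" and "x \<noteq> 0"
  shows "x $ 1 * pderivative 1 v x + x $ 2 * pderivative 2 v x = l * v x"
proof -
  have "v differentiable (at (1 *\<^sub>R x))" using assms by (simp add: hom_diff_def)
  from has_derivative_real2[OF this]
  have "((\<lambda>r. v (r *\<^sub>R x)) has_derivative
      (\<lambda>h. (h *\<^sub>R x) $ 1 * pderivative 1 v (1 *\<^sub>R x) + (h *\<^sub>R x) $ 2 * pderivative 2 v (1 *\<^sub>R x))) (at 1)"
    by (rule has_derivative_compose[rotated]) (auto intro!: derivative_eq_intros)
  then have 1: "((\<lambda>r. v (r *\<^sub>R x)) has_real_derivative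
      x $ 1 * pderivative 1 v x + x $ 2 * pderivative 2 v x) (at 1)"
    by (rule has_derivative_imp_has_field_derivative) (simp add: algebra_simps)
  have "((\<lambda>r. r powr l * v x) has_real_derivative l * 1 powr (l - 1) * v x) (at 1)"
    by (auto intro!: derivative_eq_intros)
  then have 2: "((\<lambda>r. v (r *\<^sub>R x)) has_real_derivative l * 1 powr (l - 1) * v x) (at 1)"
    by (rule has_field_derivative_transform_within_open[where S = "{0<..}"])
      (use v \<open>x \<noteq> 0\<close> in \<open>auto simp: hom_diff_def\<close>)
  from DERIV_unique[OF 1 2] show ?thesis by simp
qed

text \<open>Euler's identity gives the radial derivative and \<open>K12\<close> the angular one;
  together they determine both partial derivatives, hence \<open>A12\<close>.\<close>

lemma A12_circ:
  assumes "hom_diff l v"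
  shows "A12 v (circ t) = - l * cos (2 * t) * v (circ t) - sin (2 * t) * K12 v (circ t)"
proof -
  have E: "sin t * pderivative 1 v (circ t) + cos t * pderivative 2 v (circ t) = l * v (circ t)"
    using hom_diff_euler[OF assms circ_nonzero] by simp
  have s: "(sin t)\<^sup>2 + (cos t)\<^sup>2 = 1" by simp
  have "- l * cos (2 * t) * v (circ t) = - (cos (2 * t) * (l * v (circ t)))" by simp
  then show ?thesis
    unfolding E[symmetric] A12_def K12_def circ_nth cos_double sin_double using s
    by algebra
qed

text \<open>Partial derivatives have degree \<open>l - 1\<close>, with a change of sign for negative
  \<open>r\<close>; the factor \<open>r\<close> on the left absorbs both effects.\<close>

lemma pderivative_hom:
  assumes v: "hom_diff l v" and r: "r \<noteq> 0" "x \<noteq> 0"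
  shows "r * pderivative i v (r *\<^sub>R x) = \<bar>r\<bar> powr l * pderivative i v x"
proof -
  have d: "v differentiable (at (r *\<^sub>R x))" "v differentiable (at x)"
    using assms by (auto simp: hom_diff_def)
  have "((\<lambda>y. v (r *\<^sub>R y)) has_derivative (\<lambda>u. frechet_derivative v (at (r *\<^sub>R x)) (r *\<^sub>R u))) (at x)"
    by (rule has_derivative_compose[of "\<lambda>y. r *\<^sub>R y" "\<lambda>u. r *\<^sub>R u"])
      (use d(1) in \<open>auto simp: frechet_derivative_works[symmetric] intro!: derivative_eq_intros\<close>)
  moreover have "((\<lambda>y. v (r *\<^sub>R y)) has_derivative (\<lambda>u. \<bar>r\<bar> powr l * frechet_derivative v (at x) u)) (at x)"
  proof (rule has_derivative_transform_within_open[where s = "- {0}"])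
    show "((\<lambda>y. \<bar>r\<bar> powr l * v y) has_derivative (\<lambda>u. \<bar>r\<bar> powr l * frechet_derivative v (at x) u)) (at x)"
      using d(2) by (intro has_derivative_mult_right) (simp add: frechet_derivative_works[symmetric])
  qed (use assms in \<open>auto simp: hom_diff_def\<close>)
  ultimately have "(\<lambda>u. frechet_derivative v (at (r *\<^sub>R x)) (r *\<^sub>R u))
      = (\<lambda>u. \<bar>r\<bar> powr l * frechet_derivative v (at x) u)"
    by (rule has_derivative_unique)
  from fun_cong[OF this, of "axis i 1"] show ?thesis
    using linear_scale[OF linear_frechet_derivative[OF d(1)]] by (simp add: pderivative_def)
qed

lemma K12_A12_hom:
  assumes "hom_diff l v" "r \<noteq> 0" "x \<noteq> 0"
  shows "K12 v (r *\<^sub>R x) = \<bar>r\<bar> powr l * K12 v x" "A12 v (r *\<^sub>R x) = \<bar>r\<bar> powr l * A12 v x"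
proof -
  have "K12 v (r *\<^sub>R x) = x $ 1 * (r * pderivative 2 v (r *\<^sub>R x)) - x $ 2 * (r * pderivative 1 v (r *\<^sub>R x))"
    "A12 v (r *\<^sub>R x) = x $ 1 * (r * pderivative 1 v (r *\<^sub>R x)) - x $ 2 * (r * pderivative 2 v (r *\<^sub>R x))"
    by (simp_all add: K12_def A12_def)
  then show "K12 v (r *\<^sub>R x) = \<bar>r\<bar> powr l * K12 v x" "A12 v (r *\<^sub>R x) = \<bar>r\<bar> powr l * A12 v x"
    unfolding pderivative_hom[OF assms] by (simp_all add: K12_def A12_def algebra_simps)
qed

lemma V_hom_diff:
  assumes "v \<in> V l"
  shows "hom_diff l v" "hom_diff l (K12 v)" "hom_diff l (A12 v)"
proof -
  have "Ck_on (Suc (Suc 0)) (- {0}) v" using assms unfolding V_def smooth_on_def by blast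
  then have d: "v differentiable (at x)" "pderivative i v differentiable (at x)" if "x \<noteq> 0" for x i
    using that unfolding pderivative_def[abs_def] by auto
  show h: "hom_diff l v" using assms d by (auto simp: V_def hom_diff_def)
  have c: "(\<lambda>x. x $ i) differentiable (at x)" for x :: "real^2" and i
    by (intro bounded_linear_imp_differentiable bounded_linear_vec_nth)
  have "K12 v differentiable (at x)" "A12 v differentiable (at x)" if "x \<noteq> 0" for x
    unfolding K12_def[abs_def] A12_def[abs_def] using that
    by (intro differentiable_diff differentiable_mult c d; simp)+
  then show "hom_diff l (K12 v)" "hom_diff l (A12 v)"
    using K12_A12_hom[OF h] by (auto simp: hom_diff_def)
qed

lemma operator_circ:
  assumes "v \<in> V l"
  shows "K12 (K12 v) (circ t) - k\<^sup>2 * A12 (A12 v) (circ t) =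
    circle_op k l (\<lambda>s. v (circ s)) (\<lambda>s. - K12 v (circ s)) (\<lambda>s. K12 (K12 v) (circ s)) t"
proof -
  note hd = V_hom_diff[OF assms]
  have D: "((\<lambda>s. f (circ s)) has_real_derivative - K12 f (circ t)) (at t)" if "hom_diff l f" for f
    using that by (intro K12_circ) (simp add: hom_diff_def)
  \<comment> \<open>Differentiating the circle formula for \<open>A12 v\<close> gives minus
    \<open>K12 (A12 v)\<close>, the mixed term needed when that formula is applied a second
    time.\<close>
  have "((\<lambda>s. - l * cos (2 * s) * v (circ s) - sin (2 * s) * K12 v (circ s)) has_real_derivative
     2 * l * sin (2 * t) * v (circ t) + l * cos (2 * t) * K12 v (circ t)
     - 2 * cos (2 * t) * K12 v (circ t) + sin (2 * t) * K12 (K12 v) (circ t)) (at t)"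
    by (rule derivative_eq_intros D[OF hd(1)] D[OF hd(2)] refl | simp add: algebra_simps)+
  then have "((\<lambda>s. A12 v (circ s)) has_real_derivative
     2 * l * sin (2 * t) * v (circ t) + l * cos (2 * t) * K12 v (circ t)
     - 2 * cos (2 * t) * K12 v (circ t) + sin (2 * t) * K12 (K12 v) (circ t)) (at t)"
    by (simp add: A12_circ[OF hd(1)])
  from DERIV_unique[OF this D[OF hd(3)]]
  have KA: "K12 (A12 v) (circ t) = - (2 * l * sin (2 * t) * v (circ t) + l * cos (2 * t) * K12 v (circ t)
     - 2 * cos (2 * t) * K12 v (circ t) + sin (2 * t) * K12 (K12 v) (circ t))" by linarith
  show ?thesis
    unfolding A12_circ[OF hd(3)] A12_circ[OF hd(1)] KA circle_op_def sin_4_eq by algebra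
qed

text \<open>Homogeneity moves a point where \<open>v\<close> is nonzero onto the circle, and
  multiplication by a sign makes \<open>v\<close> positive there, as the comparison
  requires.\<close>

lemma eigenvalue_le_principal:
  assumes k: "0 < k" "k < 1" and pr: "principal k l \<mu> f f' f''" and "\<nu> \<in> eigenvalues k l"
  shows "\<nu> \<le> \<mu>"
proof -
  obtain v x where v: "v \<in> V l" and x: "x \<noteq> 0" "v x \<noteq> 0"
    and eq: "\<And>x. x \<noteq> 0 \<Longrightarrow> \<nu> * v x = K12 (K12 v) x - k\<^sup>2 * A12 (A12 v) x"
    using assms(4) by (auto simp: eigenvalues_def)
  note hd = V_hom_diff[OF v]
  obtain r t0 where r: "r > 0" "x = r *\<^sub>R circ t0" using polar_exists[OF x(1)] by blast
  then have "v x = \<bar>r\<bar> powr l * v (circ t0)" using hd(1) by (simp add: hom_diff_def)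
  with x have v0: "v (circ t0) \<noteq> 0" by auto
  define \<sigma> where "\<sigma> = sgn (v (circ t0))"
  have D: "((\<lambda>s. g (circ s)) has_real_derivative - K12 g (circ t)) (at t)" if "hom_diff l g" for g t
    using that by (intro K12_circ) (simp add: hom_diff_def)
  have C: "circle_op k l (\<lambda>s. v (circ s)) (\<lambda>s. - K12 v (circ s)) (\<lambda>s. K12 (K12 v) (circ s)) t
      = \<nu> * v (circ t)" for t
    using operator_circ[OF v, where k = k] eq[OF circ_nonzero] by metis
  show ?thesis
  proof (rule principal_upper[OF k pr, where u = "\<lambda>s. \<sigma> * v (circ s)" and u' = "\<lambda>s. \<sigma> * - K12 v (circ s)"
        and u'' = "\<lambda>s. \<sigma> * - (- K12 (K12 v) (circ s))"])
    show "((\<lambda>s. \<sigma> * v (circ s)) has_real_derivative \<sigma> * - K12 v (circ t)) (at t)" for t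
      by (intro DERIV_cmult D hd)
    show "((\<lambda>s. \<sigma> * - K12 v (circ s)) has_real_derivative \<sigma> * - (- K12 (K12 v) (circ t))) (at t)" for t
      by (intro DERIV_cmult DERIV_minus D hd)
    have "circ (t + 2 * pi) = circ t" for t by (simp add: real2_eq_iff)
    then show "\<sigma> * v (circ (t + 2 * pi)) = \<sigma> * v (circ t)" for t by simp
    show "\<sigma> * v (circ t0) > 0" using v0 by (simp add: \<sigma>_def sgn_if)
    have "circle_op k l (\<lambda>s. \<sigma> * v (circ s)) (\<lambda>s. \<sigma> * - K12 v (circ s)) (\<lambda>s. \<sigma> * - (- K12 (K12 v) (circ s))) t
       = \<sigma> * circle_op k l (\<lambda>s. v (circ s)) (\<lambda>s. - K12 v (circ s)) (\<lambda>s. K12 (K12 v) (circ s)) t" for t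
      by (simp add: circle_op_def algebra_simps)
    then show "\<nu> * (\<sigma> * v (circ t)) \<le> circle_op k l (\<lambda>s. \<sigma> * v (circ s)) (\<lambda>s. \<sigma> * - K12 v (circ s))
       (\<lambda>s. \<sigma> * - (- K12 (K12 v) (circ s))) t" for t
      using C by simp
  qed
qed

section \<open>Smoothness of homogeneous extensions\<close>

lemma Ck_on_cong:
  assumes "open S" "\<And>x. x \<in> S \<Longrightarrow> f x = g x" "Ck_on n S f"
  shows "Ck_on n S g"
  using assms(2,3)
proof (induction n arbitrary: f g)
  case 0
  then show ?case by (simp cong: continuous_on_cong)
next
  case (Suc n)
  have d: "(g has_derivative frechet_derivative f (at x)) (at x)" if x: "x \<in> S" for x
  proof (rule has_derivative_transform_within_open[OF _ \<open>open S\<close> x])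
    show "(f has_derivative frechet_derivative f (at x)) (at x)"
      using Suc.prems(2) x by (simp add: frechet_derivative_works[symmetric])
  qed (use Suc.prems(1) in auto)
  then have "frechet_derivative f (at x) = frechet_derivative g (at x)" if "x \<in> S" for x
    using frechet_derivative_at that by blast
  then have "Ck_on n S (\<lambda>x. frechet_derivative g (at x) u)" for u
    using Suc.IH[of "\<lambda>x. frechet_derivative f (at x) u"] Suc.prems(2) by simp
  moreover have "g differentiable (at x)" if "x \<in> S" for x
    using d[OF that] by (auto simp: differentiable_def)
  ultimately show ?case by simp
qed

lemma Ck_on_Un:
  assumes "open S" "open T" "Ck_on n S f" "Ck_on n T f"
  shows "Ck_on n (S \<union> T) f"
  using assms(3,4)
  by (induction n arbitrary: f) (auto intro: continuous_on_open_Un[OF assms(1,2)])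

text \<open>Generators closed under sums and products. If the partial derivatives of the generators
  lie in the algebra, so do those of every member, and membership alone then implies
  \<open>Ck_on\<close> for every order.\<close>

inductive alg :: "(real^2 \<Rightarrow> real) set \<Rightarrow> (real^2 \<Rightarrow> real) \<Rightarrow> bool" for B where
  base: "b \<in> B \<Longrightarrow> alg B b"
| const: "alg B (\<lambda>_. c)"
| add: "alg B f \<Longrightarrow> alg B g \<Longrightarrow> alg B (\<lambda>x. f x + g x)"
| mult: "alg B f \<Longrightarrow> alg B g \<Longrightarrow> alg B (\<lambda>x. f x * g x)"

lemma alg_derivative:
  assumes B: "\<And>b. b \<in> B \<Longrightarrow> \<exists>g h. alg B g \<and> alg B h \<and>
      (\<forall>x\<in>S. (b has_derivative (\<lambda>u. u $ 1 * g x + u $ 2 * h x)) (at x))"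
    and "alg B f"
  shows "\<exists>g h. alg B g \<and> alg B h \<and> (\<forall>x\<in>S. (f has_derivative (\<lambda>u. u $ 1 * g x + u $ 2 * h x)) (at x))"
  using assms(2)
proof induction
  case (base b)
  then show ?case by (rule B)
next
  case (const c)
  have "((\<lambda>_. c) has_derivative (\<lambda>u. u $ 1 * (\<lambda>_. 0) x + u $ 2 * (\<lambda>_. 0) x)) (at x)" for x :: "real^2"
    by simp
  then show ?case using alg.const by blast
next
  case (add f g)
  then obtain f1 f2 g1 g2 where alg: "alg B f1" "alg B f2" "alg B g1" "alg B g2"
    and d: "\<forall>x\<in>S. (f has_derivative (\<lambda>u. u $ 1 * f1 x + u $ 2 * f2 x)) (at x)"
      "\<forall>x\<in>S. (g has_derivative (\<lambda>u. u $ 1 * g1 x + u $ 2 * g2 x)) (at x)" by blast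
  have "((\<lambda>x. f x + g x) has_derivative (\<lambda>u. u $ 1 * (f1 x + g1 x) + u $ 2 * (f2 x + g2 x))) (at x)"
    if "x \<in> S" for x
    by (rule has_derivative_eq_rhs[OF has_derivative_add[OF bspec[OF d(1) that] bspec[OF d(2) that]]])
      (simp add: fun_eq_iff algebra_simps)
  then show ?case
    using alg.add[OF alg(1,3)] alg.add[OF alg(2,4)] by blast
next
  case (mult f g)
  then obtain f1 f2 g1 g2 where alg: "alg B f1" "alg B f2" "alg B g1" "alg B g2"
    and d: "\<forall>x\<in>S. (f has_derivative (\<lambda>u. u $ 1 * f1 x + u $ 2 * f2 x)) (at x)"
      "\<forall>x\<in>S. (g has_derivative (\<lambda>u. u $ 1 * g1 x + u $ 2 * g2 x)) (at x)" by blast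
  have "((\<lambda>x. f x * g x) has_derivative
      (\<lambda>u. u $ 1 * (f1 x * g x + f x * g1 x) + u $ 2 * (f2 x * g x + f x * g2 x))) (at x)"
    if "x \<in> S" for x
    by (rule has_derivative_eq_rhs[OF has_derivative_mult[OF bspec[OF d(1) that] bspec[OF d(2) that]]])
      (simp add: fun_eq_iff algebra_simps)
  then show ?case
    using alg.add[OF alg.mult[OF alg(1) mult.hyps(2)] alg.mult[OF mult.hyps(1) alg(3)]]
      alg.add[OF alg.mult[OF alg(2) mult.hyps(2)] alg.mult[OF mult.hyps(1) alg(4)]] by blast
qed

lemma alg_Ck_on:
  assumes "open S" and B: "\<And>b. b \<in> B \<Longrightarrow> \<exists>g h. alg B g \<and> alg B h \<and>
      (\<forall>x\<in>S. (b has_derivative (\<lambda>u. u $ 1 * g x + u $ 2 * h x)) (at x))"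
    and "alg B f"
  shows "Ck_on n S f"
  using assms(3)
proof (induction n arbitrary: f)
  case 0
  obtain g h where "\<forall>x\<in>S. (f has_derivative (\<lambda>u. u $ 1 * g x + u $ 2 * h x)) (at x)"
    using alg_derivative[OF B 0] by blast
  then show ?case
    by (auto intro!: continuous_at_imp_continuous_on has_derivative_continuous)
next
  case (Suc n)
  obtain g h where gh: "alg B g" "alg B h"
    and d: "\<And>x. x \<in> S \<Longrightarrow> (f has_derivative (\<lambda>u. u $ 1 * g x + u $ 2 * h x)) (at x)"
    using alg_derivative[OF B Suc.prems] by blast
  have "Ck_on n S (\<lambda>x. frechet_derivative f (at x) u)" for u
  proof (rule Ck_on_cong[OF \<open>open S\<close>])
    show "Ck_on n S (\<lambda>x. u $ 1 * g x + u $ 2 * h x)"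
      by (intro Suc.IH alg.add alg.mult alg.const gh)
    show "u $ 1 * g x + u $ 2 * h x = frechet_derivative f (at x) u" if "x \<in> S" for x
      using fun_cong[OF frechet_derivative_at[OF d[OF that]], of u] by simp
  qed
  moreover have "f differentiable (at x)" if "x \<in> S" for x
    using d[OF that] by (auto simp: differentiable_def)
  ultimately show ?case by simp
qed

text \<open>Near each point there is a branch \<open>ang\<close> of the polar angle; the powers of \<open>|x|\<close>, the
  coordinates and the functions \<open>f \<circ> ang\<close> with \<open>f\<close> among
  \<open>sin 2t, cos 2t, u, u', 1 / (1 - k\<^sup>2 sin\<^sup>2 2t)\<close> generate an algebra closed under partial derivatives.\<close>

lemma polar_Ck_on:
  fixes ang :: "real^2 \<Rightarrow> real"
  assumes "open S" "0 \<notin> S" and k: "0 < k" "k < 1"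
    and ang: "\<And>x. x \<in> S \<Longrightarrow> (ang has_derivative
        (\<lambda>h. (x $ 2 * h $ 1 - x $ 1 * h $ 2) * inverse ((x $ 1)\<^sup>2 + (x $ 2)\<^sup>2))) (at x)"
    and pr: "principal k l \<mu> u u' u''"
  shows "Ck_on n S (\<lambda>x. ((x $ 1)\<^sup>2 + (x $ 2)\<^sup>2) powr (l / 2) * u (ang x))"
proof -
  define \<rho> where "\<rho> x = inverse ((x $ 1)\<^sup>2 + (x $ 2)\<^sup>2)" for x :: "real^2"
  define N where "N x = ((x $ 1)\<^sup>2 + (x $ 2)\<^sup>2) powr (l / 2)" for x :: "real^2"
  \<comment> \<open>The inverse of the leading coefficient is itself a generator, so that the
    equation can be solved for \<open>u''\<close> within the algebra.\<close>
  define A where "A t = inverse (1 - k\<^sup>2 * (sin (2 * t))\<^sup>2)" for t :: real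
  define sn where "sn t = sin (2 * t)" for t :: real
  define cs where "cs t = cos (2 * t)" for t :: real
  define X where "X i x = x $ i" for i and x :: "real^2"
  define B where "B = {X 1, X 2, \<rho>, N} \<union> (\<lambda>f x. f (ang x)) ` {sn, cs, u, u', A}"
  have B: "alg B (\<lambda>x. x $ 1)" "alg B (\<lambda>x. x $ 2)" "alg B \<rho>" "alg B N" "alg B (\<lambda>x. sn (ang x))" "alg B (\<lambda>x. cs (ang x))"
    "alg B (\<lambda>x. u (ang x))" "alg B (\<lambda>x. u' (ang x))" "alg B (\<lambda>x. A (ang x))"
    using alg.base[of "X 1" B] alg.base[of "X 2" B] by (auto intro: alg.base simp: B_def X_def[abs_def])
  have Xd: "((\<lambda>x. x $ i) has_derivative (\<lambda>u. u $ i)) (at x)" for i and x :: "real^2"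
    by (intro bounded_linear_imp_has_derivative bounded_linear_vec_nth)
  have pos: "(x $ 1)\<^sup>2 + (x $ 2)\<^sup>2 > 0" if "x \<in> S" for x
    using that \<open>0 \<notin> S\<close> by (metis real2_eq_iff sum_power2_gt_zero_iff zero_index)
  have rd: "((\<lambda>x. (x $ 1)\<^sup>2 + (x $ 2)\<^sup>2) has_derivative (\<lambda>u. 2 * x $ 1 * u $ 1 + 2 * x $ 2 * u $ 2)) (at x)"
    for x :: "real^2"
    by (rule derivative_eq_intros Xd refl | simp add: fun_eq_iff)+
  have angc: "\<exists>g h. alg B g \<and> alg B h \<and>
      (\<forall>x\<in>S. ((\<lambda>x. f (ang x)) has_derivative (\<lambda>u. u $ 1 * g x + u $ 2 * h x)) (at x))"
    if f: "\<And>t. (f has_real_derivative f' t) (at t)" and f': "alg B (\<lambda>x. f' (ang x))" for f f'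
  proof -
    have "((\<lambda>x. f (ang x)) has_derivative
       (\<lambda>u. u $ 1 * (f' (ang x) * (x $ 2 * \<rho> x)) + u $ 2 * (f' (ang x) * (- 1 * (x $ 1 * \<rho> x))))) (at x)"
      if "x \<in> S" for x
    proof -
      have "(f has_derivative (*) (f' (ang x))) (at (ang x))"
        using f by (simp add: has_field_derivative_def)
      from has_derivative_compose[OF ang[OF that] this] show ?thesis
        by (rule has_derivative_eq_rhs) (simp add: fun_eq_iff \<rho>_def algebra_simps)
    qed
    moreover have "alg B (\<lambda>x. f' (ang x) * (x $ 2 * \<rho> x))" "alg B (\<lambda>x. f' (ang x) * (- 1 * (x $ 1 * \<rho> x)))"
      by (intro alg.mult f' B alg.const)+
    ultimately show ?thesis by blast
  qed
  have ne: "1 - k\<^sup>2 * (sin (2 * t))\<^sup>2 \<noteq> 0" for t using symbol_pos[OF k, of "2 * t"] by simp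
  have closed: "\<exists>g h. alg B g \<and> alg B h \<and>
      (\<forall>x\<in>S. (b has_derivative (\<lambda>u. u $ 1 * g x + u $ 2 * h x)) (at x))" if "b \<in> B" for b
  proof -
    consider "b = X 1" | "b = X 2" | "b = \<rho>" | "b = N" | "b = (\<lambda>x. sn (ang x))" | "b = (\<lambda>x. cs (ang x))"
      | "b = (\<lambda>x. u (ang x))" | "b = (\<lambda>x. u' (ang x))" | "b = (\<lambda>x. A (ang x))"
      using \<open>b \<in> B\<close> unfolding B_def by blast
    then show ?thesis
    proof cases
      case 1
      have "(b has_derivative (\<lambda>u. u $ 1 * (\<lambda>_. 1) x + u $ 2 * (\<lambda>_. 0) x)) (at x)" for x
        using Xd[of 1 x] by (simp add: 1 X_def[abs_def])
      then show ?thesis using alg.const by blast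
    next
      case 2
      have "(b has_derivative (\<lambda>u. u $ 1 * (\<lambda>_. 0) x + u $ 2 * (\<lambda>_. 1) x)) (at x)" for x
        using Xd[of 2 x] by (simp add: 2 X_def[abs_def])
      then show ?thesis using alg.const by blast
    next
      case 3
      have "(b has_derivative (\<lambda>u. u $ 1 * (- 2 * (x $ 1 * (\<rho> x * \<rho> x))) + u $ 2 * (- 2 * (x $ 2 * (\<rho> x * \<rho> x))))) (at x)"
        if "x \<in> S" for x
        unfolding 3 \<rho>_def
        by (rule has_derivative_eq_rhs[OF Deriv.has_derivative_inverse[OF _ rd]])
          (use pos[OF that] in \<open>auto simp: fun_eq_iff algebra_simps\<close>)
      moreover have "alg B (\<lambda>x. - 2 * (x $ 1 * (\<rho> x * \<rho> x)))" "alg B (\<lambda>x. - 2 * (x $ 2 * (\<rho> x * \<rho> x)))"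
        by (intro alg.mult B alg.const)+
      ultimately show ?thesis by blast
    next
      case 4
      have "(b has_derivative (\<lambda>u. u $ 1 * (l * (x $ 1 * (N x * \<rho> x))) + u $ 2 * (l * (x $ 2 * (N x * \<rho> x))))) (at x)"
        if "x \<in> S" for x
      proof -
        have "((\<lambda>r. r powr (l / 2)) has_derivative
           (*) (l / 2 * ((x $ 1)\<^sup>2 + (x $ 2)\<^sup>2) powr (l / 2 - 1))) (at ((x $ 1)\<^sup>2 + (x $ 2)\<^sup>2))"
          using has_real_derivative_powr[OF pos[OF that], of "l / 2"] by (simp add: has_field_derivative_def)
        from has_derivative_compose[OF rd this] have D: "(b has_derivative (\<lambda>u. l / 2 *
            ((x $ 1)\<^sup>2 + (x $ 2)\<^sup>2) powr (l / 2 - 1) * (2 * x $ 1 * u $ 1 + 2 * x $ 2 * u $ 2))) (at x)"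
          unfolding 4 N_def[abs_def] .
        have "r powr (l / 2 - 1) = r powr (l / 2) * inverse r" if "r > 0" for r
          using powr_diff[of r "l / 2" 1] that by (simp only: powr_one divide_inverse less_imp_le)
        then have e: "((x $ 1)\<^sup>2 + (x $ 2)\<^sup>2) powr (l / 2 - 1) = N x * \<rho> x"
          using pos[OF that] unfolding N_def \<rho>_def by blast
        show ?thesis
          by (rule has_derivative_eq_rhs[OF D]) (simp add: e fun_eq_iff algebra_simps)
      qed
      moreover have "alg B (\<lambda>x. l * (x $ 1 * (N x * \<rho> x)))" "alg B (\<lambda>x. l * (x $ 2 * (N x * \<rho> x)))"
        by (intro alg.mult B alg.const)+
      ultimately show ?thesis by blast
    next
      case 5
      show ?thesis unfolding 5
      proof (rule angc)
        show "(sn has_real_derivative 2 * cs t) (at t)" for t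
          unfolding sn_def cs_def by (auto intro!: derivative_eq_intros)
        show "alg B (\<lambda>x. 2 * cs (ang x))" by (intro alg.mult B alg.const)
      qed
    next
      case 6
      show ?thesis unfolding 6
      proof (rule angc)
        show "(cs has_real_derivative - 2 * sn t) (at t)" for t
          unfolding sn_def cs_def by (auto intro!: derivative_eq_intros)
        show "alg B (\<lambda>x. - 2 * sn (ang x))" by (intro alg.mult B alg.const)
      qed
    next
      case 7
      show ?thesis unfolding 7 by (rule angc[OF principalD(1)[OF pr] B(8)])
    next
      case 8
      show ?thesis unfolding 8
      proof (rule angc[where f' = u''])
        show "(u' has_real_derivative u'' t) (at t)" for t by (rule principalD(2)[OF pr])
        \<comment> \<open>The eigenvalue equation expresses the second derivative through
          \<open>u\<close>, \<open>u'\<close> and trigonometric generators, so no higher derivatives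
          of \<open>u\<close> are needed as generators.\<close>
        have "u'' t = A t * (\<mu> * u t + - 1 * ((l - 1) * (k\<^sup>2 * (2 * (sn t * cs t))) * u' t)
            + k\<^sup>2 * (l * ((2 * (sn t * sn t) + l * (cs t * cs t)) * u t)))" for t
        proof -
          have "(1 - k\<^sup>2 * (sin (2 * t))\<^sup>2) * u'' t = \<mu> * u t + - 1 * ((l - 1) * (k\<^sup>2 * (2 * (sn t * cs t))) * u' t)
            + k\<^sup>2 * (l * ((2 * (sn t * sn t) + l * (cs t * cs t)) * u t))"
            using principalD(5)[OF pr, of t]
            unfolding circle_op_def sin_4_eq sn_def cs_def by algebra
          then show ?thesis using ne[of t] by (simp add: A_def field_simps)
        qed
        then have "(\<lambda>x. u'' (ang x)) = (\<lambda>x. A (ang x) * (\<mu> * u (ang x) + - 1 * ((l - 1) * (k\<^sup>2 * (2 * (sn (ang x) * cs (ang x)))) * u' (ang x))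
            + k\<^sup>2 * (l * ((2 * (sn (ang x) * sn (ang x)) + l * (cs (ang x) * cs (ang x))) * u (ang x)))))"
          by (simp add: fun_eq_iff)
        moreover have "alg B \<dots>" by (intro alg.mult alg.add B alg.const)
        ultimately show "alg B (\<lambda>x. u'' (ang x))" by simp
      qed
    next
      case 9
      show ?thesis unfolding 9
      proof (rule angc)
        show "(A has_real_derivative k\<^sup>2 * (4 * (sn t * cs t)) * (A t * A t)) (at t)" for t
          unfolding A_def sn_def cs_def using ne[of t]
          by (auto intro!: derivative_eq_intros simp: algebra_simps)
        show "alg B (\<lambda>x. k\<^sup>2 * (4 * (sn (ang x) * cs (ang x))) * (A (ang x) * A (ang x)))"
          by (intro alg.mult B alg.const)
      qed
    qed
  qed
  have "alg B (\<lambda>x. N x * u (ang x))" by (intro alg.mult B)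
  from alg_Ck_on[OF \<open>open S\<close> closed this] show ?thesis unfolding N_def .
qed

lemma periodic_arctan_tan:
  fixes u :: "real \<Rightarrow> real"
  assumes per: "\<And>t. u (t + pi) = u t" and "cos t \<noteq> 0"
  shows "u (arctan (tan t)) = u t"
proof -
  define a where "a = arctan (tan t)"
  have "tan a = tan t" by (simp only: a_def tan_arctan)
  moreover have "cos a \<noteq> 0" by (simp add: a_def)
  ultimately have "sin (t - a) = 0"
    using \<open>cos t \<noteq> 0\<close> by (simp add: tan_def sin_diff field_simps)
  then obtain i where "t - a = real_of_int i * pi" using sin_zero_iff_int2 by blast
  then have "t = a + pi * real_of_int i" by (simp add: algebra_simps)
  then show ?thesis using periodic_int[of u pi a i] per by (simp add: a_def)
qed

text \<open>The eigenfunction is the extension \<open>|x|^l u(angle)\<close>. Different branches of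
  the angle differ by multiples of pi/2, a period of \<open>u\<close>, so the extension is well
  defined and smooth across the axes.\<close>

lemma principal_eigenvalue:
  assumes k: "0 < k" "k < 1" and pr: "principal k l \<mu> u u' u''"
  shows "\<mu> \<in> eigenvalues k l"
proof -
  define S1 where "S1 = {x :: real^2. x $ 2 \<noteq> 0}"
  define S2 where "S2 = {x :: real^2. x $ 1 \<noteq> 0}"
  \<comment> \<open>On the axis \<open>x $ 2 = 0\<close> the quotient is meaningless and the angle
    is pi/2 up to a multiple of pi.\<close>
  define ang where "ang x = (if x $ 2 = 0 then pi / 2 else arctan (x $ 1 / x $ 2))" for x :: "real^2"
  define v where "v x = ((x $ 1)\<^sup>2 + (x $ 2)\<^sup>2) powr (l / 2) * u (ang x)" for x :: "real^2"
  have opens: "open S1" "open S2"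
    unfolding S1_def S2_def by (intro open_Collect_neq continuous_intros)+
  have Xd: "((\<lambda>x. x $ i) has_derivative (\<lambda>u. u $ i)) (at x)" for i and x :: "real^2"
    by (intro bounded_linear_imp_has_derivative bounded_linear_vec_nth)
  have upi: "u (t + pi) = u t" for t
    using principalD(3)[OF pr, of t] principalD(3)[OF pr, of "t + pi / 2"] by (simp add: add.assoc)
  have at: "((\<lambda>x. arctan (x $ i / x $ j)) has_derivative
      (\<lambda>h. (x $ j * h $ i - x $ i * h $ j) * inverse ((x $ i)\<^sup>2 + (x $ j)\<^sup>2))) (at x)"
    if "x $ j \<noteq> 0" for x :: "real^2" and i j
  proof -
    have "1 + (x $ i / x $ j)\<^sup>2 = ((x $ i)\<^sup>2 + (x $ j)\<^sup>2) / (x $ j)\<^sup>2"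
      using that by (simp add: field_simps)
    moreover have "inverse (s / (x $ j)\<^sup>2) * (d / (x $ j * x $ j)) = d * inverse s" for s d
      using that by (simp add: inverse_eq_divide power2_eq_square)
    ultimately have e: "inverse (1 + (x $ i / x $ j)\<^sup>2) * ((h $ i * x $ j - x $ i * h $ j) / (x $ j * x $ j))
        = (x $ j * h $ i - x $ i * h $ j) * inverse ((x $ i)\<^sup>2 + (x $ j)\<^sup>2)" for h :: "real^2"
      by (simp only: mult.commute[of "h $ i"])
    have "((\<lambda>x. arctan (x $ i / x $ j)) has_derivative
      (\<lambda>h. inverse (1 + (x $ i / x $ j)\<^sup>2) * ((h $ i * x $ j - x $ i * h $ j) / (x $ j * x $ j)))) (at x)"
      by (rule has_derivative_compose[OF has_derivative_divide'[OF Xd Xd that] DERIV_arctan[unfolded has_field_derivative_def]])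
    then show ?thesis unfolding e .
  qed
  have "Ck_on n (- {0}) v" for n
  proof -
    have "Ck_on n S1 (\<lambda>x. ((x $ 1)\<^sup>2 + (x $ 2)\<^sup>2) powr (l / 2) * u (arctan (x $ 1 / x $ 2)))"
      using at[of _ 2 1] by (intro polar_Ck_on[OF opens(1) _ k _ pr]) (auto simp: S1_def)
    then have 1: "Ck_on n S1 v"
      by (rule Ck_on_cong[OF opens(1), rotated]) (simp add: S1_def v_def ang_def)
    have "Ck_on n S2 (\<lambda>x. ((x $ 1)\<^sup>2 + (x $ 2)\<^sup>2) powr (l / 2) * u (- arctan (x $ 2 / x $ 1)))"
    proof (intro polar_Ck_on[OF opens(2) _ k _ pr])
      fix x assume "x \<in> S2"
      then have "x $ 1 \<noteq> 0" by (simp add: S2_def)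
      from has_derivative_minus[OF at[of x 1 2, OF this]]
      show "((\<lambda>x. - arctan (x $ 2 / x $ 1)) has_derivative
        (\<lambda>h. (x $ 2 * h $ 1 - x $ 1 * h $ 2) * inverse ((x $ 1)\<^sup>2 + (x $ 2)\<^sup>2))) (at x)"
        by (rule has_derivative_eq_rhs) (simp add: fun_eq_iff algebra_simps)
    qed (simp add: S2_def)
    then have 2: "Ck_on n S2 v"
    proof (rule Ck_on_cong[OF opens(2), rotated])
      fix x assume "x \<in> S2"
      then have x1: "x $ 1 \<noteq> 0" by (simp add: S2_def)
      have "u (- arctan (x $ 2 / x $ 1)) = u (ang x)"
      proof (cases "x $ 2 = 0")
        case True
        then show ?thesis using principalD(3)[OF pr, of 0] by (simp add: ang_def)
      next
        case False
        \<comment> \<open>The inversion formula for \<open>arctan\<close> shows that the two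
          branches differ by pi/2 in one direction or the other.\<close>
        define y where "y = x $ 2 / x $ 1"
        have y: "y \<noteq> 0" "x $ 1 / x $ 2 = 1 / y" using x1 False by (simp_all add: y_def)
        have "ang x = sgn y * pi / 2 - arctan y" using False y Transcendental.arctan_inverse[of y] by (simp add: ang_def)
        then have "ang x = - arctan y + pi / 2 \<or> ang x + pi / 2 = - arctan y"
          using y(1) by (auto simp: sgn_if)
        then show ?thesis using principalD(3)[OF pr] unfolding y_def by metis
      qed
      then show "((x $ 1)\<^sup>2 + (x $ 2)\<^sup>2) powr (l / 2) * u (- arctan (x $ 2 / x $ 1)) = v x"
        by (simp add: v_def)
    qed
    have "S1 \<union> S2 = - {0}" by (auto simp: S1_def S2_def real2_eq_iff)
    then show ?thesis using Ck_on_Un[OF opens 1 2] by simp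
  qed
  moreover have "v (r *\<^sub>R x) = \<bar>r\<bar> powr l * v x" if "r \<noteq> 0" "x \<noteq> 0" for r x
  proof -
    have "ang (r *\<^sub>R x) = ang x" using that by (simp add: ang_def)
    moreover have "((r *\<^sub>R x) $ 1)\<^sup>2 + ((r *\<^sub>R x) $ 2)\<^sup>2 = r\<^sup>2 * ((x $ 1)\<^sup>2 + (x $ 2)\<^sup>2)"
      by (simp add: power_mult_distrib algebra_simps)
    moreover have "(r\<^sup>2) powr (l / 2) = \<bar>r\<bar> powr l"
      using powr_powr[of "\<bar>r\<bar>" 2 "l / 2"] by simp
    ultimately show ?thesis by (simp add: v_def powr_mult)
  qed
  ultimately have V: "v \<in> V l" by (simp add: V_def smooth_on_def)
  have vc: "v (circ t) = u t" for t
  proof (cases "cos t = 0")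
    case True
    then obtain i where i: "odd i" "t = real_of_int i * (pi / 2)" using cos_zero_iff_int by blast
    then have "t = pi / 2 + pi / 2 * real_of_int (i - 1)" by (simp add: field_simps)
    then have "u t = u (pi / 2)" using periodic_int[of u "pi / 2" "pi / 2" "i - 1"] principalD(3)[OF pr] by simp
    then show ?thesis using True sin_cos_squared_add[of t] by (simp add: v_def ang_def)
  next
    case False
    then show ?thesis using periodic_arctan_tan[of u t] upi by (simp add: v_def ang_def tan_def)
  qed
  note hd = V_hom_diff[OF V]
  have D: "((\<lambda>s. g (circ s)) has_real_derivative - K12 g (circ t)) (at t)" if "hom_diff l g" for g t
    using that by (intro K12_circ) (simp add: hom_diff_def)
  have u': "- K12 v (circ t) = u' t" for t
    using DERIV_unique[OF D[OF hd(1), of t]] principalD(1)[OF pr, of t] by (simp add: vc)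
  have "((\<lambda>s. - K12 v (circ s)) has_real_derivative - (- K12 (K12 v) (circ t))) (at t)" for t
    by (intro DERIV_minus D hd)
  then have u'': "K12 (K12 v) (circ t) = u'' t" for t
    using DERIV_unique[OF _ principalD(2)[OF pr, of t]] by (simp add: u')
  have C: "K12 (K12 v) (circ t) - k\<^sup>2 * A12 (A12 v) (circ t) = \<mu> * v (circ t)" for t
    unfolding operator_circ[OF V] u' using principalD(5)[OF pr, of t] by (simp add: vc u'')
  have "\<mu> * v x = K12 (K12 v) x - k\<^sup>2 * A12 (A12 v) x" if x: "x \<noteq> 0" for x
  proof -
    obtain r t where r: "r > 0" "x = r *\<^sub>R circ t" using polar_exists[OF x] by blast
    have h: "g (r *\<^sub>R circ t) = \<bar>r\<bar> powr l * g (circ t)" if "hom_diff l g" for g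
      using that r(1) by (simp add: hom_diff_def)
    have "K12 (K12 v) x - k\<^sup>2 * A12 (A12 v) x = \<bar>r\<bar> powr l * (K12 (K12 v) (circ t) - k\<^sup>2 * A12 (A12 v) (circ t))"
      unfolding r(2) using r(1) by (simp add: K12_A12_hom[OF hd(2)] K12_A12_hom[OF hd(3)] right_diff_distrib)
    then show ?thesis by (simp add: C r(2) h[OF hd(1)])
  qed
  moreover have "circ 0 \<noteq> 0 \<and> v (circ 0) \<noteq> 0" using principalD(4)[OF pr, of 0] by (simp add: vc)
  ultimately show ?thesis unfolding eigenvalues_def using V by blast
qed

lemma leading_eigenvalue_eq:
  assumes k: "0 < k" "k < 1" and pr: "principal k l \<mu> u u' u''"
  shows "leading_eigenvalue k l = \<mu>"
  unfolding leading_eigenvalue_def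
  by (rule Greatest_equality) (use principal_eigenvalue[OF assms] eigenvalue_le_principal[OF assms] in auto)

lemma leading_eigenvalue_principal:
  assumes "0 < k" "k < 1"
  obtains u u' u'' where "principal k l (leading_eigenvalue k l) u u' u''"
  using principal_exists[OF assms] leading_eigenvalue_eq[OF assms] by metis

section \<open>Trial functions and the expansion of the eigenvalue\<close>

text \<open>In the variable \<open>C = cos 4t\<close> the operator acts on \<open>p(cos 4t)\<close> as \<open>diag_op + k\<^sup>2 * coupling_op\<close>.
  The polynomials \<open>trial1\<close> to \<open>trial5\<close> are the coefficients of \<open>k\<^sup>2, ..., k\<^sup>1\<^sup>0\<close> in the formal perturbation
  series of the eigenfunction, normalised to have mean 1 over the circle.\<close>

definition diag_op :: "real poly \<Rightarrow> real \<Rightarrow> real" where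
  "diag_op p C = 16 * ((1 - C\<^sup>2) * poly (pderiv (pderiv p)) C - C * poly (pderiv p) C)"

definition coupling_op :: "real \<Rightarrow> real poly \<Rightarrow> real \<Rightarrow> real" where
  "coupling_op l p C = - ((1 - C) / 2) * diag_op p C - 4 * (l - 1) * (1 - C\<^sup>2) * poly (pderiv p) C
     - l * ((1 - C) + l * ((1 + C) / 2)) * poly p C"

text \<open>The numbers \<open>mu1\<close> to \<open>mu5\<close> are fixed by solvability:
  \<open>diag_op\<close> is the second derivative in \<open>t\<close>, so its values have mean zero
  over the circle, and at each order the new coefficient must cancel the mean of the remaining
  terms.\<close>

definition mu1 :: "real \<Rightarrow> real" where
  "mu1 l = - (l * (l + 2) / 2)"

definition mu2 :: "real \<Rightarrow> real" where
  "mu2 l = (l - 2) * l * (l + 2) * (l + 4) / 128"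

definition mu3 :: "real \<Rightarrow> real" where
  "mu3 l = (l - 2) * l * (l + 2) * (l + 4) / 256"

definition mu4 :: "real \<Rightarrow> real" where
  "mu4 l = - ((l - 2) * l * (l + 2) * (l + 4)
                * (7 * l ^ 4 + 28 * l ^ 3 + 36 * l ^ 2 + 16 * l - 5248) / 2097152)"

definition mu5 :: "real \<Rightarrow> real" where
  "mu5 l = - ((l - 2) * l * (l + 2) * (l + 4)
                * (21 * l ^ 4 + 84 * l ^ 3 + 108 * l ^ 2 + 48 * l - 7552) / 4194304)"

text \<open>Coupling raises the degree in C by one, so the j-th correction has degree at most j.
  Padding all of them to one shape makes differentiation and evaluation single rewrite
  rules.\<close>

definition quintic :: "real \<Rightarrow> real \<Rightarrow> real \<Rightarrow> real \<Rightarrow> real \<Rightarrow> real \<Rightarrow> real poly" where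
  "quintic a b c d e f = [:a, b, c, d, e, f:]"

definition trial1 :: "real \<Rightarrow> real poly" where
  "trial1 l = quintic
     0
     (- (l * (l - 2) / 32))
     0 0 0 0"

definition trial2 :: "real \<Rightarrow> real poly" where
  "trial2 l = quintic
     (- (l * (l - 2) * (l - 4) * (l - 6) / 8192))
     (- (l * (l - 2) / 64))
     (l * (l - 2) * (l - 4) * (l - 6) / 4096)
     0 0 0"

definition trial3 :: "real \<Rightarrow> real poly" where
  "trial3 l = quintic
     (- (l * (l - 2) * (l - 4) * (l - 6) / 8192))
     (l * (l - 2) * (11 * l ^ 4 + 28 * l ^ 3 + 196 * l ^ 2 - 592 * l - 6912) / 786432)
     (l * (l - 2) * (l - 4) * (l - 6) / 4096)
     (- (l * (l - 2) * (l - 4) * (l - 6) * (l ^ 2 - 18 * l + 80) / 1179648))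
     0 0"

definition trial4 :: "real \<Rightarrow> real poly" where
  "trial4 l = quintic
     (l * (l - 2) * (l - 4) * (l - 6) * (107 * l ^ 4 + 412 * l ^ 3 + 836 * l ^ 2 - 1360 * l - 169600) / 1610612736)
     (l * (l - 2) * (11 * l ^ 4 + 28 * l ^ 3 + 196 * l ^ 2 - 592 * l - 2816) / 524288)
     (- (l * (l - 2) * (l - 4) * (l - 6) * (27 * l ^ 4 + 92 * l ^ 3 + 388 * l ^ 2 - 1616 * l - 39040) / 201326592))
     (- (l * (l - 2) * (l - 4) * (l - 6) * (l ^ 2 - 18 * l + 80) / 786432))
     (l * (l - 2) * (l - 4) * (l - 6) * (l ^ 4 - 44 * l ^ 3 + 716 * l ^ 2 - 5104 * l + 13440) / 603979776)
     0"

definition trial5 :: "real \<Rightarrow> real poly" where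
  "trial5 l = quintic
     (l * (l - 2) * (l - 4) * (l - 6) * (107 * l ^ 4 + 412 * l ^ 3 + 836 * l ^ 2 - 1360 * l - 71296) / 805306368)
     (- (l * (l - 2) * (3191 * l ^ 8 + 22392 * l ^ 7 + 87864 * l ^ 6 + 36928 * l ^ 5 - 6230416 * l ^ 4 - 17053312 * l ^ 3 - 103561984 * l ^ 2 + 316004352 * l + 910295040) / 257698037760))
     (- (l * (l - 2) * (l - 4) * (l - 6) * (27 * l ^ 4 + 92 * l ^ 3 + 388 * l ^ 2 - 1616 * l - 14464) / 100663296))
     (l * (l - 2) * (l - 4) * (l - 6) * (49 * l ^ 6 - 702 * l ^ 5 + 1300 * l ^ 4 + 120 * l ^ 3 - 21344 * l ^ 2 + 2038272 * l - 10168320) / 96636764160)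
     (l * (l - 2) * (l - 4) * (l - 6) * (l ^ 4 - 44 * l ^ 3 + 716 * l ^ 2 - 5104 * l + 13440) / 301989888)
     (- (l * (l - 2) * (l - 4) * (l - 6) * (l ^ 6 - 78 * l ^ 5 + 2500 * l ^ 4 - 42120 * l ^ 3 + 393184 * l ^ 2 - 1926912 * l + 3870720) / 483183820800))"

definition trial :: "real \<Rightarrow> real \<Rightarrow> real poly" where
  "trial K l = 1 + smult K (trial1 l) + smult (K ^ 2) (trial2 l) + smult (K ^ 3) (trial3 l)
     + smult (K ^ 4) (trial4 l) + smult (K ^ 5) (trial5 l)"

definition mu_approx :: "real \<Rightarrow> real \<Rightarrow> real" where
  "mu_approx K l = K * mu1 l + K ^ 2 * mu2 l + K ^ 3 * mu3 l + K ^ 4 * mu4 l + K ^ 5 * mu5 l"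

lemma poly_quintic:
  "poly (quintic a b c d e f) C = a + C * (b + C * (c + C * (d + C * (e + C * f))))"
  by (simp add: quintic_def)

lemma pderiv_quintic:
  "pderiv (quintic a b c d e f) = quintic b (2 * c) (3 * d) (4 * e) (5 * f) 0"
  by (simp add: quintic_def pderiv_pCons)

lemma coupling_op_1: "coupling_op l 1 C = - l * ((1 - C) + l * ((1 + C) / 2))"
  by (simp add: coupling_op_def diag_op_def)

lemmas trial_simps = trial1_def trial2_def trial3_def trial4_def trial5_def
  mu1_def mu2_def mu3_def mu4_def mu5_def diag_op_def coupling_op_def pderiv_quintic poly_quintic

text \<open>This and the next four identities are the coefficients of \<open>K\<close> to
  \<open>K ^ 5\<close> in the eigenvalue equation; at order zero \<open>diag_op\<close> annihilates
  constants.\<close>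

lemma perturbation_order1: "diag_op (trial1 l) C = - coupling_op l 1 C + mu1 l"
  unfolding coupling_op_1 unfolding trial_simps by (simp add: field_simps)

lemma perturbation_order2: "diag_op (trial2 l) C = - coupling_op l (trial1 l) C + mu1 l * poly (trial1 l) C + mu2 l"
  unfolding trial_simps by (simp add: divide_simps) algebra

lemma perturbation_order3: "diag_op (trial3 l) C = - coupling_op l (trial2 l) C
    + mu1 l * poly (trial2 l) C + mu2 l * poly (trial1 l) C + mu3 l"
  unfolding trial_simps by (simp add: divide_simps) algebra

lemma perturbation_order4: "diag_op (trial4 l) C = - coupling_op l (trial3 l) C
    + mu1 l * poly (trial3 l) C + mu2 l * poly (trial2 l) C + mu3 l * poly (trial1 l) C + mu4 l"
  unfolding trial_simps by (simp add: divide_simps) algebra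

lemma perturbation_order5: "diag_op (trial5 l) C = - coupling_op l (trial4 l) C
    + mu1 l * poly (trial4 l) C + mu2 l * poly (trial3 l) C + mu3 l * poly (trial2 l) C
    + mu4 l * poly (trial1 l) C + mu5 l"
  unfolding trial_simps by (simp add: divide_simps) algebra

text \<open>The terms of total order at least six, divided by \<open>K ^ 6\<close>: the coupling of
  the last correction and the products of \<open>mu_i\<close> with the j-th correction for i + j
  between 6 and 10.\<close>

definition residual :: "real \<Rightarrow> real \<Rightarrow> real \<Rightarrow> real" where
  "residual K l C = coupling_op l (trial5 l) C
     - (mu1 l * poly (trial5 l) C + mu2 l * poly (trial4 l) C + mu3 l * poly (trial3 l) C
        + mu4 l * poly (trial2 l) C + mu5 l * poly (trial1 l) C)
     - K * (mu2 l * poly (trial5 l) C + mu3 l * poly (trial4 l) C + mu4 l * poly (trial3 l) C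
        + mu5 l * poly (trial2 l) C)
     - K ^ 2 * (mu3 l * poly (trial5 l) C + mu4 l * poly (trial4 l) C + mu5 l * poly (trial3 l) C)
     - K ^ 3 * (mu4 l * poly (trial5 l) C + mu5 l * poly (trial4 l) C)
     - K ^ 4 * (mu5 l * poly (trial5 l) C)"

lemma diag_op_linear:
  "diag_op (p + q) C = diag_op p C + diag_op q C" "diag_op (smult c p) C = c * diag_op p C" "diag_op 1 C = 0"
  by (simp_all add: diag_op_def pderiv_add pderiv_smult algebra_simps)

lemma coupling_op_linear:
  "coupling_op l (p + q) C = coupling_op l p C + coupling_op l q C"
  "coupling_op l (smult c p) C = c * coupling_op l p C"
  unfolding coupling_op_def diag_op_linear pderiv_add pderiv_smult poly_add poly_smult by algebra+

lemma trial_residual: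
  "diag_op (trial K l) C + K * coupling_op l (trial K l) C - mu_approx K l * poly (trial K l) C
    = K ^ 6 * residual K l C"
  unfolding trial_def diag_op_linear coupling_op_linear perturbation_order1 perturbation_order2 perturbation_order3 perturbation_order4 perturbation_order5
    poly_add poly_smult poly_1 mu_approx_def residual_def
  by algebra

lemma circle_op_poly:
  "circle_op k l (\<lambda>t. poly p (cos (4 * t))) (\<lambda>t. - 4 * sin (4 * t) * poly (pderiv p) (cos (4 * t)))
     (\<lambda>t. diag_op p (cos (4 * t))) t
   = diag_op p (cos (4 * t)) + k\<^sup>2 * coupling_op l p (cos (4 * t))"
proof -
  have c: "cos (4 * t) = 1 - 2 * (sin (2 * t))\<^sup>2" "cos (4 * t) = 2 * (cos (2 * t))\<^sup>2 - 1"
    using cos_double_sin[of "2 * t"] cos_double_cos[of "2 * t"] by simp_all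
  have s: "(sin (2 * t))\<^sup>2 = (1 - cos (4 * t)) / 2" using c(1) by simp
  have s': "(cos (2 * t))\<^sup>2 = (1 + cos (4 * t)) / 2" using c(2) by simp
  have s4: "sin (4 * t) * sin (4 * t) = 1 - (cos (4 * t))\<^sup>2"
    using sin_squared_eq[of "4 * t"] by (simp add: power2_eq_square)
  have "circle_op k l (\<lambda>t. poly p (cos (4 * t))) (\<lambda>t. - 4 * sin (4 * t) * poly (pderiv p) (cos (4 * t)))
     (\<lambda>t. diag_op p (cos (4 * t))) t
    = (1 - k\<^sup>2 * ((1 - cos (4 * t)) / 2)) * diag_op p (cos (4 * t))
      - 4 * (l - 1) * k\<^sup>2 * (sin (4 * t) * sin (4 * t)) * poly (pderiv p) (cos (4 * t))
      - k\<^sup>2 * l * (2 * ((1 - cos (4 * t)) / 2) + l * ((1 + cos (4 * t)) / 2)) * poly p (cos (4 * t))"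
    unfolding circle_op_def s s' by (simp add: algebra_simps)
  also have "\<dots> = diag_op p (cos (4 * t)) + k\<^sup>2 * coupling_op l p (cos (4 * t))"
    unfolding s4 coupling_op_def by (simp add: divide_simps) algebra
  finally show ?thesis .
qed

lemma poly_cos_derivatives:
  "((\<lambda>t. poly p (cos (4 * t))) has_real_derivative - 4 * sin (4 * t) * poly (pderiv p) (cos (4 * t))) (at t)"
  "((\<lambda>t. - 4 * sin (4 * t) * poly (pderiv p) (cos (4 * t))) has_real_derivative diag_op p (cos (4 * t))) (at t)"
proof -
  have d: "((\<lambda>t. poly q (cos (4 * t))) has_real_derivative - 4 * sin (4 * t) * poly (pderiv q) (cos (4 * t))) (at t)" for q
  proof -
    have "((\<lambda>t. cos (4 * t)) has_real_derivative - 4 * sin (4 * t)) (at t)"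
      by (auto intro!: derivative_eq_intros)
    from DERIV_chain2[OF poly_DERIV this] show ?thesis by (simp add: mult.commute)
  qed
  show "((\<lambda>t. poly p (cos (4 * t))) has_real_derivative - 4 * sin (4 * t) * poly (pderiv p) (cos (4 * t))) (at t)"
    by (rule d)
  have s4: "(sin (4 * t))\<^sup>2 = 1 - (cos (4 * t))\<^sup>2" by (rule sin_squared_eq)
  have "((\<lambda>t. - 4 * sin (4 * t) * poly (pderiv p) (cos (4 * t))) has_real_derivative
     - 16 * cos (4 * t) * poly (pderiv p) (cos (4 * t))
     + 16 * (sin (4 * t))\<^sup>2 * poly (pderiv (pderiv p)) (cos (4 * t))) (at t)"
    by (rule derivative_eq_intros d refl | simp add: algebra_simps power2_eq_square)+
  then show "((\<lambda>t. - 4 * sin (4 * t) * poly (pderiv p) (cos (4 * t))) has_real_derivative diag_op p (cos (4 * t))) (at t)"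
    unfolding s4 by (rule DERIV_cong) (unfold diag_op_def, algebra)
qed

section \<open>Uniform bounds for the residual and the trial function\<close>

lemma continuous_bounded_box:
  fixes f :: "real \<times> real \<times> real \<Rightarrow> real"
  assumes "continuous_on UNIV f"
  shows "\<exists>M>0. \<forall>K\<in>{0..1}. \<forall>l\<in>{-b..b}. \<forall>C\<in>{-1..1}. \<bar>f (K, l, C)\<bar> \<le> M"
proof -
  have "compact ({0..1::real} \<times> {-b..b} \<times> {-1..1::real})"
    by (intro compact_Times compact_Icc)
  then have "bounded (f ` ({0..1::real} \<times> {-b..b} \<times> {-1..1::real}))"
    by (intro compact_imp_bounded compact_continuous_image continuous_on_subset[OF assms]) auto
  then obtain M where "M > 0" "\<forall>x\<in>{0..1::real} \<times> {-b..b} \<times> {-1..1::real}. norm (f x) \<le> M"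
    unfolding bounded_pos by blast
  then show ?thesis by (intro exI[of _ M]) auto
qed

lemma residual_bounded: "\<exists>M>0. \<forall>K\<in>{0..1}. \<forall>l\<in>{-b..b}. \<forall>C\<in>{-1..1}. \<bar>residual K l C\<bar> \<le> M"
proof -
  have "continuous_on UNIV (\<lambda>(K, l, C). residual K l C)"
    unfolding residual_def trial_simps case_prod_unfold by (intro continuous_intros) simp_all
  from continuous_bounded_box[OF this, of b] show ?thesis by simp
qed

lemma trial_lower_bound:
  "\<exists>M>0. \<forall>K\<in>{0..1}. \<forall>l\<in>{-b..b}. \<forall>C\<in>{-1..1}. poly (trial K l) C \<ge> 1 - K * M"
proof -
  define g where "g K l C = poly (trial1 l) C + K * poly (trial2 l) C + K ^ 2 * poly (trial3 l) C
     + K ^ 3 * poly (trial4 l) C + K ^ 4 * poly (trial5 l) C" for K l C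
  have "continuous_on UNIV (\<lambda>(K, l, C). g K l C)"
    unfolding g_def trial_simps case_prod_unfold by (intro continuous_intros) simp_all
  from continuous_bounded_box[OF this, of b] obtain M where M: "M > 0"
    "\<And>K l C. K \<in> {0..1} \<Longrightarrow> l \<in> {-b..b} \<Longrightarrow> C \<in> {-1..1} \<Longrightarrow> \<bar>g K l C\<bar> \<le> M"
    by auto
  have e: "poly (trial K l) C = 1 + K * g K l C" for K l C
    by (simp add: trial_def g_def algebra_simps power_numeral_reduce)
  have "poly (trial K l) C \<ge> 1 - K * M" if "K \<in> {0..1}" "l \<in> {-b..b}" "C \<in> {-1..1}" for K l C
  proof -
    have "K * - M \<le> K * g K l C"
      using M(2)[OF that] that(1) by (intro mult_left_mono) (auto simp: abs_le_iff)
    then show ?thesis by (simp add: e)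
  qed
  with M(1) show ?thesis by blast
qed

theorem leading_eigenvalue_expansion:
  "\<exists>d>0. \<exists>M>0. d \<le> 1 \<and> (\<forall>k l. 0 < k \<longrightarrow> k < d \<longrightarrow> \<bar>l\<bar> \<le> b \<longrightarrow>
     \<bar>leading_eigenvalue k l - mu_approx (k\<^sup>2) l\<bar> \<le> M * k ^ 12)"
proof -
  obtain M1 where M1: "M1 > 0" "\<And>K l C. K \<in> {0..1} \<Longrightarrow> l \<in> {-b..b} \<Longrightarrow> C \<in> {-1..1} \<Longrightarrow> \<bar>residual K l C\<bar> \<le> M1"
    using residual_bounded[of b] by blast
  obtain M2 where M2: "M2 > 0" "\<And>K l C. K \<in> {0..1} \<Longrightarrow> l \<in> {-b..b} \<Longrightarrow> C \<in> {-1..1} \<Longrightarrow> poly (trial K l) C \<ge> 1 - K * M2"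
    using trial_lower_bound[of b] by blast
  \<comment> \<open>Since \<open>k\<^sup>2 \<le> k\<close>, this keeps the trial function above 1/2.
    Dividing the residual by it costs the factor 2 in the final constant
    \<open>2 * M1\<close>.\<close>
  define d where "d = min 1 (1 / (2 * M2))"
  have "d > 0" "d \<le> 1" using M2(1) by (auto simp: d_def)
  have "\<bar>leading_eigenvalue k l - mu_approx (k\<^sup>2) l\<bar> \<le> 2 * M1 * k ^ 12"
    if k: "0 < k" "k < d" and l: "\<bar>l\<bar> \<le> b" for k l
  proof -
    have k1: "k < 1" using k \<open>d \<le> 1\<close> by simp
    have l': "l \<in> {-b..b}" using l by auto
    have "k\<^sup>2 \<le> k" using k(1) k1 by (simp add: power2_eq_square mult_left_le)
    then have K: "k\<^sup>2 \<in> {0..1}" "k\<^sup>2 * M2 \<le> 1 / 2"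
    proof -
      show "k\<^sup>2 \<in> {0..1}" using \<open>k\<^sup>2 \<le> k\<close> k1 by simp
      have "k\<^sup>2 * M2 \<le> 1 / (2 * M2) * M2"
        using \<open>k\<^sup>2 \<le> k\<close> k(2) M2(1) by (intro mult_right_mono) (auto simp: d_def)
      then show "k\<^sup>2 * M2 \<le> 1 / 2" using M2(1) by simp
    qed
    have C: "cos (4 * t) \<in> {-1..1}" for t :: real by simp
    define p where "p = trial (k\<^sup>2) l"
    define u where "u t = poly p (cos (4 * t))" for t
    define u' where "u' t = - 4 * sin (4 * t) * poly (pderiv p) (cos (4 * t))" for t
    define u'' where "u'' t = diag_op p (cos (4 * t))" for t
    have ud: "(u has_real_derivative u' t) (at t)" "(u' has_real_derivative u'' t) (at t)" for t
      unfolding u_def[abs_def] u'_def[abs_def] u''_def[abs_def] by (rule poly_cos_derivatives)+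
    have u_half: "u t \<ge> 1 / 2" for t
      using M2(2)[OF K(1) l' C, of t] K(2) by (simp add: u_def p_def)
    then have upos: "u t > 0" for t using less_le_trans[of 0 "1 / 2" "u t"] by simp
    have "4 * (t + pi / 2) = 4 * t + 2 * pi" for t :: real by simp
    then have per: "u (t + pi / 2) = u t" for t unfolding u_def by (simp only: cos_periodic)
    have per2: "u (t + 2 * pi) = u t" for t
      using periodic_int[of u "pi / 2" t 4] per by simp
    have "circle_op k l u u' u'' t - mu_approx (k\<^sup>2) l * u t = k ^ 12 * residual (k\<^sup>2) l (cos (4 * t))" for t
      using trial_residual[of "k\<^sup>2" l "cos (4 * t)"]
      unfolding u_def[abs_def] u'_def[abs_def] u''_def[abs_def] circle_op_poly p_def
      by (simp flip: power_mult)
    moreover have "\<bar>k ^ 12 * residual (k\<^sup>2) l (cos (4 * t))\<bar> \<le> 2 * M1 * k ^ 12 * u t" for t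
    proof -
      have "\<bar>k ^ 12 * residual (k\<^sup>2) l (cos (4 * t))\<bar> \<le> k ^ 12 * M1"
        using M1(2)[OF K(1) l' C, of t] k(1) by (simp add: abs_mult)
      also have "\<dots> = 2 * M1 * k ^ 12 * (1 / 2)" by simp
      also have "\<dots> \<le> 2 * M1 * k ^ 12 * u t"
        using u_half[of t] M1(1) k(1) by (intro mult_left_mono) auto
      finally show ?thesis .
    qed
    ultimately have b: "\<bar>circle_op k l u u' u'' t - mu_approx (k\<^sup>2) l * u t\<bar> \<le> 2 * M1 * k ^ 12 * u t" for t
      by simp
    obtain f f' f'' where pr: "principal k l (leading_eigenvalue k l) f f' f''"
      using leading_eigenvalue_principal[OF k(1) k1] by blast
    have "leading_eigenvalue k l \<le> mu_approx (k\<^sup>2) l + 2 * M1 * k ^ 12"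
    proof (rule principal_lower[OF k(1) k1 pr ud per upos])
      show "circle_op k l u u' u'' t \<le> (mu_approx (k\<^sup>2) l + 2 * M1 * k ^ 12) * u t" for t
        using b[of t] by (simp add: abs_le_iff algebra_simps)
    qed
    moreover have "mu_approx (k\<^sup>2) l - 2 * M1 * k ^ 12 \<le> leading_eigenvalue k l"
    proof (rule principal_upper[OF k(1) k1 pr ud per2 upos])
      show "(mu_approx (k\<^sup>2) l - 2 * M1 * k ^ 12) * u t \<le> circle_op k l u u' u'' t" for t
        using b[of t] by (simp add: abs_le_iff algebra_simps)
    qed
    ultimately show ?thesis by (simp add: abs_le_iff)
  qed
  then show ?thesis
    using \<open>d > 0\<close> \<open>d \<le> 1\<close> M1(1) by (intro exI[of _ d] conjI exI[of _ "2 * M1"]) auto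
qed

section \<open>The Legendre transform\<close>

text \<open>Constants are positive eigenfunctions at \<open>l = 0\<close>. The resulting value 0 of
  \<open>l * s - Lam k l\<close> is the benchmark for excluding large \<open>l\<close>.\<close>

lemma Lam_0:
  assumes "0 < k" "k < 1"
  shows "Lam k 0 = 0"
proof -
  have "principal k 0 0 (\<lambda>_. 1) (\<lambda>_. 0) (\<lambda>_. 0)"
    by (simp add: principal_def circle_op_def)
  from leading_eigenvalue_eq[OF assms this] show ?thesis by (simp add: Lam_def)
qed

text \<open>The constant function 1 as trial function. The bound is crude but holds for every
  \<open>l\<close>, which gives the coercivity of \<open>Lam k\<close>.\<close>

lemma leading_eigenvalue_ge:
  assumes k: "0 < k" "k < 1"
  shows "leading_eigenvalue k l \<ge> - (k\<^sup>2 * (l\<^sup>2 + 2 * \<bar>l\<bar>))"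
proof -
  obtain f f' f'' where pr: "principal k l (leading_eigenvalue k l) f f' f''"
    using leading_eigenvalue_principal[OF k] by blast
  show ?thesis
  proof (rule principal_upper[OF k pr, where u = "\<lambda>_. 1" and u' = "\<lambda>_. 0" and u'' = "\<lambda>_. 0"])
    fix t
    have "l * (sin (2 * t))\<^sup>2 \<le> \<bar>l\<bar> * (sin (2 * t))\<^sup>2" by (intro mult_right_mono) auto
    also have "\<dots> \<le> \<bar>l\<bar> * 1" by (intro mult_left_mono) (simp_all add: abs_square_le_1)
    finally have 1: "l * (sin (2 * t))\<^sup>2 \<le> \<bar>l\<bar>" by simp
    have 2: "l\<^sup>2 * (cos (2 * t))\<^sup>2 \<le> l\<^sup>2 * 1" by (intro mult_left_mono) (simp_all add: abs_square_le_1)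
    have "l * (2 * (sin (2 * t))\<^sup>2 + l * (cos (2 * t))\<^sup>2) = 2 * (l * (sin (2 * t))\<^sup>2) + l\<^sup>2 * (cos (2 * t))\<^sup>2"
      by (simp add: algebra_simps power2_eq_square)
    also have "\<dots> \<le> l\<^sup>2 + 2 * \<bar>l\<bar>" using 1 2 by linarith
    finally have "k\<^sup>2 * (l * (2 * (sin (2 * t))\<^sup>2 + l * (cos (2 * t))\<^sup>2)) \<le> k\<^sup>2 * (l\<^sup>2 + 2 * \<bar>l\<bar>)"
      by (intro mult_left_mono) auto
    then show "- (k\<^sup>2 * (l\<^sup>2 + 2 * \<bar>l\<bar>)) * 1 \<le> circle_op k l (\<lambda>_. 1) (\<lambda>_. 0) (\<lambda>_. 0) t"
      by (simp add: circle_op_def mult.assoc)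
  qed auto
qed

text \<open>The eigenfunction \<open>f\<close> at \<open>l0\<close> is used as trial function at
  nearby \<open>l\<close>. The two operators applied to \<open>f\<close> differ by
  \<open>l - l0\<close> times a multiple of \<open>f\<close> that is bounded because
  \<open>f' / f\<close> is continuous and periodic.\<close>

lemma leading_eigenvalue_local_lipschitz:
  assumes k: "0 < k" "k < 1"
  shows "\<exists>M. \<forall>l. \<bar>l - l0\<bar> \<le> 1 \<longrightarrow> \<bar>leading_eigenvalue k l - leading_eigenvalue k l0\<bar> \<le> M * \<bar>l - l0\<bar>"
proof -
  obtain f f' f'' where pr: "principal k l0 (leading_eigenvalue k l0) f f' f''"
    using leading_eigenvalue_principal[OF k] by blast
  note d = principalD(1,2)[OF pr] and per = principalD(3)[OF pr] and pos = principalD(4)[OF pr]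
  have per2: "f (t + 2 * pi) = f t" for t
    using periodic_int[of f "pi / 2" t 4] per by simp
  have per': "f' (t + pi / 2) = f' t" for t
    using DERIV_unique[OF d(1)[of t]] DERIV_compose_affine[OF d(1), of "pi / 2" 1 t] per
    by (simp add: add.commute)
  have "continuous_on {0..pi / 2} (\<lambda>t. f' t / f t)"
    using DERIV_continuous_on[OF has_field_derivative_at_within[OF d(1)]]
      DERIV_continuous_on[OF has_field_derivative_at_within[OF d(2)]] pos
    by (intro continuous_on_divide) (auto simp: less_imp_neq[symmetric])
  then have "bounded ((\<lambda>t. f' t / f t) ` {0..pi / 2})"
    by (intro compact_imp_bounded compact_continuous_image) auto
  then obtain M0 where "\<forall>t\<in>{0..pi / 2}. \<bar>f' t / f t\<bar> \<le> M0" by (auto simp: bounded_real)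
  then have M0: "\<bar>f' t / f t\<bar> \<le> M0" for t
    using periodic_reduce[of "\<lambda>t. f' t / f t" "pi / 2" t] per per' by fastforce
  define M where "M = M0 + (2 * \<bar>l0\<bar> + 3)"
  have bnd: "\<bar>circle_op k l f f' f'' t - leading_eigenvalue k l0 * f t\<bar> \<le> (M * \<bar>l - l0\<bar>) * f t"
    if l: "\<bar>l - l0\<bar> \<le> 1" for l t
  proof -
    \<comment> \<open>The factor \<open>l - l0\<close> is pulled out of the difference of the
      operators; the quadratic dependence on \<open>l\<close> leaves \<open>l + l0\<close>, at most
      \<open>2 * \<bar>l0\<bar> + 1\<close> in modulus.\<close>
    define X where "X = sin (4 * t) * f' t - (2 * (sin (2 * t))\<^sup>2 + (l + l0) * (cos (2 * t))\<^sup>2) * f t"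
    have "circle_op k l f f' f'' t - circle_op k l0 f f' f'' t = (l - l0) * (k\<^sup>2 * X)"
      unfolding circle_op_def X_def by (simp add: algebra_simps power2_eq_square)
    then have e: "circle_op k l f f' f'' t - leading_eigenvalue k l0 * f t = (l - l0) * (k\<^sup>2 * X)"
      by (simp add: principalD(5)[OF pr])
    have "\<bar>X\<bar> \<le> \<bar>sin (4 * t) * f' t\<bar> + \<bar>(2 * (sin (2 * t))\<^sup>2 + (l + l0) * (cos (2 * t))\<^sup>2) * f t\<bar>"
      unfolding X_def by (rule abs_triangle_ineq4)
    also have "\<dots> \<le> M0 * f t + (2 * \<bar>l0\<bar> + 3) * f t"
    proof (rule add_mono)
      have "\<bar>f' t\<bar> \<le> M0 * f t" using M0[of t] pos[of t] by (simp add: abs_divide pos_divide_le_eq)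
      moreover have "\<bar>sin (4 * t)\<bar> * \<bar>f' t\<bar> \<le> 1 * \<bar>f' t\<bar>" by (intro mult_right_mono) auto
      ultimately show "\<bar>sin (4 * t) * f' t\<bar> \<le> M0 * f t" by (simp add: abs_mult)
      have "\<bar>2 * (sin (2 * t))\<^sup>2 + (l + l0) * (cos (2 * t))\<^sup>2\<bar> \<le> \<bar>2 * (sin (2 * t))\<^sup>2\<bar> + \<bar>l + l0\<bar> * \<bar>(cos (2 * t))\<^sup>2\<bar>"
        by (metis abs_mult abs_triangle_ineq)
      also have "\<dots> \<le> 2 * 1 + (2 * \<bar>l0\<bar> + 1) * 1"
        using l by (intro add_mono mult_mono) (auto simp: abs_square_le_1)
      finally have "\<bar>2 * (sin (2 * t))\<^sup>2 + (l + l0) * (cos (2 * t))\<^sup>2\<bar> \<le> 2 * \<bar>l0\<bar> + 3" by simp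
      then show "\<bar>(2 * (sin (2 * t))\<^sup>2 + (l + l0) * (cos (2 * t))\<^sup>2) * f t\<bar> \<le> (2 * \<bar>l0\<bar> + 3) * f t"
        using pos[of t] by (simp add: abs_mult)
    qed
    also have "\<dots> = M * f t" by (simp add: M_def algebra_simps)
    finally have X: "\<bar>X\<bar> \<le> M * f t" .
    have "k\<^sup>2 \<le> 1" using k by (simp add: power_le_one)
    then have "k\<^sup>2 * \<bar>X\<bar> \<le> 1 * (M * f t)" using X by (intro mult_mono) auto
    then have "\<bar>l - l0\<bar> * (k\<^sup>2 * \<bar>X\<bar>) \<le> \<bar>l - l0\<bar> * (M * f t)" by (intro mult_left_mono) auto
    then show ?thesis unfolding e by (simp add: abs_mult mult_ac)
  qed
  have "\<bar>leading_eigenvalue k l - leading_eigenvalue k l0\<bar> \<le> M * \<bar>l - l0\<bar>" if l: "\<bar>l - l0\<bar> \<le> 1" for l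
  proof -
    obtain g g' g'' where pr': "principal k l (leading_eigenvalue k l) g g' g''"
      using leading_eigenvalue_principal[OF k] by blast
    have "leading_eigenvalue k l \<le> leading_eigenvalue k l0 + M * \<bar>l - l0\<bar>"
      by (rule principal_lower[OF k pr' d per pos])
        (use bnd[OF l] in \<open>simp add: abs_le_iff algebra_simps\<close>)
    moreover have "leading_eigenvalue k l0 - M * \<bar>l - l0\<bar> \<le> leading_eigenvalue k l"
      by (rule principal_upper[OF k pr' d per2 pos])
        (use bnd[OF l] in \<open>simp add: abs_le_iff algebra_simps\<close>)
    ultimately show ?thesis by (simp add: abs_le_iff)
  qed
  then show ?thesis by blast
qed

lemma continuous_on_Lam:
  assumes k: "0 < k" "k < 1"
  shows "continuous_on S (Lam k)"
proof -
  have "isCont (leading_eigenvalue k) l0" for l0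
  proof -
    obtain M where M: "\<And>l. \<bar>l - l0\<bar> \<le> 1 \<Longrightarrow>
        \<bar>leading_eigenvalue k l - leading_eigenvalue k l0\<bar> \<le> M * \<bar>l - l0\<bar>"
      using leading_eigenvalue_local_lipschitz[OF k] by blast
    have "((\<lambda>l. leading_eigenvalue k l - leading_eigenvalue k l0) \<longlongrightarrow> 0) (at l0)"
    proof (rule Lim_null_comparison)
      have "\<forall>\<^sub>F l in at l0. dist l l0 < 1" by (auto simp: eventually_at intro: exI[of _ 1])
      then show "\<forall>\<^sub>F l in at l0. norm (leading_eigenvalue k l - leading_eigenvalue k l0) \<le> M * \<bar>l - l0\<bar>"
        by eventually_elim (use M in \<open>auto simp: dist_real_def\<close>)
      have "((\<lambda>l. M * \<bar>l - l0\<bar>) \<longlongrightarrow> M * \<bar>l0 - l0\<bar>) (at l0)" by (intro tendsto_intros)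
      then show "((\<lambda>l. M * \<bar>l - l0\<bar>) \<longlongrightarrow> 0) (at l0)" by simp
    qed
    then show ?thesis unfolding isCont_def by (rule LIM_zero_cancel)
  qed
  then have "continuous_on S (leading_eigenvalue k)"
    by (intro continuous_at_imp_continuous_on) auto
  then show ?thesis unfolding Lam_def[abs_def] by (intro continuous_intros) auto
qed

lemma Ups_attained:
  assumes k: "0 < k" "k \<le> 1 / 4" and b: "b \<ge> 3 * (\<bar>s\<bar> + 2)"
  shows "\<exists>l. \<bar>l\<bar> \<le> b \<and> Ups k s = l * s - Lam k l \<and> (\<forall>m. m * s - Lam k m \<le> Ups k s)"
proof -
  have k1: "k < 1" using k by simp
  define g where "g l = l * s - Lam k l" for l
  have "continuous_on {-b..b} g"
    unfolding g_def by (intro continuous_intros continuous_on_Lam k k1)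
  moreover have "{-b..b} \<noteq> {}" using b by auto
  ultimately obtain l where l: "l \<in> {-b..b}" "\<And>m. m \<in> {-b..b} \<Longrightarrow> g m \<le> g l"
    using continuous_attains_sup[of "{-b..b}" g] by auto
  have "g 0 = 0" using Lam_0[OF k(1) k1] by (simp add: g_def)
  then have "g l \<ge> 0" using l(2)[of 0] b by simp
  \<comment> \<open>With \<open>k \<le> 1 / 4\<close> at most one sixteenth of
    \<open>m\<^sup>2 + 2 * \<bar>m\<bar>\<close> is lost, and beyond
    \<open>3 * (\<bar>s\<bar> + 2)\<close> the remaining quadratic term dominates
    \<open>m * s - m\<close>.\<close>
  have out: "g m \<le> 0" if "\<bar>m\<bar> > b" for m
  proof -
    have "k\<^sup>2 \<le> (1 / 4)\<^sup>2" using k by (intro power_mono) auto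
    then have "k\<^sup>2 * (m\<^sup>2 + 2 * \<bar>m\<bar>) \<le> 1 / 16 * (m\<^sup>2 + 2 * \<bar>m\<bar>)"
      by (intro mult_right_mono) (auto simp: power2_eq_square)
    then have "Lam k m \<ge> m + m\<^sup>2 / 2 - 1 / 16 * (m\<^sup>2 + 2 * \<bar>m\<bar>)"
      using leading_eigenvalue_ge[OF k(1) k1, of m] unfolding Lam_def by linarith
    moreover have "m * s \<le> \<bar>m\<bar> * \<bar>s\<bar>" by (metis abs_ge_self abs_mult)
    moreover have "\<bar>m\<bar> * (3 * (\<bar>s\<bar> + 2)) \<le> \<bar>m\<bar> * \<bar>m\<bar>" using that b by (intro mult_left_mono) auto
    then have "3 * (\<bar>m\<bar> * \<bar>s\<bar>) + 6 * \<bar>m\<bar> \<le> m\<^sup>2" by (simp add: algebra_simps power2_eq_square)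
    moreover have "\<bar>m\<bar> * \<bar>s\<bar> \<ge> 0" "- m \<le> \<bar>m\<bar>" "\<bar>m\<bar> \<ge> 0" by auto
    \<comment> \<open>The products are replaced by variables, which leaves a linear
      statement.\<close>
    moreover have "ms - L \<le> 0" if "ms \<le> P" "L \<ge> m + q / 2 - 1 / 16 * (q + 2 * A)" "3 * P + 6 * A \<le> q"
        "P \<ge> 0" "- m \<le> A" "A \<ge> 0" for ms A P L q :: real
      using that by argo
    ultimately show ?thesis unfolding g_def by blast
  qed
  have max: "g m \<le> g l" for m
  proof (cases "\<bar>m\<bar> \<le> b")
    case True
    then show ?thesis using l(2)[of m] by (simp add: abs_le_iff)
  next
    case False
    then show ?thesis using out[of m] \<open>g l \<ge> 0\<close> by simp
  qed
  have "Ups k s = g l"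
    unfolding Ups_def by (rule Greatest_equality) (use max in \<open>auto simp: g_def\<close>)
  then show ?thesis using l(1) max by (intro exI[of _ l]) (auto simp: g_def)
qed

text \<open>By Taylor's formula the gain over \<open>f x\<close> is at most
  \<open>f' x * h - h\<^sup>2 / 4\<close> with \<open>h = y - x\<close>, and completing the square
  bounds this by \<open>(f' x)\<^sup>2\<close>.\<close>

lemma quadratic_upper_bound:
  fixes f f' f'' :: "real \<Rightarrow> real"
  assumes f: "\<And>x. (f has_real_derivative f' x) (at x)" "\<And>x. (f' has_real_derivative f'' x) (at x)"
    and c: "\<And>x. x \<in> {a..b} \<Longrightarrow> f'' x \<le> - 1 / 2" and x: "x \<in> {a..b}" and y: "y \<in> {a..b}"
  shows "f y \<le> f x + (f' x)\<^sup>2"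
proof (cases "y = x")
  case False
  define diff where "diff m = (if m = 0 then f else if m = 1 then f' else f'')" for m :: nat
  have "\<exists>t. (if y < x then y < t \<and> t < x else x < t \<and> t < y) \<and>
      f y = (\<Sum>m<2. (diff m x / fact m) * (y - x) ^ m) + (diff 2 t / fact 2) * (y - x) ^ 2"
    by (rule Taylor[where a = a and b = b]) (use f x y False in \<open>auto simp: diff_def less_2_cases_iff\<close>)
  then obtain t where t0: "if y < x then y < t \<and> t < x else x < t \<and> t < y"
      "f y = (\<Sum>m<2. (diff m x / fact m) * (y - x) ^ m) + (diff 2 t / fact 2) * (y - x) ^ 2" by blast
  have t: "t \<in> {a..b}" "f y = f x + f' x * (y - x) + f'' t / 2 * (y - x)\<^sup>2"
  proof -
    have "(\<Sum>m<2. (diff m x / fact m) * (y - x) ^ m) = f x + f' x * (y - x)" "diff 2 = f''"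
      by (simp_all add: diff_def lessThan_nat_numeral)
    then show "f y = f x + f' x * (y - x) + f'' t / 2 * (y - x)\<^sup>2" using t0(2) by simp
    show "t \<in> {a..b}" using t0(1) x y by (simp split: if_splits)
  qed
  have "f'' t / 2 * (y - x)\<^sup>2 \<le> - 1 / 4 * (y - x)\<^sup>2"
    using c[OF t(1)] by (intro mult_right_mono) auto
  moreover have "0 \<le> (f' x - (y - x) / 2)\<^sup>2" by simp
  then have "f' x * (y - x) - 1 / 4 * (y - x)\<^sup>2 \<le> (f' x)\<^sup>2"
    by (simp add: power2_eq_square field_simps)
  ultimately show ?thesis using t(2) by linarith
qed simp

section \<open>The truncated Legendre functional and its concavity\<close>

text \<open>With \<open>n = l (l + 2)\<close> and \<open>K = k\<^sup>2\<close>, every coefficient of the expansion of \<open>\<Lambda>\<close> is a polynomial in \<open>n\<close>.\<close>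

definition quartic4 :: "real \<Rightarrow> real" where
  "quartic4 n = 7 * n ^ 4 - 48 * n ^ 3 - 5312 * n ^ 2 + 41984 * n"

definition quartic5 :: "real \<Rightarrow> real" where
  "quartic5 n = 21 * n ^ 4 - 144 * n ^ 3 - 7744 * n ^ 2 + 60416 * n"

definition lam_approx :: "real \<Rightarrow> real \<Rightarrow> real" where
  "lam_approx K n = (1 - K) * n / 2 + (K ^ 2 / 128 + K ^ 3 / 256) * (n ^ 2 - 8 * n)
     - K ^ 4 / 2097152 * quartic4 n - K ^ 5 / 4194304 * quartic5 n"

text \<open>With \<open>n = l * (l + 2)\<close> one has \<open>(l - 2) * (l + 4) = n - 8\<close>,
  and the two quartic factors become \<open>7 * n\<^sup>2 + 8 * n - 5248\<close> and
  \<open>21 * n\<^sup>2 + 24 * n - 7552\<close>.\<close>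

lemma lam_approx_eq: "l + l\<^sup>2 / 2 + mu_approx K l = lam_approx K (l * (l + 2))"
  unfolding mu_approx_def mu1_def mu2_def mu3_def mu4_def mu5_def lam_approx_def quartic4_def quartic5_def
  by (simp add: divide_simps) algebra

definition leg :: "real \<Rightarrow> real \<Rightarrow> real \<Rightarrow> real" where
  "leg K s l = l * s - lam_approx K (l * (l + 2))"

text \<open>Twice the derivative of \<open>lam_approx K\<close> in \<open>n\<close>; as
  \<open>n\<close> has derivative \<open>2 * (l + 1)\<close>, the derivative in \<open>l\<close> is
  \<open>(l + 1) * slope\<close>.\<close>

definition slope :: "real \<Rightarrow> real \<Rightarrow> real" where
  "slope K n = 1 - K + (K ^ 2 / 64 + K ^ 3 / 128) * (2 * n - 8)
     - K ^ 4 / 1048576 * (28 * n ^ 3 - 144 * n ^ 2 - 10624 * n + 41984)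
     - K ^ 5 / 2097152 * (84 * n ^ 3 - 432 * n ^ 2 - 15488 * n + 60416)"

text \<open>The derivative of \<open>slope K\<close> in \<open>n\<close>, divided by
  \<open>K\<close>.\<close>

definition slope' :: "real \<Rightarrow> real \<Rightarrow> real" where
  "slope' K n = K / 32 + K ^ 2 / 64
     - K ^ 3 / 1048576 * (84 * n ^ 2 - 288 * n - 10624)
     - K ^ 4 / 2097152 * (252 * n ^ 2 - 864 * n - 15488)"

lemma leg_derivatives:
  "((\<lambda>l. leg K s l) has_real_derivative s - (l + 1) * slope K (l * (l + 2))) (at l)"
  "((\<lambda>l. s - (l + 1) * slope K (l * (l + 2))) has_real_derivative
     - slope K (l * (l + 2)) - 2 * (l + 1)\<^sup>2 * (K * slope' K (l * (l + 2)))) (at l)"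
proof -
  have n: "((\<lambda>l. l * (l + 2)) has_real_derivative 2 * (l + 1)) (at l)" for l :: real
    by (auto intro!: derivative_eq_intros)
  have a: "(lam_approx K has_real_derivative slope K n / 2) (at n)" for n
    unfolding lam_approx_def[abs_def] quartic4_def quartic5_def slope_def
    by (auto intro!: derivative_eq_intros simp: field_simps)
  have s: "(slope K has_real_derivative K * slope' K n) (at n)" for n
    unfolding slope_def[abs_def] slope'_def
    by (auto intro!: derivative_eq_intros simp: field_simps power_numeral_reduce)
  have "((\<lambda>l. l * s - lam_approx K (l * (l + 2))) has_real_derivative
      s - slope K (l * (l + 2)) / 2 * (2 * (l + 1))) (at l)"
    by (intro DERIV_diff DERIV_chain2[OF a n]) (auto intro!: derivative_eq_intros)
  then show "((\<lambda>l. leg K s l) has_real_derivative s - (l + 1) * slope K (l * (l + 2))) (at l)"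
    unfolding leg_def by (rule DERIV_cong) (simp add: algebra_simps)
  have "((\<lambda>l. s - (l + 1) * slope K (l * (l + 2))) has_real_derivative
     0 - (1 * slope K (l * (l + 2)) + K * slope' K (l * (l + 2)) * (2 * (l + 1)) * (l + 1))) (at l)"
    by (intro DERIV_diff DERIV_mult DERIV_chain2[OF s n]) (auto intro!: derivative_eq_intros)
  then show "((\<lambda>l. s - (l + 1) * slope K (l * (l + 2))) has_real_derivative
     - slope K (l * (l + 2)) - 2 * (l + 1)\<^sup>2 * (K * slope' K (l * (l + 2)))) (at l)"
    by (rule DERIV_cong) (simp add: algebra_simps power2_eq_square)
qed

text \<open>At \<open>K = 0\<close> the second derivative of \<open>leg\<close> is -1; the
  correction is \<open>K * W\<close> with \<open>W\<close> bounded on the box, so half of the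
  concavity survives for small \<open>K\<close>.\<close>

lemma leg_concave:
  "\<exists>d>0. d \<le> 1 \<and> (\<forall>K l. 0 \<le> K \<longrightarrow> K \<le> d \<longrightarrow> l \<in> {-b..b} \<longrightarrow>
     - slope K (l * (l + 2)) - 2 * (l + 1)\<^sup>2 * (K * slope' K (l * (l + 2))) \<le> - 1 / 2)"
proof -
  define W where "W K l = 1 - (K / 64 + K ^ 2 / 128) * (2 * (l * (l + 2)) - 8)
     + K ^ 3 / 1048576 * (28 * (l * (l + 2)) ^ 3 - 144 * (l * (l + 2)) ^ 2 - 10624 * (l * (l + 2)) + 41984)
     + K ^ 4 / 2097152 * (84 * (l * (l + 2)) ^ 3 - 432 * (l * (l + 2)) ^ 2 - 15488 * (l * (l + 2)) + 60416)
     - 2 * (l + 1)\<^sup>2 * slope' K (l * (l + 2))" for K l :: real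
  have e: "- slope K (l * (l + 2)) - 2 * (l + 1)\<^sup>2 * (K * slope' K (l * (l + 2))) = - 1 + K * W K l" for K l
    unfolding slope_def W_def by (simp add: divide_simps) algebra
  have "continuous_on UNIV (\<lambda>(K, l, C :: real). W K l)"
    unfolding W_def slope'_def case_prod_unfold by (intro continuous_intros) simp_all
  from continuous_bounded_box[OF this, of b] obtain M where M: "M > 0"
    "\<And>K l. K \<in> {0..1} \<Longrightarrow> l \<in> {-b..b} \<Longrightarrow> \<bar>W K l\<bar> \<le> M"
    by fastforce
  define d where "d = min 1 (1 / (2 * M))"
  have "- 1 + K * W K l \<le> - 1 / 2" if "0 \<le> K" "K \<le> d" "l \<in> {-b..b}" for K l
  proof -
    have "K * W K l \<le> K * M"
      using M(2)[of K l] that by (intro mult_left_mono) (auto simp: d_def abs_le_iff)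
    also have "\<dots> \<le> 1 / (2 * M) * M" using that M(1) by (intro mult_right_mono) (auto simp: d_def)
    finally show ?thesis using M(1) by simp
  qed
  then show ?thesis unfolding e using M(1) by (intro exI[of _ d]) (auto simp: d_def)
qed

section \<open>The approximate maximiser and its value\<close>

definition ups_approx :: "real \<Rightarrow> real \<Rightarrow> real" where
  "ups_approx K s = (s - 1) ^ 2 / 2 + (s - 1) * (s + 1) / 2 * K
     - (s ^ 4 - 74 * s ^ 2 + 9) / 128 * K ^ 2
     - (3 * s ^ 2 - 14 * s + 3) * (3 * s ^ 2 + 14 * s + 3) / 256 * K ^ 3
     + (7 * s ^ 8 + 948 * s ^ 6 - 211974 * s ^ 4 + 1781972 * s ^ 2 - 47241) / 2097152 * K ^ 4
     + (133 * s ^ 8 + 15244 * s ^ 6 - 990274 * s ^ 4 + 4389324 * s ^ 2 - 67995) / 4194304 * K ^ 5"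

text \<open>The maximiser up to an error \<open>O(K\<^sup>3)\<close>; as the point is nearly stationary, this gives the
  maximum up to \<open>O(K\<^sup>6)\<close>.\<close>

definition near_max :: "real \<Rightarrow> real \<Rightarrow> real" where
  "near_max K s = s - 1 + K * (s + K * ((37 * s - s ^ 3) / 32))"

lemma near_max_square:
  fixes a s K :: real
  assumes "a = (37 * s - s ^ 3) / 32"
  shows "near_max K s * (near_max K s + 2) =
    (s\<^sup>2 - 1) + K * (2 * s\<^sup>2 + K * ((s\<^sup>2 + 2 * s * a) + K * (2 * s * a + K * a\<^sup>2)))"
  unfolding near_max_def assms[symmetric] by algebra

text \<open>Insert \<open>l + 1 = s + K * s + K\<^sup>2 * a\<close> into the stationarity condition
  \<open>s = (l + 1) * slope\<close>. Order \<open>K\<close> cancels by the choice of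
  \<open>s\<close> as coefficient, and order \<open>K\<^sup>2\<close> determines
  \<open>a\<close>.\<close>

lemma leg_slope_near_max:
  "\<exists>R. continuous_on UNIV R \<and> (\<forall>K. s - (near_max K s + 1) * slope K (near_max K s * (near_max K s + 2)) = K ^ 3 * R K)"
proof -
  define a where "a = (37 * s - s ^ 3) / 32"
  define \<tau> where "\<tau> K = s + K * a" for K
  define \<nu> where "\<nu> K = 2 * s\<^sup>2 + K * ((s\<^sup>2 + 2 * s * a) + K * (2 * s * a + K * a\<^sup>2))" for K
  define n where "n K = (s\<^sup>2 - 1) + K * \<nu> K" for K
  define R where "R K = a - \<tau> K * ((2 * (s\<^sup>2 - 1) - 8) / 64)
     - (s + K * \<tau> K) * (\<nu> K / 32 + (2 * n K - 8) / 128
        - K / 1048576 * (28 * n K ^ 3 - 144 * n K ^ 2 - 10624 * n K + 41984)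
        - K ^ 2 / 2097152 * (84 * n K ^ 3 - 432 * n K ^ 2 - 15488 * n K + 60416))" for K
  \<comment> \<open>The order \<open>K\<^sup>2\<close> condition, which gives
    \<open>a = (37 * s - s ^ 3) / 32\<close>.\<close>
  have sa: "s - a = s * ((2 * (s\<^sup>2 - 1) - 8) / 64)"
    by (simp add: a_def power2_eq_square power3_eq_cube field_simps)
  have "s - (near_max K s + 1) * slope K (near_max K s * (near_max K s + 2)) = K ^ 3 * R K" for K
  proof -
    define q where "q = 28 * n K ^ 3 - 144 * n K ^ 2 - 10624 * n K + 41984"
    define p where "p = 84 * n K ^ 3 - 432 * n K ^ 2 - 15488 * n K + 60416"
    define c where "c = (2 * (s\<^sup>2 - 1) - 8) / 64"
    have 1: "near_max K s + 1 = s + K * \<tau> K" by (simp add: near_max_def \<tau>_def a_def)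
    have 2: "near_max K s * (near_max K s + 2) = n K"
      unfolding n_def \<nu>_def by (rule near_max_square[OF a_def])
    have 3: "slope K (n K) = 1 - K + K\<^sup>2 * (c + K * (\<nu> K / 32)) + K ^ 3 * ((2 * n K - 8) / 128)
       - K ^ 3 * (K / 1048576 * q) - K ^ 3 * (K ^ 2 / 2097152 * p)"
    proof -
      have "(2 * n K - 8) / 64 = c + K * (\<nu> K / 32)" by (simp add: n_def c_def field_simps)
      then show ?thesis unfolding slope_def q_def p_def by (simp add: divide_simps) algebra
    qed
    define X where "X = \<nu> K / 32 + (2 * n K - 8) / 128 - K / 1048576 * q - K ^ 2 / 2097152 * p"
    have 4: "slope K (n K) = 1 - K + K\<^sup>2 * c + K ^ 3 * X"
      unfolding 3 X_def by (simp only: right_diff_distrib distrib_left) algebra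
    have 5: "R K = a - \<tau> K * c - (s + K * \<tau> K) * X" unfolding R_def X_def c_def q_def p_def ..
    have 6: "s - a = s * c" using sa unfolding c_def .
    show ?thesis unfolding 1 2 4 5 using 6 \<tau>_def[of K] by algebra
  qed
  moreover have "continuous_on UNIV R"
    unfolding R_def n_def \<nu>_def \<tau>_def by (intro continuous_intros) simp_all
  ultimately show ?thesis by blast
qed

text \<open>Only terms below \<open>K ^ 6\<close> must cancel, so each power of \<open>n\<close> is
  expanded about \<open>s\<^sup>2 - 1\<close> just as far as its prefactor requires, and the
  remainders stay unexpanded in \<open>R\<close>.\<close>

lemma leg_value_near_max:
  "\<exists>R. continuous_on UNIV R \<and> (\<forall>K. leg K s (near_max K s) - ups_approx K s = K ^ 6 * R K)"
proof -
  define a where "a = (37 * s - s ^ 3) / 32"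
  define n0 where "n0 = s\<^sup>2 - 1"
  define \<nu>0 where "\<nu>0 = 2 * s\<^sup>2"
  define \<nu>' where "\<nu>' K = (s\<^sup>2 + 2 * s * a) + K * (2 * s * a + K * a\<^sup>2)" for K
  define \<nu> where "\<nu> K = \<nu>0 + K * \<nu>' K" for K
  define q1 where "q1 = 28 * n0 ^ 3 - 144 * n0 ^ 2 - 10624 * n0 + 41984"
  define q2 where "q2 K = (42 * n0\<^sup>2 - 144 * n0 - 5312) + (28 * n0 - 48) * (K * \<nu> K) + 7 * (K * \<nu> K)\<^sup>2" for K
  define p1 where "p1 K = (84 * n0 ^ 3 - 432 * n0 ^ 2 - 15488 * n0 + 60416)
     + (126 * n0\<^sup>2 - 432 * n0 - 7744) * (K * \<nu> K) + (84 * n0 - 144) * (K * \<nu> K)\<^sup>2 + 21 * (K * \<nu> K) ^ 3" for K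
  define R where "R K = - (a\<^sup>2 * (2 * n0 - 8) + (\<nu>' K)\<^sup>2 + 2 * \<nu>0 * (2 * s * a + K * a\<^sup>2)) / 128
     - ((2 * s * a + K * a\<^sup>2) * (2 * n0 - 8) + 2 * \<nu>0 * \<nu>' K + K * (\<nu>' K)\<^sup>2) / 256
     + (q1 * \<nu>' K + (\<nu> K)\<^sup>2 * q2 K) / 2097152 + \<nu> K * p1 K / 4194304" for K
  have 1: "near_max K s * (near_max K s + 2) = n0 + K * \<nu> K" for K
    unfolding n0_def \<nu>_def \<nu>0_def \<nu>'_def by (rule near_max_square[OF a_def])
  have 4: "quartic4 (n0 + K * \<nu> K) = quartic4 n0 + K * q1 * \<nu>0 + K\<^sup>2 * (q1 * \<nu>' K + (\<nu> K)\<^sup>2 * q2 K)" for K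
  proof -
    have "quartic4 (n0 + x) = quartic4 n0 + x * q1 + x\<^sup>2 * ((42 * n0\<^sup>2 - 144 * n0 - 5312) + (28 * n0 - 48) * x + 7 * x\<^sup>2)" for x
      unfolding quartic4_def q1_def by algebra
    from this[of "K * \<nu> K"] show ?thesis unfolding q2_def[symmetric] using \<nu>_def[of K] by algebra
  qed
  have 5: "quartic5 (n0 + K * \<nu> K) = quartic5 n0 + K * (\<nu> K * p1 K)" for K
    unfolding quartic5_def p1_def by algebra
  \<comment> \<open>The same quadratic is expanded twice: to remainder order \<open>K ^ 4\<close>
    for the prefactor \<open>K ^ 2\<close>, and, in the next step, to order \<open>K ^ 3\<close> for
    the prefactor \<open>K ^ 3\<close>.\<close>
  have 2: "(n0 + K * \<nu> K)\<^sup>2 - 8 * (n0 + K * \<nu> K) = n0\<^sup>2 - 8 * n0 + K * \<nu>0 * (2 * n0 - 8)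
      + K\<^sup>2 * ((s\<^sup>2 + 2 * s * a) * (2 * n0 - 8) + \<nu>0\<^sup>2) + K ^ 3 * (2 * s * a * (2 * n0 - 8) + 2 * \<nu>0 * (s\<^sup>2 + 2 * s * a))
      + K ^ 4 * (a\<^sup>2 * (2 * n0 - 8) + (\<nu>' K)\<^sup>2 + 2 * \<nu>0 * (2 * s * a + K * a\<^sup>2))" for K
    unfolding \<nu>_def \<nu>'_def by algebra
  have 3: "(n0 + K * \<nu> K)\<^sup>2 - 8 * (n0 + K * \<nu> K) = n0\<^sup>2 - 8 * n0 + K * \<nu>0 * (2 * n0 - 8)
      + K\<^sup>2 * ((s\<^sup>2 + 2 * s * a) * (2 * n0 - 8) + \<nu>0\<^sup>2)
      + K ^ 3 * ((2 * s * a + K * a\<^sup>2) * (2 * n0 - 8) + 2 * \<nu>0 * \<nu>' K + K * (\<nu>' K)\<^sup>2)" for K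
    unfolding \<nu>_def \<nu>'_def by algebra
  have "leg K s (near_max K s) - ups_approx K s = K ^ 6 * R K" for K
  proof -
    define A where "A = a\<^sup>2 * (2 * n0 - 8) + (\<nu>' K)\<^sup>2 + 2 * \<nu>0 * (2 * s * a + K * a\<^sup>2)"
    define B where "B = (2 * s * a + K * a\<^sup>2) * (2 * n0 - 8) + 2 * \<nu>0 * \<nu>' K + K * (\<nu>' K)\<^sup>2"
    define E where "E = q1 * \<nu>' K + (\<nu> K)\<^sup>2 * q2 K"
    define G where "G = \<nu> K * p1 K"
    have R: "R K = - A / 128 - B / 256 + E / 2097152 + G / 4194304"
      unfolding R_def A_def B_def E_def G_def by simp
    have "leg K s (near_max K s) = near_max K s * s - (1 - K) * (n0 + K * \<nu> K) / 2
       - K ^ 2 / 128 * ((n0 + K * \<nu> K)\<^sup>2 - 8 * (n0 + K * \<nu> K))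
       - K ^ 3 / 256 * ((n0 + K * \<nu> K)\<^sup>2 - 8 * (n0 + K * \<nu> K))
       + K ^ 4 / 2097152 * quartic4 (n0 + K * \<nu> K) + K ^ 5 / 4194304 * quartic5 (n0 + K * \<nu> K)"
      unfolding leg_def 1 lam_approx_def by (simp add: algebra_simps)
    also have "\<dots> = near_max K s * s - (1 - K) * (n0 + K * \<nu> K) / 2
       - K ^ 2 / 128 * (n0\<^sup>2 - 8 * n0 + K * \<nu>0 * (2 * n0 - 8)
      + K\<^sup>2 * ((s\<^sup>2 + 2 * s * a) * (2 * n0 - 8) + \<nu>0\<^sup>2) + K ^ 3 * (2 * s * a * (2 * n0 - 8) + 2 * \<nu>0 * (s\<^sup>2 + 2 * s * a))
      + K ^ 4 * A)
       - K ^ 3 / 256 * (n0\<^sup>2 - 8 * n0 + K * \<nu>0 * (2 * n0 - 8)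
      + K\<^sup>2 * ((s\<^sup>2 + 2 * s * a) * (2 * n0 - 8) + \<nu>0\<^sup>2) + K ^ 3 * B)
       + K ^ 4 / 2097152 * (quartic4 n0 + K * q1 * \<nu>0 + K\<^sup>2 * E) + K ^ 5 / 4194304 * (quartic5 n0 + K * G)"
      unfolding A_def B_def E_def G_def 4 5 by (simp only: 2[symmetric] 3[symmetric])
    also have "\<dots> = ups_approx K s + K ^ 6 * R K"
      unfolding R ups_approx_def near_max_def q1_def \<nu>_def \<nu>'_def \<nu>0_def n0_def quartic4_def quartic5_def a_def
      by (simp add: divide_simps) algebra
    finally show ?thesis by simp
  qed
  moreover have "continuous_on UNIV R"
    unfolding R_def q2_def p1_def \<nu>_def \<nu>'_def by (intro continuous_intros) simp_all
  ultimately show ?thesis by blast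
qed

lemma Lam_expansion_uniform:
  "\<exists>d>0. \<exists>M>0. d \<le> 1 \<and> (\<forall>k l. 0 < k \<longrightarrow> k < d \<longrightarrow> \<bar>l\<bar> \<le> b \<longrightarrow>
     \<bar>Lam k l - lam_approx (k\<^sup>2) (l * (l + 2))\<bar> \<le> M * k ^ 12)"
proof -
  have "Lam k l - lam_approx (k\<^sup>2) (l * (l + 2)) = leading_eigenvalue k l - mu_approx (k\<^sup>2) l" for k l
    unfolding Lam_def lam_approx_eq[symmetric] by simp
  then show ?thesis using leading_eigenvalue_expansion[of b] by simp
qed

text \<open>One interval has to contain the exact maximiser, by coercivity, and the approximate
  one.\<close>

lemma near_max_bounded: "\<exists>b\<ge>3 * (\<bar>s\<bar> + 2). \<forall>K\<in>{0..1}. \<bar>near_max K s\<bar> \<le> b"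
proof -
  have "continuous_on UNIV (\<lambda>K. near_max K s)"
    unfolding near_max_def by (intro continuous_intros) simp_all
  then obtain c where "\<forall>K\<in>{0..1}. \<bar>near_max K s\<bar> \<le> c"
    using continuous_bounded_Icc by blast
  then show ?thesis by (intro exI[of _ "max c (3 * (\<bar>s\<bar> + 2))"]) (auto simp: le_max_iff_disj)
qed

text \<open>The constant has three sources: \<open>M1\<close> from replacing \<open>Lam\<close> by
  its expansion, the square of \<open>M2\<close> from the nonzero slope at the approximate
  maximiser, and \<open>M3\<close> from truncating the value there.\<close>

lemma Ups_expansion:
  "\<exists>d>0. \<exists>M. \<forall>k. 0 < k \<longrightarrow> k < d \<longrightarrow> \<bar>Ups k s - ups_approx (k\<^sup>2) s\<bar> \<le> M * k ^ 12"
proof -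
  obtain b where b: "b \<ge> 3 * (\<bar>s\<bar> + 2)" "\<And>K. K \<in> {0..1} \<Longrightarrow> \<bar>near_max K s\<bar> \<le> b"
    using near_max_bounded[of s] by blast
  obtain d1 M1 where 1: "d1 > 0" "M1 > 0" "d1 \<le> 1" "\<And>k l. 0 < k \<Longrightarrow> k < d1 \<Longrightarrow> \<bar>l\<bar> \<le> b \<Longrightarrow>
     \<bar>Lam k l - lam_approx (k\<^sup>2) (l * (l + 2))\<bar> \<le> M1 * k ^ 12"
    using Lam_expansion_uniform[of b] by blast
  obtain d2 where 2: "d2 > 0" "d2 \<le> 1" "\<And>K l. 0 \<le> K \<Longrightarrow> K \<le> d2 \<Longrightarrow> l \<in> {-b..b} \<Longrightarrow>
     - slope K (l * (l + 2)) - 2 * (l + 1)\<^sup>2 * (K * slope' K (l * (l + 2))) \<le> - 1 / 2"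
    using leg_concave[of b] by blast
  obtain R where R: "continuous_on UNIV R"
    "\<And>K. s - (near_max K s + 1) * slope K (near_max K s * (near_max K s + 2)) = K ^ 3 * R K"
    using leg_slope_near_max[of s] by blast
  obtain M2 where M2: "\<And>K. K \<in> {0..1} \<Longrightarrow> \<bar>R K\<bar> \<le> M2"
    using continuous_bounded_Icc[OF R(1)] by blast
  obtain Q where Q: "continuous_on UNIV Q" "\<And>K. leg K s (near_max K s) - ups_approx K s = K ^ 6 * Q K"
    using leg_value_near_max[of s] by blast
  obtain M3 where M3: "\<And>K. K \<in> {0..1} \<Longrightarrow> \<bar>Q K\<bar> \<le> M3"
    using continuous_bounded_Icc[OF Q(1)] by blast
  define d where "d = min d1 (min d2 (1 / 4))"
  have "\<bar>Ups k s - ups_approx (k\<^sup>2) s\<bar> \<le> (M1 + M2\<^sup>2 + M3) * k ^ 12" if k: "0 < k" "k < d" for k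
  proof -
    define K where "K = k\<^sup>2"
    have kd: "k < d1" "k < d2" "k \<le> 1 / 4" using k by (auto simp: d_def)
    have "k\<^sup>2 \<le> k" using k kd by (simp add: power2_eq_square mult_left_le)
    then have K: "0 \<le> K" "K \<le> d2" "K \<in> {0..1}" using kd by (auto simp: K_def)
    have K6: "K ^ 6 = k ^ 12" by (simp add: K_def flip: power_mult)
    obtain l where l: "\<bar>l\<bar> \<le> b" "Ups k s = l * s - Lam k l" "\<And>m. m * s - Lam k m \<le> Ups k s"
      using Ups_attained[OF k(1) kd(3) b(1)] by blast
    define m where "m = near_max K s"
    have m: "\<bar>m\<bar> \<le> b" unfolding m_def by (rule b(2)[OF K(3)])
    have near: "\<bar>leg K s m - ups_approx K s\<bar> \<le> M3 * k ^ 12"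
    proof -
      have "\<bar>K ^ 6 * Q K\<bar> = k ^ 12 * \<bar>Q K\<bar>" using k(1) by (simp add: abs_mult K6)
      also have "\<dots> \<le> k ^ 12 * M3" using M3[OF K(3)] k(1) by (intro mult_left_mono) auto
      finally show ?thesis using Q(2)[of K] by (simp add: m_def mult.commute)
    qed
    have "leg K s l \<le> leg K s m + (s - (m + 1) * slope K (m * (m + 2)))\<^sup>2"
      by (rule quadratic_upper_bound[OF leg_derivatives, where a = "-b" and b = b])
        (use 2(3)[OF K(1,2)] l(1) m in \<open>auto simp: abs_le_iff\<close>)
    also have "(s - (m + 1) * slope K (m * (m + 2)))\<^sup>2 = k ^ 12 * \<bar>R K\<bar>\<^sup>2"
      unfolding m_def R(2) by (simp add: power_mult_distrib K_def flip: power_mult)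
    also have "\<dots> \<le> k ^ 12 * M2\<^sup>2"
      using M2[OF K(3)] k(1) by (intro mult_left_mono power_mono) auto
    finally have upper: "leg K s l \<le> leg K s m + M2\<^sup>2 * k ^ 12" by (simp add: mult.commute)
    have "Ups k s \<le> leg K s l + M1 * k ^ 12"
      using 1(4)[OF k(1) kd(1) l(1)] l(2) by (simp add: leg_def K_def abs_le_iff)
    moreover have "leg K s m - M1 * k ^ 12 \<le> Ups k s"
      using 1(4)[OF k(1) kd(1) m] l(3)[of m] by (simp add: leg_def K_def abs_le_iff)
    moreover have "0 \<le> M2\<^sup>2 * k ^ 12" by simp
    ultimately show ?thesis
      using upper near unfolding K_def[symmetric] distrib_right abs_le_iff by linarith
  qed
  moreover have "d > 0" using 1(1) 2(1) by (simp add: d_def)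
  ultimately show ?thesis by blast
qed

lemma bigo_at_right_0I:
  fixes f :: "real \<Rightarrow> real"
  assumes "d > 0" "\<And>k. 0 < k \<Longrightarrow> k < d \<Longrightarrow> \<bar>f k\<bar> \<le> M * k ^ n"
  shows "f \<in> O[at_right 0](\<lambda>k. k ^ n)"
proof (rule bigoI)
  have "\<forall>\<^sub>F k in at_right 0. k \<in> {0<..<d}"
    by (rule eventually_at_right_real[OF assms(1)])
  then show "\<forall>\<^sub>F k in at_right 0. norm (f k) \<le> M * norm (k ^ n)"
    by eventually_elim (use assms(2) in auto)
qed

text \<open>\<open>GREATEST\<close> is meaningful only when a greatest element exists. The first and
  third conjuncts therefore assert that the maxima defining \<open>leading_eigenvalue\<close> and
  \<open>Ups\<close> are attained for all small positive \<open>k\<close>.\<close>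

theorem mainTheorem3:
  shows
    "(\<forall>\<^sub>F k in at_right 0. \<forall>l. leading_eigenvalue k l \<in> eigenvalues k l \<and>
        (\<forall>\<mu>\<in>eigenvalues k l. \<mu> \<le> leading_eigenvalue k l)) \<and>
     (\<forall>l::real.
        (\<lambda>k. Lam k l -
           (l * (l + 2) / 2
            - l * (l + 2) / 2 * k ^ 2
            + (l - 2) * l * (l + 2) * (l + 4) / 128 * k ^ 4
            + (l - 2) * l * (l + 2) * (l + 4) / 256 * k ^ 6
            - (l - 2) * l * (l + 2) * (l + 4)
                * (7 * l ^ 4 + 28 * l ^ 3 + 36 * l ^ 2 + 16 * l - 5248) / 2097152 * k ^ 8
            - (l - 2) * l * (l + 2) * (l + 4)
                * (21 * l ^ 4 + 84 * l ^ 3 + 108 * l ^ 2 + 48 * l - 7552) / 4194304 * k ^ 10))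
        \<in> O[at_right 0](\<lambda>k. k ^ 12)) \<and>
     (\<forall>s::real. \<forall>\<^sub>F k in at_right 0.
        (\<exists>l. Ups k s = l * s - Lam k l) \<and> (\<forall>l. l * s - Lam k l \<le> Ups k s)) \<and>
     (\<forall>s::real.
        (\<lambda>k. Ups k s -
           ((s - 1) ^ 2 / 2
            + (s - 1) * (s + 1) / 2 * k ^ 2
            - (s ^ 4 - 74 * s ^ 2 + 9) / 128 * k ^ 4
            - (3 * s ^ 2 - 14 * s + 3) * (3 * s ^ 2 + 14 * s + 3) / 256 * k ^ 6
            + (7 * s ^ 8 + 948 * s ^ 6 - 211974 * s ^ 4 + 1781972 * s ^ 2 - 47241)
                / 2097152 * k ^ 8
            + (133 * s ^ 8 + 15244 * s ^ 6 - 990274 * s ^ 4 + 4389324 * s ^ 2 - 67995)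
                / 4194304 * k ^ 10))
        \<in> O[at_right 0](\<lambda>k. k ^ 12))"
    (is "?exists \<and> (\<forall>l. (\<lambda>k. Lam k l - ?L l k) \<in> _) \<and> ?max \<and> (\<forall>s. (\<lambda>k. Ups k s - ?U s k) \<in> _)")
proof (intro conjI allI)
  have "\<forall>\<^sub>F k in at_right 0. k \<in> {0<..<1::real}" by (rule eventually_at_right_real) simp
  then show ?exists
  proof eventually_elim
    fix k :: real assume "k \<in> {0<..<1}"
    then have k: "0 < k" "k < 1" by auto
    show "\<forall>l. leading_eigenvalue k l \<in> eigenvalues k l \<and> (\<forall>\<mu>\<in>eigenvalues k l. \<mu> \<le> leading_eigenvalue k l)"
    proof
      fix l
      obtain u u' u'' where pr: "principal k l (leading_eigenvalue k l) u u' u''"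
        using leading_eigenvalue_principal[OF k] by blast
      show "leading_eigenvalue k l \<in> eigenvalues k l \<and> (\<forall>\<mu>\<in>eigenvalues k l. \<mu> \<le> leading_eigenvalue k l)"
        using principal_eigenvalue[OF k pr] eigenvalue_le_principal[OF k pr] by blast
    qed
  qed
next
  fix l :: real
  have L: "?L l k = l + l\<^sup>2 / 2 + mu_approx (k\<^sup>2) l" for k
    unfolding mu_approx_def mu1_def mu2_def mu3_def mu4_def mu5_def
    by (simp add: divide_simps) algebra
  \<comment> \<open>For a fixed \<open>l\<close> the uniform expansion is used on the interval of
    radius \<open>\<bar>l\<bar>\<close>.\<close>
  obtain d M where "d > 0" "\<And>k. 0 < k \<Longrightarrow> k < d \<Longrightarrow> \<bar>Lam k l - lam_approx (k\<^sup>2) (l * (l + 2))\<bar> \<le> M * k ^ 12"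
    using Lam_expansion_uniform[of "\<bar>l\<bar>"] by blast
  then show "(\<lambda>k. Lam k l - ?L l k) \<in> O[at_right 0](\<lambda>k. k ^ 12)"
    unfolding L lam_approx_eq by (rule bigo_at_right_0I)
next
  fix s :: real
  have "\<forall>\<^sub>F k in at_right 0. k \<in> {0<..<1 / 4::real}" by (rule eventually_at_right_real) simp
  then show "\<forall>\<^sub>F k in at_right 0. (\<exists>l. Ups k s = l * s - Lam k l) \<and> (\<forall>l. l * s - Lam k l \<le> Ups k s)"
  proof eventually_elim
    fix k :: real assume "k \<in> {0<..<1 / 4}"
    then show "(\<exists>l. Ups k s = l * s - Lam k l) \<and> (\<forall>l. l * s - Lam k l \<le> Ups k s)"
      using Ups_attained[of k s "3 * (\<bar>s\<bar> + 2)"] by auto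
  qed
next
  fix s :: real
  have U: "?U s k = ups_approx (k\<^sup>2) s" for k
    unfolding ups_approx_def by (simp flip: power_mult)
  obtain d M where "d > 0" "\<And>k. 0 < k \<Longrightarrow> k < d \<Longrightarrow> \<bar>Ups k s - ups_approx (k\<^sup>2) s\<bar> \<le> M * k ^ 12"
    using Ups_expansion[of s] by blast
  then show "(\<lambda>k. Ups k s - ?U s k) \<in> O[at_right 0](\<lambda>k. k ^ 12)"
    unfolding U by (rule bigo_at_right_0I)
qed

end
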